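(* Let $\Gamma\subset\mathbb{R}$ be a separated set and let $\mathcal{G}\in W\cap C(\mathbb{R})$ be such that $\#\big(\mathrm{Zer}(\hat{\mathcal{G}})\cap(x,x+1)\big)<\infty$ for every $x\in\mathbb{R}$. Then the $\Gamma$-shifts of $\mathcal{G}$ are $l^\infty$-stable if and only if no set $\Gamma^\ast\in W(\Gamma)$ supports a non-zero sparse crystalline measure with bounded coefficients whose spectrum lies in $\mathrm{Zer}(\hat{\mathcal{G}})$.
   Context: Fourier transform: $\hat f(x)=\int_{\mathbb{R}} e^{-2\pi i xt}f(t)\,dt$. $W$ (without argument) denotes the Wiener amalgam space of measurable $f:\mathbb{R}\to\mathbb{C}$ with $\|f\|_W:=\sum_{k\in\mathbb{Z}}\|f\|_{L^\infty(k,k+1)}<\infty$; for $\mathcal{G}\in W$ the function $\hat{\mathcal{G}}$ is continuous, and $\mathrm{Zer}(\hat{\mathcal{G}}):=\{t\in\mathbb{R}:\hat{\mathcal{G}}(t)=0\}$. A set $\Gamma\subset\mathbb{R}$ is separated if $\Delta(\Gamma):=\inf_{\gamma,\gamma'\in\Gamma,\gamma\ne\gamma'}|\gamma-\gamma'|>0$. The $\Gamma$-shifts of $\mathcal{G}$ are $l^\infty$-stable if there exist positive constants $C_1,C_2$ with $C_1\|\mathbf{c}\|_\infty\le\|\sum_{\gamma\in\Gamma}c_\gamma\mathcal{G}(\cdot-\gamma)\|_{\infty}\le C_2\|\mathbf{c}\|_\infty$ for every $\mathbf{c}=\{c_\gamma\}\in l^\infty(\Gamma)$. Weak limits: a sequence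 of separated sets $\Gamma_k\subset\mathbb{R}$ with $\inf_k\Delta(\Gamma_k)>0$ converges weakly to a separated set $\Gamma'\subset\mathbb{R}$ if for every $\epsilon>0$ and $R>0$ there is an integer $l=l(\epsilon,R)$ such that $\Gamma_k\cap(-R,R)\subset\Gamma'+(-\epsilon,\epsilon)$ and $\Gamma'\cap(-R,R)\subset\Gamma_k+(-\epsilon,\epsilon)$ for all $k\ge l$. $W(\Gamma)$ (with argument a separated set) denotes the set of all weak limits of sequences of translates $\Gamma-x_k$, $x_k\in\mathbb{R}$. Crystalline measures: an atomic measure $\mu=\sum_{\lambda\in\Lambda}c_\lambda\delta_\lambda$ (all $c_\lambda\neq0$) is a crystalline measure if $\mu$ is a tempered distribution, its distributional Fourier transform $\hat\mu$ (defined by $\langle\hat\mu,\phi\rangle=\langle\mu,\hat\phi\rangle$ for Schwartz $\phi$) is again an atomic measure $\hat\mu=\sum_{s\in S}a_s\delta_s$ (all $a_s\ne0$), and both the support $\Lambda$ and the spectrum $S$ are locally finite sets. It is sparse if its support $\Lambda$ is separated. It has bounded coefficients if $\sup_\lambda|c_\lambda|<\infty$. A separated set supports a measure $\mu$ if the support of $\mu$ is contained in that set. *)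

theory Defs
  imports "HOL-Analysis.Analysis" "HOL-Probability.Essential_Supremum"
begin

section \<open>Function spaces and the Fourier transform\<close>

definition Linf_norm :: "real set \<Rightarrow> (real \<Rightarrow> complex) \<Rightarrow> ennreal" where
  "Linf_norm A f = esssup (lebesgue_on A) (\<lambda>x. ennreal (norm (f x)))"

definition wiener_norm :: "(real \<Rightarrow> complex) \<Rightarrow> ennreal" where
  "wiener_norm f = (\<Sum>\<^sub>\<infinity>k\<in>(UNIV :: int set). Linf_norm {real_of_int k<..<real_of_int k + 1} f)"

definition wiener_amalgam :: "(real \<Rightarrow> complex) set" where
  "wiener_amalgam = {f. f \<in> borel_measurable lebesgue \<and> wiener_norm f < \<infinity>}"

definition fourier :: "(real \<Rightarrow> complex) \<Rightarrow> real \<Rightarrow> complex" where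
  "fourier f x = (LINT t|lebesgue. exp (- (2 * of_real pi * \<i> * of_real x * of_real t)) * f t)"

definition Zer :: "(real \<Rightarrow> complex) \<Rightarrow> real set" where
  "Zer f = {t. f t = 0}"

section \<open>Separated sets, stability of shifts and weak limits\<close>

text \<open>The infimum is taken in the extended reals, so that sets with at most one point
  have \<open>\<Delta> = \<infinity>\<close> and are separated.\<close>

definition separation :: "real set \<Rightarrow> ereal" where
  "separation \<Gamma> = Inf {ereal \<bar>\<gamma> - \<gamma>'\<bar> | \<gamma> \<gamma>'. \<gamma> \<in> \<Gamma> \<and> \<gamma>' \<in> \<Gamma> \<and> \<gamma> \<noteq> \<gamma>'}"

definition separated_set :: "real set \<Rightarrow> bool" where
  "separated_set \<Gamma> \<longleftrightarrow> separation \<Gamma> > 0"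

text \<open>The shift series is taken pointwise; it converges absolutely at every point when \<open>G\<close> is a
  continuous function in the Wiener amalgam space, \<open>\<Gamma>\<close> is separated and \<open>c\<close> is bounded on \<open>\<Gamma>\<close>.
  Only the values of \<open>c\<close> on \<open>\<Gamma>\<close> matter below.\<close>

definition shift_series :: "real set \<Rightarrow> (real \<Rightarrow> complex) \<Rightarrow> (real \<Rightarrow> complex) \<Rightarrow> real \<Rightarrow> complex" where
  "shift_series \<Gamma> G c x = (\<Sum>\<^sub>\<infinity>\<gamma>\<in>\<Gamma>. c \<gamma> * G (x - \<gamma>))"

definition linf_norm :: "real set \<Rightarrow> (real \<Rightarrow> complex) \<Rightarrow> ennreal" where
  "linf_norm \<Gamma> c = (SUP \<gamma>\<in>\<Gamma>. ennreal (norm (c \<gamma>)))"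

definition linf_stable_shifts :: "real set \<Rightarrow> (real \<Rightarrow> complex) \<Rightarrow> bool" where
  "linf_stable_shifts \<Gamma> G \<longleftrightarrow>
     (\<exists>C1 C2 :: real. C1 > 0 \<and> C2 > 0 \<and>
        (\<forall>c :: real \<Rightarrow> complex. bounded (c ` \<Gamma>) \<longrightarrow>
           ennreal C1 * linf_norm \<Gamma> c \<le> Linf_norm UNIV (shift_series \<Gamma> G c) \<and>
           Linf_norm UNIV (shift_series \<Gamma> G c) \<le> ennreal C2 * linf_norm \<Gamma> c))"

definition fatten :: "real \<Rightarrow> real set \<Rightarrow> real set" where
  "fatten \<epsilon> A = {a + t | a t. a \<in> A \<and> t \<in> {-\<epsilon><..<\<epsilon>}}"

definition converges_weakly :: "(nat \<Rightarrow> real set) \<Rightarrow> real set \<Rightarrow> bool" where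
  "converges_weakly \<Gamma>s \<Gamma>' \<longleftrightarrow>
     (\<forall>k. separated_set (\<Gamma>s k)) \<and> (INF k. separation (\<Gamma>s k)) > 0 \<and> separated_set \<Gamma>' \<and>
     (\<forall>\<epsilon>>0. \<forall>R>0. \<exists>l. \<forall>k\<ge>l.
        \<Gamma>s k \<inter> {-R<..<R} \<subseteq> fatten \<epsilon> \<Gamma>' \<and> \<Gamma>' \<inter> {-R<..<R} \<subseteq> fatten \<epsilon> (\<Gamma>s k))"

definition weak_limits :: "real set \<Rightarrow> real set set" where
  "weak_limits \<Gamma> = {\<Gamma>'. \<exists>x :: nat \<Rightarrow> real. converges_weakly (\<lambda>k. (\<lambda>\<gamma>. \<gamma> - x k) ` \<Gamma>) \<Gamma>'}"

section \<open>Tempered distributions\<close>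

definition nth_deriv :: "nat \<Rightarrow> (real \<Rightarrow> complex) \<Rightarrow> real \<Rightarrow> complex" where
  "nth_deriv n = (\<lambda>f x. vector_derivative f (at x)) ^^ n"

definition smooth :: "(real \<Rightarrow> complex) \<Rightarrow> bool" where
  "smooth f \<longleftrightarrow> (\<forall>n x. nth_deriv n f differentiable (at x))"

definition schwartz_space :: "(real \<Rightarrow> complex) set" where
  "schwartz_space =
     {f. smooth f \<and> (\<forall>m n. bdd_above (range (\<lambda>x. \<bar>x\<bar> ^ m * norm (nth_deriv n f x))))}"

definition schwartz_seminorm :: "nat \<Rightarrow> nat \<Rightarrow> (real \<Rightarrow> complex) \<Rightarrow> real" where
  "schwartz_seminorm m n f = (SUP x. \<bar>x\<bar> ^ m * norm (nth_deriv n f x))"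

definition test_functions :: "(real \<Rightarrow> complex) set" where
  "test_functions = {f. smooth f \<and> compact (closure {x. f x \<noteq> 0})}"

text \<open>A functional is only constrained on the Schwartz space; its values elsewhere are irrelevant.
  Continuity is expressed by the seminorms generating the Schwartz topology.\<close>

definition tempered_distribution :: "((real \<Rightarrow> complex) \<Rightarrow> complex) \<Rightarrow> bool" where
  "tempered_distribution T \<longleftrightarrow>
     (\<forall>f\<in>schwartz_space. \<forall>g\<in>schwartz_space. T (\<lambda>x. f x + g x) = T f + T g) \<and>
     (\<forall>a. \<forall>f\<in>schwartz_space. T (\<lambda>x. a * f x) = a * T f) \<and>
     (\<exists>C N. \<forall>f\<in>schwartz_space. norm (T f) \<le> C * (\<Sum>m\<le>N. \<Sum>n\<le>N. schwartz_seminorm m n f))"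

definition fourier_distr :: "((real \<Rightarrow> complex) \<Rightarrow> complex) \<Rightarrow> (real \<Rightarrow> complex) \<Rightarrow> complex" where
  "fourier_distr T = (\<lambda>\<phi>. T (fourier \<phi>))"

section \<open>Crystalline measures\<close>

text \<open>The atomic measure \<open>\<Sum>\<lambda>. c\<^sub>\<lambda> \<delta>\<^sub>\<lambda>\<close> is represented by its mass function
  \<open>\<mu> :: real \<Rightarrow> complex\<close>, with \<open>\<mu> \<lambda> = c\<^sub>\<lambda>\<close> on the support and \<open>0\<close> elsewhere.\<close>

definition atoms :: "(real \<Rightarrow> complex) \<Rightarrow> real set" where
  "atoms \<mu> = {x. \<mu> x \<noteq> 0}"

definition locally_finite_set :: "real set \<Rightarrow> bool" where
  "locally_finite_set A \<longleftrightarrow> (\<forall>a b. finite (A \<inter> {a..b}))"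

text \<open>A measure with locally finite support need not be absolutely summable against Schwartz
  functions, even if it is a tempered distribution. It is therefore identified with a distribution
  through compactly supported test functions, for which the sum has finitely many nonzero terms;
  by density these determine a tempered distribution.\<close>

definition is_atomic_measure :: "((real \<Rightarrow> complex) \<Rightarrow> complex) \<Rightarrow> (real \<Rightarrow> complex) \<Rightarrow> bool" where
  "is_atomic_measure T \<mu> \<longleftrightarrow>
     (\<forall>\<phi>\<in>test_functions. T \<phi> = (\<Sum>\<^sub>\<infinity>x\<in>atoms \<mu>. \<mu> x * \<phi> x))"

text \<open>\<open>crystalline_measure \<mu> \<nu>\<close>: the measure \<open>\<mu>\<close> is crystalline with Fourier transform \<open>\<nu>\<close>, so
  that \<open>atoms \<mu>\<close> is its support and \<open>atoms \<nu>\<close> its spectrum.\<close>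

definition crystalline_measure :: "(real \<Rightarrow> complex) \<Rightarrow> (real \<Rightarrow> complex) \<Rightarrow> bool" where
  "crystalline_measure \<mu> \<nu> \<longleftrightarrow>
     locally_finite_set (atoms \<mu>) \<and> locally_finite_set (atoms \<nu>) \<and>
     (\<exists>T. tempered_distribution T \<and> is_atomic_measure T \<mu> \<and>
          is_atomic_measure (fourier_distr T) \<nu>)"

definition sparse_measure :: "(real \<Rightarrow> complex) \<Rightarrow> bool" where
  "sparse_measure \<mu> \<longleftrightarrow> separated_set (atoms \<mu>)"

definition bounded_coefficients :: "(real \<Rightarrow> complex) \<Rightarrow> bool" where
  "bounded_coefficients \<mu> \<longleftrightarrow> bounded (\<mu> ` atoms \<mu>)"

definition supports_measure :: "real set \<Rightarrow> (real \<Rightarrow> complex) \<Rightarrow> bool" where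
  "supports_measure \<Gamma> \<mu> \<longleftrightarrow> atoms \<mu> \<subseteq> \<Gamma>"

end

theory Submission
  imports Defs "HOL-Probability.Characteristic_Functions"
begin

text \<open>
Between stability and crystalline measures stands a third condition: some weak limit \<open>\<Gamma>'\<close> of
translates of \<open>\<Gamma>\<close> carries a bounded family \<open>c \<noteq> 0\<close> whose shift series
\<open>\<Sum>g\<in>\<Gamma>'. c g * G (x - g)\<close> vanishes for every \<open>x\<close>. Call this a null series.

Stability against null series. The upper stability bound always holds, because \<open>G\<close> is summable over
unit cells and each cell meets a separated set in boundedly many points. If the lower bound fails,
there are weights of norm at most 1 on \<open>\<Gamma>\<close> with arbitrarily small series. Translating a node with a
large weight to the origin and passing to a limit of nodes and weights
(\<open>spaced_sets_compactness\<close>) produces a null series (\<open>unstable_imp_null_series\<close>). Conversely, a null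
series multiplied by a very flat tent is a finite sum that is small everywhere but has kept one of
its weights (\<open>truncated_null_series_small\<close>); its nodes can be moved to nodes of a translate of \<open>\<Gamma>\<close>,
which contradicts the lower bound (\<open>stable_imp_no_null_series\<close>).

Null series against crystalline measures. For a test function \<open>f\<close> let
\<open>v x = \<Sum>g. c g * fourier f (g - x)\<close>. Then \<open>v 0\<close> is the value at \<open>f\<close> of the Fourier transform of the
measure \<open>\<Sum>g. c g \<delta>\<^sub>g\<close>, and \<open>v x\<close> is its value at \<open>f\<close> times the character of frequency \<open>x\<close>. The
convolution of \<open>G\<close> with \<open>v\<close> equals the pairing of the shift series with a translate of
\<open>fourier f\<close> (\<open>wave_shift_series\<close>).

If the measure is crystalline with spectrum in the zeros of \<open>fourier G\<close>, then \<open>v\<close> is a finite sum of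
exponentials that convolution with \<open>G\<close> annihilates. So the shift series is orthogonal to all
translates of \<open>fourier f\<close>, and it vanishes since these contain an approximate identity
(\<open>null_of_crystalline\<close>).

If the shift series vanishes, then so does the convolution of \<open>G\<close> with every \<open>v\<close>. When \<open>f\<close> is
supported in a short interval around \<open>s\<close>, the function \<open>v\<close> is almost an exponential of frequency \<open>s\<close>
on long intervals (\<open>wave_almost_constant\<close>), and convolution with \<open>G\<close> is almost multiplication by
\<open>fourier G s\<close>. If this number is not zero, the error is a contraction in the supremum norm and
\<open>v = 0\<close> (\<open>wave_local_vanish\<close>); this takes the place of the division step in Wiener's Tauberian
theorem. If \<open>s\<close> is an isolated zero, the interval may be shrunk arbitrarily, so \<open>v\<close> is exactly a
multiple of one exponential (\<open>wave_isolated\<close>). Because \<open>v\<close> is bounded, no polynomial factors appear: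
near \<open>s\<close> the Fourier transform of the measure is a multiple of a point mass, without derivatives. A
partition of unity glues these local statements together (\<open>wave_atomic\<close>).
\<close>

section \<open>Sums over spaced sets\<close>

text \<open>The gap is taken of the form \<open>1 / N\<close> with an integer \<open>N\<close>, so that \<open>\<lfloor>N a\<rfloor>\<close> labels the points
  of a spaced set injectively and every unit cell uses \<open>N\<close> consecutive labels.\<close>

definition spaced :: "int \<Rightarrow> real set \<Rightarrow> bool" where
  "spaced N A \<longleftrightarrow> N > 0 \<and> (\<forall>a\<in>A. \<forall>b\<in>A. a \<noteq> b \<longrightarrow> 1 \<le> of_int N * \<bar>a - b\<bar>)"

lemma spaced_subset: "spaced N A \<Longrightarrow> B \<subseteq> A \<Longrightarrow> spaced N B"
  unfolding spaced_def by blast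

lemma separated_set_imp_spaced:
  assumes "separated_set A"
  obtains N where "spaced N A"
proof -
  have pos: "separation A > 0" using assms by (simp add: separated_set_def)
  obtain e where e: "0 < ereal e" "ereal e < separation A"
    using ereal_dense2[OF pos] by blast
  obtain n where n: "1 / e < real n" using reals_Archimedean2 by blast
  have en: "e > 0" using e by simp
  have npos: "n > 0" using n en by (metis divide_pos_pos gr0I less_asym of_nat_0 zero_less_one)
  have "1 \<le> real n * \<bar>a - b\<bar>" if "a \<in> A" "b \<in> A" "a \<noteq> b" for a b
  proof -
    have "separation A \<le> ereal \<bar>a - b\<bar>"
      unfolding separation_def using that by (intro Inf_lower) blast
    then have "e \<le> \<bar>a - b\<bar>" using e by (metis ereal_less_eq(3) less_le_trans order_less_imp_le)
    have "1 < real n * e" using n en by (simp add: field_simps)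
    also have "\<dots> \<le> real n * \<bar>a - b\<bar>" using \<open>e \<le> _\<close> by (intro mult_left_mono) auto
    finally show ?thesis by simp
  qed
  then have "spaced (int n) A" using npos unfolding spaced_def by auto
  then show ?thesis by (rule that)
qed

lemma spaced_imp_separated_set:
  assumes "spaced N A"
  shows "separated_set A" "ereal (1 / of_int N) \<le> separation A"
proof -
  show *: "ereal (1 / of_int N) \<le> separation A"
    unfolding separation_def using assms
    by (intro Inf_greatest) (auto simp: spaced_def field_simps)
  have "0 < ereal (1 / of_int N)" using assms by (auto simp: spaced_def)
  then show "separated_set A" unfolding separated_set_def using * by (rule less_le_trans)
qed

lemma spaced_floor_inj:
  assumes "spaced N A" "a \<in> A" "b \<in> A" "\<lfloor>of_int N * a\<rfloor> = \<lfloor>of_int N * b\<rfloor>"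
  shows "a = b"
proof (rule ccontr)
  assume "a \<noteq> b"
  have N: "N > 0" using assms by (simp add: spaced_def)
  have "1 \<le> real_of_int N * \<bar>a - b\<bar>" using assms \<open>a \<noteq> b\<close> by (simp add: spaced_def)
  also have "\<dots> = \<bar>real_of_int N * a - real_of_int N * b\<bar>"
    using N by (simp add: abs_mult flip: right_diff_distrib)
  finally show False using assms(4) by linarith
qed

lemma spaced_countable:
  assumes "spaced N A" shows "countable A"
proof -
  have "inj_on (\<lambda>a. \<lfloor>real_of_int N * a\<rfloor>) A"
    by (rule inj_onI) (use spaced_floor_inj[OF assms] in blast)
  then show ?thesis by (rule countableI')  
qed

lemma spaced_finite_Icc:
  assumes "spaced N A" shows "finite (A \<inter> {a..b})"
proof -
  have N: "N > 0" using assms by (simp add: spaced_def)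
  have "inj_on (\<lambda>a. \<lfloor>real_of_int N * a\<rfloor>) (A \<inter> {a..b})"
    by (rule inj_onI) (use spaced_floor_inj[OF assms] in blast)
  moreover have "(\<lambda>a. \<lfloor>real_of_int N * a\<rfloor>) ` (A \<inter> {a..b}) \<subseteq> {\<lfloor>real_of_int N * a\<rfloor>..\<lfloor>real_of_int N * b\<rfloor>}"
    using N by (auto intro!: floor_mono)
  ultimately show ?thesis by (meson finite_atLeastAtMost_int inj_on_finite)
qed

lemma spaced_image_diff: "spaced N ((\<lambda>g. x - g) ` A) \<longleftrightarrow> spaced N A"
  unfolding spaced_def by (auto simp: abs_minus_commute)

lemma spaced_image_diff': "spaced N ((\<lambda>g. g - x) ` A) \<longleftrightarrow> spaced N A"
  unfolding spaced_def by auto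

text \<open>A majorant for the amalgam norm that is constant on the cells \<open>[k, k + 1)\<close>. It is available both for
  continuous functions in the Wiener space and for Fourier transforms of test functions, and the
  estimates below depend on the function only through it.\<close>

definition amalg :: "(int \<Rightarrow> real) \<Rightarrow> (real \<Rightarrow> 'a::real_normed_vector) \<Rightarrow> bool" where
  "amalg B f \<longleftrightarrow> (\<forall>k. 0 \<le> B k) \<and> B summable_on UNIV \<and> (\<forall>x. norm (f x) \<le> B \<lfloor>x\<rfloor>)"

lemma amalgD:
  assumes "amalg B f"
  shows "0 \<le> B k" "B summable_on A" "norm (f x) \<le> B \<lfloor>x\<rfloor>"
  using assms by (auto simp: amalg_def intro: summable_on_subset)

text \<open>A unit cell contains at most \<open>N\<close> points of a spaced set, because their labels \<open>\<lfloor>N y\<rfloor>\<close> are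
  distinct and lie among \<open>N\<close> consecutive integers.\<close>

lemma spaced_sum_cells:
  fixes B :: "int \<Rightarrow> real"
  assumes F: "finite F" "spaced N F" and B: "\<And>k. 0 \<le> B k" "B summable_on UNIV"
  shows "(\<Sum>y\<in>F. B \<lfloor>y\<rfloor>) \<le> of_int N * (\<Sum>\<^sub>\<infinity>k. B k)"
proof -
  have N: "N > 0" using F by (simp add: spaced_def)
  let ?R = "floor ` F"
  have card: "card {y \<in> F. \<lfloor>y\<rfloor> = k} \<le> nat N" for k
  proof -
    have "inj_on (\<lambda>a. \<lfloor>real_of_int N * a\<rfloor>) {y \<in> F. \<lfloor>y\<rfloor> = k}"
      by (rule inj_onI) (use spaced_floor_inj[OF F(2)] in blast)
    moreover have "(\<lambda>a. \<lfloor>real_of_int N * a\<rfloor>) ` {y \<in> F. \<lfloor>y\<rfloor> = k} \<subseteq> {N * k..<N * k + N}"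
    proof clarsimp
      fix y assume "y \<in> F"
      have "real_of_int (N * \<lfloor>y\<rfloor>) \<le> real_of_int N * y" using N by simp
      then have 1: "N * \<lfloor>y\<rfloor> \<le> \<lfloor>real_of_int N * y\<rfloor>" by (simp add: le_floor_iff)
      have "real_of_int N * y < real_of_int N * (of_int \<lfloor>y\<rfloor> + 1)"
        using N by (intro mult_strict_left_mono) linarith+
      also have "\<dots> = real_of_int (N * \<lfloor>y\<rfloor> + N)" by (simp add: algebra_simps)
      finally have "\<lfloor>real_of_int N * y\<rfloor> < N * \<lfloor>y\<rfloor> + N" by (simp only: floor_less_iff)
      with 1 show "N * \<lfloor>y\<rfloor> \<le> \<lfloor>real_of_int N * y\<rfloor> \<and> \<lfloor>real_of_int N * y\<rfloor> < N * \<lfloor>y\<rfloor> + N" by simp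
    qed
    ultimately have "card {y \<in> F. \<lfloor>y\<rfloor> = k} \<le> card {N * k..<N * k + N}"
      by (intro card_inj_on_le) auto
    then show ?thesis by simp
  qed
  have "(\<Sum>y\<in>F. B \<lfloor>y\<rfloor>) = (\<Sum>k\<in>?R. of_nat (card {y \<in> F. \<lfloor>y\<rfloor> = k}) * B k)"
    using F by (intro sum_fun_comp) auto
  also have "\<dots> \<le> (\<Sum>k\<in>?R. of_int N * B k)"
  proof (intro sum_mono mult_right_mono B)
    fix k
    have "int (card {y \<in> F. \<lfloor>y\<rfloor> = k}) \<le> N" using card[of k] N by linarith
    then show "real (card {y \<in> F. \<lfloor>y\<rfloor> = k}) \<le> of_int N" by (metis of_int_le_iff of_int_of_nat_eq)
  qed
  also have "\<dots> = of_int N * (\<Sum>k\<in>?R. B k)" by (simp add: sum_distrib_left)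
  also have "\<dots> \<le> of_int N * (\<Sum>\<^sub>\<infinity>k. B k)"
    using N F B by (intro mult_left_mono finite_sum_le_infsum) auto
  finally show ?thesis .
qed

lemma amalg_nonneg: "amalg B f \<Longrightarrow> 0 \<le> (\<Sum>\<^sub>\<infinity>k. B k)"
  by (intro infsum_nonneg) (auto simp: amalg_def)

lemma amalg_finite_sum:
  assumes "amalg B f" "spaced N A" "finite F" "F \<subseteq> A"
  shows "(\<Sum>g\<in>F. norm (f (x - g))) \<le> of_int N * (\<Sum>\<^sub>\<infinity>k. B k)"
    and "(\<Sum>g\<in>F. norm (f (g - x))) \<le> of_int N * (\<Sum>\<^sub>\<infinity>k. B k)"
proof -
  have sp: "spaced N F" using assms spaced_subset by blast
  have "(\<Sum>g\<in>F. norm (f (x - g))) \<le> (\<Sum>g\<in>F. B \<lfloor>x - g\<rfloor>)"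
    by (intro sum_mono amalgD(3)[OF assms(1)])
  also have "\<dots> = (\<Sum>y\<in>(\<lambda>g. x - g) ` F. B \<lfloor>y\<rfloor>)" by (subst sum.reindex) (auto simp: inj_on_def)
  also have "\<dots> \<le> of_int N * (\<Sum>\<^sub>\<infinity>k. B k)"
    using assms sp by (intro spaced_sum_cells) (auto simp: spaced_image_diff amalg_def)
  finally show "(\<Sum>g\<in>F. norm (f (x - g))) \<le> of_int N * (\<Sum>\<^sub>\<infinity>k. B k)" .
  have "(\<Sum>g\<in>F. norm (f (g - x))) \<le> (\<Sum>g\<in>F. B \<lfloor>g - x\<rfloor>)"
    by (intro sum_mono amalgD(3)[OF assms(1)])
  also have "\<dots> = (\<Sum>y\<in>(\<lambda>g. g - x) ` F. B \<lfloor>y\<rfloor>)" by (subst sum.reindex) (auto simp: inj_on_def)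
  also have "\<dots> \<le> of_int N * (\<Sum>\<^sub>\<infinity>k. B k)"
    using assms sp by (intro spaced_sum_cells) (auto simp: spaced_image_diff' amalg_def)
  finally show "(\<Sum>g\<in>F. norm (f (g - x))) \<le> of_int N * (\<Sum>\<^sub>\<infinity>k. B k)" .
qed

text \<open>Uniform bounds on finite partial sums are what \<open>amalg_finite_sum\<close> delivers; here they are turned into
  statements about unordered sums.\<close>

lemma bounded_sums_imp_summable:
  fixes h :: "'i \<Rightarrow> 'a::banach"
  assumes "\<And>F. finite F \<Longrightarrow> F \<subseteq> A \<Longrightarrow> (\<Sum>g\<in>F. norm (h g)) \<le> C"
  shows "(\<lambda>g. norm (h g)) summable_on A" "(\<Sum>\<^sub>\<infinity>g\<in>A. norm (h g)) \<le> C"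
    "h summable_on A" "norm (\<Sum>\<^sub>\<infinity>g\<in>A. h g) \<le> C"
proof -
  show 1: "(\<lambda>g. norm (h g)) summable_on A"
    using assms by (intro nonneg_bounded_partial_sums_imp_summable_on[of _ _ C] eventually_finite_subsets_at_top_weakI) auto
  show 2: "(\<Sum>\<^sub>\<infinity>g\<in>A. norm (h g)) \<le> C" by (rule infsum_le_finite_sums[OF 1]) (use assms in auto)
  show "h summable_on A" by (rule abs_summable_summable[OF 1])
  show "norm (\<Sum>\<^sub>\<infinity>g\<in>A. h g) \<le> C" using norm_infsum_bound[OF 1] 2 by linarith
qed

lemma weighted_finite_sum:
  fixes f :: "real \<Rightarrow> complex"
  assumes "finite F" "F \<subseteq> A" and c: "\<And>g. g \<in> A \<Longrightarrow> norm (c g) \<le> M"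
    and S: "(\<Sum>g\<in>F. norm (f g)) \<le> S" and M: "0 \<le> M"
  shows "(\<Sum>g\<in>F. norm (c g * f g :: complex)) \<le> M * S"
proof -
  have "(\<Sum>g\<in>F. norm (c g * f g)) \<le> (\<Sum>g\<in>F. M * norm (f g))"
    using assms by (intro sum_mono) (auto simp: norm_mult intro!: mult_right_mono)
  also have "\<dots> = M * (\<Sum>g\<in>F. norm (f g))" by (simp add: sum_distrib_left)
  also have "\<dots> \<le> M * S" using S M by (intro mult_left_mono)
  finally show ?thesis .
qed

text \<open>Tannery's theorem for unordered sums: dominated convergence for the counting measure.\<close>

lemma infsum_dominated_convergence:
  fixes f :: "nat \<Rightarrow> 'i \<Rightarrow> 'b::{banach, second_countable_topology}"
  assumes h: "h summable_on A" and le: "\<And>n i. i \<in> A \<Longrightarrow> norm (f n i) \<le> h i"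
    and lim: "\<And>i. i \<in> A \<Longrightarrow> (\<lambda>n. f n i) \<longlonglongrightarrow> g i"
  shows "(\<lambda>n. \<Sum>\<^sub>\<infinity>i\<in>A. f n i) \<longlonglongrightarrow> (\<Sum>\<^sub>\<infinity>i\<in>A. g i)"
proof -
  have h0: "0 \<le> h i" if "i \<in> A" for i using le[OF that, of 0] norm_ge_zero order_trans by blast
  have hn: "(\<lambda>i. norm (h i)) summable_on A"
    using h by (rule summable_on_cong[THEN iffD1, rotated]) (use h0 in auto)
  have int_h: "integrable (count_space A) h"
    using hn abs_summable_equivalent[of h A] by (simp only: Infinite_Set_Sum.abs_summable_on_def)
  have fs: "Infinite_Set_Sum.abs_summable_on (f n) A" for n
    unfolding abs_summable_equivalent[symmetric]
    by (rule Infinite_Sum.abs_summable_on_comparison_test[OF hn]) (use le h0 in auto)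
  have gb: "norm (g i) \<le> h i" if "i \<in> A" for i
    using lim[OF that] le[OF that] by (intro LIMSEQ_le_const2[OF tendsto_norm]) auto
  have gs: "Infinite_Set_Sum.abs_summable_on g A"
    unfolding abs_summable_equivalent[symmetric]
    by (rule Infinite_Sum.abs_summable_on_comparison_test[OF hn]) (use gb h0 in auto)
  have "(\<lambda>n. integral\<^sup>L (count_space A) (f n)) \<longlonglongrightarrow> integral\<^sup>L (count_space A) g"
    by (rule integral_dominated_convergence[where w=h]) (use int_h lim le in \<open>auto simp: AE_count_space\<close>)
  then show ?thesis
    using infsetsum_infsum[OF fs] infsetsum_infsum[OF gs] by (simp add: infsetsum_def)
qed

lemma reciprocal_tendsto_0: "(\<lambda>n. 1 / (1 + real n)) \<longlonglongrightarrow> 0"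
  using LIMSEQ_inverse_real_of_nat by (simp add: inverse_eq_divide add.commute)

text \<open>Domination is required of the finite partial sums, pointwise in \<open>x\<close>, since this is the form in which
  sums over spaced sets are estimated. After an enumeration of \<open>A\<close> it is dominated convergence.\<close>

lemma integral_infsum_swap:
  fixes f :: "'i \<Rightarrow> 'x \<Rightarrow> complex"
  assumes A: "countable A" and meas: "\<And>i. i \<in> A \<Longrightarrow> f i \<in> borel_measurable M"
    and w: "integrable M w"
    and dom: "\<And>F x. finite F \<Longrightarrow> F \<subseteq> A \<Longrightarrow> (\<Sum>i\<in>F. norm (f i x)) \<le> w x"
  shows "(\<integral>x. (\<Sum>\<^sub>\<infinity>i\<in>A. f i x) \<partial>M) = (\<Sum>\<^sub>\<infinity>i\<in>A. \<integral>x. f i x \<partial>M)"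
    and "integrable M (\<lambda>x. \<Sum>\<^sub>\<infinity>i\<in>A. f i x)"
proof -
  have int: "integrable M (f i)" if "i \<in> A" for i
  proof (rule Bochner_Integration.integrable_bound[OF w meas[OF that]], intro AE_I2)
    fix x show "norm (f i x) \<le> norm (w x)" using dom[of "{i}" x] that by auto
  qed
  have sm: "(\<lambda>i. f i x) summable_on A" for x by (rule bounded_sums_imp_summable(3)[of A _ "w x"]) (rule dom)
  have w0: "0 \<le> w x" for x using dom[of "{}" x] by simp
  have ism: "(\<lambda>i. \<integral>x. f i x \<partial>M) summable_on A"
  proof (rule bounded_sums_imp_summable(3)[of A _ "\<integral>x. w x \<partial>M"])
    fix F assume F: "finite F" "F \<subseteq> A"
    have "(\<Sum>i\<in>F. norm (\<integral>x. f i x \<partial>M)) \<le> (\<Sum>i\<in>F. (\<integral>x. norm (f i x) \<partial>M))"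
      by (intro sum_mono integral_norm_bound)
    also have "\<dots> = (\<integral>x. (\<Sum>i\<in>F. norm (f i x)) \<partial>M)"
      using F int by (intro Bochner_Integration.integral_sum[symmetric]) auto
    also have "\<dots> \<le> (\<integral>x. w x \<partial>M)"
      using F int w dom by (intro integral_mono) (auto intro!: Bochner_Integration.integrable_sum)
    finally show "(\<Sum>i\<in>F. norm (\<integral>x. f i x \<partial>M)) \<le> (\<integral>x. w x \<partial>M)" .
  qed
  have "(\<integral>x. (\<Sum>\<^sub>\<infinity>i\<in>A. f i x) \<partial>M) = (\<Sum>\<^sub>\<infinity>i\<in>A. \<integral>x. f i x \<partial>M) \<and> integrable M (\<lambda>x. \<Sum>\<^sub>\<infinity>i\<in>A. f i x)"
  proof (cases "finite A")
    case True
    then show ?thesis using int by auto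
  next
    case False
    define e where "e = from_nat_into A"
    have e: "bij_betw e UNIV A" unfolding e_def using A False by (rule bij_betw_from_nat_into)
    then have eA: "e n \<in> A" for n by (auto simp: bij_betw_def)
    have lim: "(\<lambda>n. \<Sum>k<n. f (e k) x) \<longlonglongrightarrow> (\<Sum>\<^sub>\<infinity>i\<in>A. f i x)" for x
    proof -
      have "((\<lambda>k. f (e k) x) has_sum (\<Sum>\<^sub>\<infinity>i\<in>A. f i x)) UNIV"
        using has_sum_infsum[OF sm[of x]] has_sum_reindex_bij_betw[OF e, of "\<lambda>i. f i x"] by simp
      then show ?thesis using has_sum_imp_sums sums_def by blast
    qed
    have lim2: "(\<lambda>n. \<Sum>k<n. \<integral>x. f (e k) x \<partial>M) \<longlonglongrightarrow> (\<Sum>\<^sub>\<infinity>i\<in>A. \<integral>x. f i x \<partial>M)"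
    proof -
      have "((\<lambda>k. \<integral>x. f (e k) x \<partial>M) has_sum (\<Sum>\<^sub>\<infinity>i\<in>A. \<integral>x. f i x \<partial>M)) UNIV"
        using has_sum_infsum[OF ism] has_sum_reindex_bij_betw[OF e, of "\<lambda>i. \<integral>x. f i x \<partial>M"] by simp
      then show ?thesis using has_sum_imp_sums sums_def by blast
    qed
    have m: "(\<lambda>x. \<Sum>\<^sub>\<infinity>i\<in>A. f i x) \<in> borel_measurable M"
      by (rule borel_measurable_LIMSEQ_metric[where f="\<lambda>n x. \<Sum>k<n. f (e k) x"]) (use lim meas eA in auto)
    have bd: "norm (\<Sum>k<n. f (e k) x) \<le> w x" for n x
    proof -
      have "(\<Sum>k<n. norm (f (e k) x)) = (\<Sum>i\<in>e ` {..<n}. norm (f i x))"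
        using e by (subst sum.reindex) (auto simp: bij_betw_def inj_on_def)
      also have "\<dots> \<le> w x" using eA by (intro dom) auto
      finally show ?thesis using norm_sum[of "\<lambda>k. f (e k) x" "{..<n}"] by linarith
    qed
    have D: "(\<lambda>n. \<integral>x. (\<Sum>k<n. f (e k) x) \<partial>M) \<longlonglongrightarrow> (\<integral>x. (\<Sum>\<^sub>\<infinity>i\<in>A. f i x) \<partial>M)"
      by (rule integral_dominated_convergence[where w=w]) (use m w lim bd meas eA in auto)
    have I: "integrable M (\<lambda>x. \<Sum>\<^sub>\<infinity>i\<in>A. f i x)"
      by (rule integrable_dominated_convergence[where w=w and s="\<lambda>n x. \<Sum>k<n. f (e k) x"])
         (use m w lim bd meas eA in auto)
    have "(\<integral>x. (\<Sum>k<n. f (e k) x) \<partial>M) = (\<Sum>k<n. \<integral>x. f (e k) x \<partial>M)" for n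
      using int eA by (intro Bochner_Integration.integral_sum) auto
    then show ?thesis using D I lim2 by (auto intro: LIMSEQ_unique)
  qed
  then show "(\<integral>x. (\<Sum>\<^sub>\<infinity>i\<in>A. f i x) \<partial>M) = (\<Sum>\<^sub>\<infinity>i\<in>A. \<integral>x. f i x \<partial>M)"
    and "integrable M (\<lambda>x. \<Sum>\<^sub>\<infinity>i\<in>A. f i x)" by auto
qed

text \<open>The cell majorant is a step function with integral \<open>\<Sum>k. B k\<close>.\<close>

lemma amalg_integrable:
  fixes f :: "real \<Rightarrow> 'a::{banach, second_countable_topology}"
  assumes f: "amalg B f" "f \<in> borel_measurable borel"
  shows "integrable lborel f"
proof -
  define e where "e = from_nat_into (UNIV :: int set)"
  have e: "bij_betw e UNIV (UNIV :: int set)" unfolding e_def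
    by (rule bij_betw_from_nat_into) (auto simp: infinite_UNIV_int)
  have sB: "summable (\<lambda>n. B (e n))"
  proof -
    have "(\<lambda>n. B (e n)) summable_on UNIV"
      using amalgD(2)[OF f(1), of UNIV] summable_on_reindex_bij_betw[OF e, of B] by simp
    then show ?thesis by (rule summable_on_imp_summable)
  qed
  let ?s = "\<lambda>n (x::real). B (e n) * indicat_real {of_int (e n)..<of_int (e n) + 1} x"
  have single: "?s n x = (if \<lfloor>x\<rfloor> = e n then B \<lfloor>x\<rfloor> else 0)" for n x
    using floor_eq_iff[of x "e n"] by (auto simp: indicator_def)
  have sums: "(\<lambda>n. ?s n x) sums B \<lfloor>x\<rfloor>" for x
  proof -
    obtain m where m: "e m = \<lfloor>x\<rfloor>" using e by (metis UNIV_I bij_betw_iff_bijections)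
    have "?s n x = (if n = m then B \<lfloor>x\<rfloor> else 0)" for n
      unfolding single using m e by (metis UNIV_I bij_betw_iff_bijections)
    then show ?thesis using sums_single[of m "\<lambda>_. B \<lfloor>x\<rfloor>"] by simp
  qed
  have "integrable lborel (\<lambda>x. \<Sum>n. ?s n x)"
  proof (rule integrable_suminf)
    show "integrable lborel (?s n)" for n by simp
    have nn: "norm (?s n x) = ?s n x" for n x using amalgD(1)[OF f(1)] by (auto simp: indicator_def)
    show "AE x in lborel. summable (\<lambda>n. norm (?s n x))"
      unfolding nn using sums by (auto intro: sums_summable)
    show "summable (\<lambda>n. \<integral>x. norm (?s n x) \<partial>lborel)"
      unfolding nn using sB by simp
  qed
  then have "integrable lborel (\<lambda>x::real. B \<lfloor>x\<rfloor>)" using sums by (simp add: sums_iff)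
  then show ?thesis
    by (rule Bochner_Integration.integrable_bound) (use f amalgD[OF f(1)] in auto)
qed

text \<open>A point moved by at most one stays in its cell or enters a neighbouring one. Hence \<open>nbr_sum B\<close> dominates
  all translates of a function by at most one simultaneously, which gives uniform majorants for limits
  along moving points.\<close>

definition nbr_sum :: "(int \<Rightarrow> real) \<Rightarrow> int \<Rightarrow> real" where
  "nbr_sum B k = B (k - 1) + B k + B (k + 1)"

lemma nbr_sum:
  assumes "amalg B f"
  shows "0 \<le> nbr_sum B k" "nbr_sum B summable_on UNIV"
    "\<bar>u - x\<bar> \<le> 1 \<Longrightarrow> norm (f u) \<le> nbr_sum B \<lfloor>x\<rfloor>"
proof -
  note B = amalgD[OF assms]
  show "0 \<le> nbr_sum B k" unfolding nbr_sum_def using B(1) by (simp add: add_nonneg_nonneg)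
  have "(\<lambda>k. B (k + 1)) summable_on UNIV"
    using summable_on_reindex_bij_betw[of "\<lambda>k::int. k + 1" UNIV UNIV B] B(2)[of UNIV]
    by (simp add: bij_betw_def inj_on_def)
  moreover have "(\<lambda>k. B (k - 1)) summable_on UNIV"
    using summable_on_reindex_bij_betw[of "\<lambda>k::int. k - 1" UNIV UNIV B] B(2)[of UNIV]
    by (simp add: bij_betw_def inj_on_def)
  ultimately show "nbr_sum B summable_on UNIV"
    unfolding nbr_sum_def[abs_def] using B(2)[of UNIV] by (intro summable_on_add) auto
  assume "\<bar>u - x\<bar> \<le> 1"
  then have "\<lfloor>u\<rfloor> = \<lfloor>x\<rfloor> - 1 \<or> \<lfloor>u\<rfloor> = \<lfloor>x\<rfloor> \<or> \<lfloor>u\<rfloor> = \<lfloor>x\<rfloor> + 1" by linarith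
  then show "norm (f u) \<le> nbr_sum B \<lfloor>x\<rfloor>"
    unfolding nbr_sum_def using B(3)[of u] B(1)[of "\<lfloor>x\<rfloor>"] B(1)[of "\<lfloor>x\<rfloor> - 1"] B(1)[of "\<lfloor>x\<rfloor> + 1"]
    by (elim disjE) auto
qed

lemma amalg_tendsto_0:
  assumes "amalg B f" "e > 0"
  obtains R where "R > 0" "\<And>x. \<bar>x\<bar> \<ge> R \<Longrightarrow> norm (f x) < e"
proof -
  have "finite {k. B k \<ge> e}"
  proof (rule ccontr)
    assume inf: "infinite {k. B k \<ge> e}"
    obtain n where n: "(\<Sum>\<^sub>\<infinity>k. B k) / e < real n" using reals_Archimedean2 by blast
    obtain F where F: "F \<subseteq> {k. B k \<ge> e}" "finite F" "card F = n"
      using inf infinite_arbitrarily_large by metis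
    have "real n * e = (\<Sum>k\<in>F. e)" using F by simp
    also have "\<dots> \<le> (\<Sum>k\<in>F. B k)" using F by (intro sum_mono) auto
    also have "\<dots> \<le> (\<Sum>\<^sub>\<infinity>k. B k)"
      using F amalgD[OF assms(1)] by (intro finite_sum_le_infsum) auto
    finally show False using n assms(2) by (simp add: field_simps)
  qed
  then obtain K where K: "\<And>k. B k \<ge> e \<Longrightarrow> \<bar>k\<bar> \<le> K"
    by (metis (no_types, lifting) Max_ge finite_imageI imageI mem_Collect_eq)
  show ?thesis
  proof (rule that[of "of_int (\<bar>K\<bar> + 2)"])
    fix x :: real assume "of_int (\<bar>K\<bar> + 2) \<le> \<bar>x\<bar>"
    then have "\<bar>\<lfloor>x\<rfloor>\<bar> > K" by linarith
    then have "B \<lfloor>x\<rfloor> < e" using K by (meson not_le)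
    then show "norm (f x) < e" using amalgD(3)[OF assms(1), of x] by linarith
  qed auto
qed

section \<open>Smooth functions and test functions\<close>

lemma nth_deriv_0 [simp]: "nth_deriv 0 f = f"
  by (simp add: nth_deriv_def)

lemma nth_deriv_Suc: "nth_deriv (Suc n) f x = vector_derivative (nth_deriv n f) (at x)"
  by (simp add: nth_deriv_def)

lemma nth_deriv_Suc': "nth_deriv (Suc n) f = nth_deriv n (nth_deriv 1 f)"
proof (induction n)
  case (Suc n)
  show ?case
    by (rule ext) (simp only: nth_deriv_Suc[of "Suc n"] Suc nth_deriv_Suc[of n "nth_deriv 1 f"])
qed simp

lemma smooth_has_vector_derivative:
  "smooth f \<Longrightarrow> (nth_deriv n f has_vector_derivative nth_deriv (Suc n) f x) (at x)"
  unfolding nth_deriv_Suc by (subst vector_derivative_works[symmetric]) (simp add: smooth_def)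

lemma smooth_has_vector_derivative0:
  "smooth f \<Longrightarrow> (f has_vector_derivative nth_deriv 1 f x) (at x)"
  using smooth_has_vector_derivative[of f 0 x] by simp

text \<open>Used both to prove smoothness and to identify the iterated derivatives.\<close>

lemma smooth_seqI:
  assumes "D 0 = f" and "\<And>n x. (D n has_vector_derivative D (Suc n) x) (at x)"
  shows "smooth f" "nth_deriv n f = D n"
proof -
  have *: "nth_deriv n f = D n" for n
  proof (induction n)
    case (Suc n)
    show ?case by (rule ext) (simp add: nth_deriv_Suc Suc vector_derivative_at[OF assms(2)])
  qed (use assms in simp)
  show "smooth f" unfolding smooth_def *
    using assms(2) by (meson differentiableI_vector)
  show "nth_deriv n f = D n" by (rule *)
qed

text \<open>A family closed under differentiation consists of smooth functions. Finding such a family is often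
  easier than writing down the derivatives.\<close>

lemma smooth_familyI:
  assumes "f \<in> F" and der: "\<And>g. g \<in> F \<Longrightarrow> \<exists>g'\<in>F. \<forall>x. (g has_vector_derivative g' x) (at x)"
  shows "smooth f" "nth_deriv n f \<in> F"
proof -
  have F: "nth_deriv n f \<in> F" for n
  proof (induction n)
    case (Suc n)
    obtain g' where g': "g' \<in> F" "\<And>x. (nth_deriv n f has_vector_derivative g' x) (at x)"
      using der[OF Suc] by blast
    then have "nth_deriv (Suc n) f = g'" by (auto simp: fun_eq_iff nth_deriv_Suc vector_derivative_at)
    then show ?case using g' by simp
  qed (use assms in simp)
  then show "nth_deriv n f \<in> F" .
  show "smooth f" unfolding smooth_def using der[OF F] by (meson differentiableI_vector)
qed

lemma smooth_deriv: "smooth f \<Longrightarrow> smooth (nth_deriv 1 f)"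
  by (simp only: smooth_def nth_deriv_Suc'[symmetric]) blast

lemma smooth_continuous: "smooth f \<Longrightarrow> continuous_on A (nth_deriv n f)"
  by (meson continuous_at_imp_continuous_on differentiable_imp_continuous_within smooth_def)

lemma smooth_continuous0: "smooth f \<Longrightarrow> continuous_on A f"
  using smooth_continuous[of f A 0] by simp

lemma smooth_add:
  assumes "smooth f" "smooth g"
  shows "smooth (\<lambda>x. f x + g x)" "nth_deriv n (\<lambda>x. f x + g x) = (\<lambda>x. nth_deriv n f x + nth_deriv n g x)"
  by (rule smooth_seqI[of "\<lambda>n x. nth_deriv n f x + nth_deriv n g x"];
      use assms in \<open>auto intro!: derivative_eq_intros smooth_has_vector_derivative\<close>)+

lemma smooth_cmult:
  assumes "smooth f"
  shows "smooth (\<lambda>x. c * f x)"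
  by (rule smooth_seqI[of "\<lambda>n x. c * nth_deriv n f x"];
      use assms in \<open>auto intro!: has_vector_derivative_mult_right smooth_has_vector_derivative\<close>)

lemma smooth_const: "smooth (\<lambda>x. c)"
  by (rule smooth_seqI(1)[of "\<lambda>n x. if n = 0 then c else 0"]) auto

lemma smooth_of_real: "smooth (\<lambda>x. of_real x)"
  by (rule smooth_seqI(1)[of "\<lambda>n x. if n = 0 then of_real x else if n = 1 then 1 else 0"])
     (auto simp: has_vector_derivative_of_real intro!: derivative_eq_intros)

lemma smooth_affine:
  assumes "smooth f"
  shows "smooth (\<lambda>x. f (a * x + b))"
    "nth_deriv n (\<lambda>x. f (a * x + b)) = (\<lambda>x. of_real a ^ n * nth_deriv n f (a * x + b))"
proof -
  let ?D = "\<lambda>n x. of_real a ^ n * nth_deriv n f (a * x + b)"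
  have D: "(?D n has_vector_derivative ?D (Suc n) x) (at x)" for n x
  proof -
    have "((\<lambda>x. nth_deriv n f (a * x + b)) has_vector_derivative a *\<^sub>R nth_deriv (Suc n) f (a * x + b)) (at x)"
      by (rule vector_diff_chain_at[where f="\<lambda>x. a * x + b", unfolded o_def])
         (auto intro!: derivative_eq_intros smooth_has_vector_derivative assms)
    then have "(?D n has_vector_derivative of_real a ^ n * (a *\<^sub>R nth_deriv (Suc n) f (a * x + b))) (at x)"
      by (rule has_vector_derivative_mult_right)
    then show ?thesis by (simp add: scaleR_conv_of_real mult_ac)
  qed
  show "smooth (\<lambda>x. f (a * x + b))" by (rule smooth_seqI(1)[of ?D, OF _ D]) simp
  show "nth_deriv n (\<lambda>x. f (a * x + b)) = (\<lambda>x. of_real a ^ n * nth_deriv n f (a * x + b))"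
    by (rule smooth_seqI(2)[of ?D, OF _ D]) simp
qed

lemma smooth_exp: "smooth (\<lambda>x. exp (c * of_real x))"
proof (rule smooth_seqI(1)[of "\<lambda>n x. c ^ n * exp (c * of_real x)"])
  fix n x
  have "((\<lambda>z. c ^ n * exp (c * z)) has_field_derivative c ^ Suc n * exp (c * of_real x)) (at (of_real x))"
    by (auto intro!: derivative_eq_intros)
  then show "((\<lambda>x. c ^ n * exp (c * of_real x)) has_vector_derivative c ^ Suc n * exp (c * of_real x)) (at x)"
    by (rule has_vector_derivative_real_field)
qed simp

text \<open>The closed family consists of the finite sums of products of derivatives of \<open>f\<close> and \<open>g\<close>, indexed by
  lists of pairs of orders, so that differentiation becomes an operation on lists and binomial
  coefficients do not appear.\<close>

lemma smooth_mult:
  assumes f: "smooth f" and g: "smooth g"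
  shows "smooth (\<lambda>x. f x * g x)"
proof (rule smooth_familyI(1))
  let ?S = "\<lambda>l x. \<Sum>(i,j)\<leftarrow>l. nth_deriv i f x * nth_deriv j g x"
  show "(\<lambda>x. f x * g x) \<in> range ?S"
    by (intro image_eqI[of _ _ "[(0,0)]"]) auto
  fix h assume "h \<in> range ?S"
  then obtain l where h: "h = ?S l" by blast
  have "(?S l has_vector_derivative ?S (concat (map (\<lambda>(i,j). [(Suc i, j), (i, Suc j)]) l)) x) (at x)" for x
  proof (induction l)
    case (Cons p l)
    obtain i j where p: "p = (i, j)" by fastforce
    have "((\<lambda>x. nth_deriv i f x * nth_deriv j g x) has_vector_derivative
        (nth_deriv i f x * nth_deriv (Suc j) g x + nth_deriv (Suc i) f x * nth_deriv j g x)) (at x)"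
      by (intro has_vector_derivative_mult smooth_has_vector_derivative f g)
    from has_vector_derivative_add[OF this Cons] show ?case by (simp add: p algebra_simps)
  qed simp
  then show "\<exists>g'\<in>range ?S. \<forall>x. (h has_vector_derivative g' x) (at x)"
    unfolding h by (intro bexI[of _ "?S (concat (map (\<lambda>(i,j). [(Suc i, j), (i, Suc j)]) l))"]) auto
qed

lemma nth_deriv_mult:
  assumes f: "smooth f" and g: "smooth g"
  shows "nth_deriv 1 (\<lambda>x. f x * g x) = (\<lambda>x. nth_deriv 1 f x * g x + f x * nth_deriv 1 g x)"
proof
  fix x
  have "((\<lambda>x. f x * g x) has_vector_derivative (f x * nth_deriv 1 g x + nth_deriv 1 f x * g x)) (at x)"
    by (intro has_vector_derivative_mult smooth_has_vector_derivative0 f g)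
  then show "nth_deriv 1 (\<lambda>x. f x * g x) x = nth_deriv 1 f x * g x + f x * nth_deriv 1 g x"
    by (simp add: nth_deriv_def vector_derivative_at)
qed

lemma nth_deriv_cong_open:
  assumes "open S" "x \<in> S" "\<And>y. y \<in> S \<Longrightarrow> f y = g y"
  shows "nth_deriv n f x = nth_deriv n g x"
  using assms(2)
proof (induction n arbitrary: x)
  case (Suc n)
  have "\<forall>\<^sub>F y in nhds x. nth_deriv n f y = nth_deriv n g y"
    using Suc assms(1) by (auto simp: eventually_nhds)
  then have "vector_derivative (nth_deriv n f) (at x) = vector_derivative (nth_deriv n g) (at x)"
    by (intro vector_derivative_cong_eq) auto
  then show ?case by (simp only: nth_deriv_Suc)
qed (use assms in simp)

lemma nth_deriv_zero [simp]: "nth_deriv n (\<lambda>x. 0) = (\<lambda>x. 0)"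
  by (rule smooth_seqI(2)[of "\<lambda>n x. 0"]) auto

lemma test_functions_iff:
  "f \<in> test_functions \<longleftrightarrow> smooth f \<and> (\<exists>R. \<forall>x. R < \<bar>x\<bar> \<longrightarrow> f x = 0)"
proof -
  have "compact (closure {x. f x \<noteq> 0}) \<longleftrightarrow> bounded {x. f x \<noteq> 0}"
    by (rule compact_closure)
  also have "\<dots> \<longleftrightarrow> (\<exists>R. \<forall>x. R < \<bar>x\<bar> \<longrightarrow> f x = 0)"
    unfolding bounded_iff real_norm_def mem_Collect_eq Ball_def by (metis not_less)
  finally show ?thesis by (simp add: test_functions_def)
qed

lemma test_smooth: "f \<in> test_functions \<Longrightarrow> smooth f"
  by (simp add: test_functions_def)

lemma test_bound:
  assumes "f \<in> test_functions"
  obtains R where "R > 0" "\<And>x. R < \<bar>x\<bar> \<Longrightarrow> f x = 0"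
proof -
  obtain R where R: "\<And>x. R < \<bar>x\<bar> \<Longrightarrow> f x = 0" using assms unfolding test_functions_iff by blast
  show ?thesis by (rule that[of "max R 1"]) (use R in auto)
qed

lemma test_continuous: "f \<in> test_functions \<Longrightarrow> continuous_on A f"
  by (simp add: smooth_continuous0 test_smooth)

lemma test_borel: "f \<in> test_functions \<Longrightarrow> f \<in> borel_measurable borel"
  by (intro borel_measurable_continuous_onI test_continuous)

lemma test_mult_smooth: "f \<in> test_functions \<Longrightarrow> smooth g \<Longrightarrow> (\<lambda>x. f x * g x) \<in> test_functions"
  unfolding test_functions_iff using smooth_mult by fastforce

lemma test_mult_smooth': "f \<in> test_functions \<Longrightarrow> smooth g \<Longrightarrow> (\<lambda>x. g x * f x) \<in> test_functions"
  using test_mult_smooth[of f g] by (simp add: mult.commute)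

lemma test_deriv: "f \<in> test_functions \<Longrightarrow> nth_deriv 1 f \<in> test_functions"
proof -
  assume f: "f \<in> test_functions"
  obtain R where R: "\<And>x. R < \<bar>x\<bar> \<Longrightarrow> f x = 0" using test_bound[OF f] by blast
  have "nth_deriv 1 f x = 0" if "R < \<bar>x\<bar>" for x
  proof -
    have "open {x::real. R < \<bar>x\<bar>}" by (intro open_Collect_less continuous_intros)
    then show ?thesis using nth_deriv_cong_open[of "{x. R < \<bar>x\<bar>}" x f "\<lambda>_. 0" 1] R that by simp
  qed
  then show ?thesis unfolding test_functions_iff using smooth_deriv[OF test_smooth[OF f]] by blast
qed

lemma test_affine: "f \<in> test_functions \<Longrightarrow> a \<noteq> 0 \<Longrightarrow> (\<lambda>x. f (a * x + b)) \<in> test_functions"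
proof -
  assume f: "f \<in> test_functions" and a: "a \<noteq> 0"
  obtain R where R: "\<And>x. R < \<bar>x\<bar> \<Longrightarrow> f x = 0" using test_bound[OF f] by blast
  have "f (a * x + b) = 0" if "(R + \<bar>b\<bar>) / \<bar>a\<bar> < \<bar>x\<bar>" for x
  proof (rule R)
    have "R + \<bar>b\<bar> < \<bar>a * x\<bar>" using that a by (simp add: divide_less_eq abs_mult mult.commute)
    then show "R < \<bar>a * x + b\<bar>" by linarith
  qed
  then show ?thesis unfolding test_functions_iff using smooth_affine(1)[OF test_smooth[OF f]] by blast
qed

lemma test_bounded:
  assumes "f \<in> test_functions"
  obtains C where "C \<ge> 0" "\<And>x. norm (f x) \<le> C"
proof -
  obtain R where R: "\<And>x. R < \<bar>x\<bar> \<Longrightarrow> f x = 0" using test_bound[OF assms] by blast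
  have "bounded (f ` {-R..R})"
    by (intro compact_imp_bounded compact_continuous_image test_continuous assms) auto
  then obtain C where C: "\<And>x. x \<in> {-R..R} \<Longrightarrow> norm (f x) \<le> C" unfolding bounded_iff by blast
  show ?thesis
  proof (rule that[of "max C 0"])
    fix x show "norm (f x) \<le> max C 0"
      using C[of x] R[of x] by (cases "R < \<bar>x\<bar>") (auto simp: le_max_iff_disj abs_le_iff not_less)
  qed simp
qed

lemma test_nth_deriv:
  assumes "f \<in> test_functions"
  shows "nth_deriv n f \<in> test_functions"
proof (rule smooth_familyI(2)[OF assms])
  fix g assume "g \<in> test_functions"
  then show "\<exists>g'\<in>test_functions. \<forall>x. (g has_vector_derivative g' x) (at x)"
    using test_deriv smooth_has_vector_derivative0 test_smooth by blast
qed

lemma test_schwartz: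
  assumes f: "f \<in> test_functions"
  shows "f \<in> schwartz_space"
proof -
  have pw: "(\<lambda>x. of_real x ^ m * g x) \<in> test_functions" if "g \<in> test_functions" for m g
  proof (induction m)
    case (Suc m)
    from test_mult_smooth'[OF this smooth_of_real] show ?case by (simp add: mult_ac)
  qed (use that in simp)
  have "bdd_above (range (\<lambda>x. \<bar>x\<bar> ^ m * norm (nth_deriv n f x)))" for m n
  proof -
    obtain C where "\<And>x. norm (of_real x ^ m * nth_deriv n f x) \<le> C"
      using test_bounded[OF pw[OF test_nth_deriv[OF f]]] by blast
    then show ?thesis by (intro bdd_aboveI[of _ C]) (auto simp: norm_mult norm_power)
  qed
  then show ?thesis unfolding schwartz_space_def using test_smooth[OF f] by blast
qed


text \<open>The flat function \<open>exp (- 1 / x)\<close>, with powers of \<open>1 / x\<close> attached because the derivative of each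
  \<open>flat k\<close> is a combination of two others.\<close>

definition flat :: "nat \<Rightarrow> real \<Rightarrow> real" where
  "flat k x = (if x > 0 then inverse x ^ k * exp (- inverse x) else 0)"

lemma flat_tendsto: "(flat k \<longlongrightarrow> 0) (at 0)"
proof (rule filterlim_split_at)
  have "(flat k \<longlongrightarrow> 0) (at_left 0) \<longleftrightarrow> ((\<lambda>_. 0) \<longlongrightarrow> (0::real)) (at_left (0::real))"
    by (intro tendsto_cong) (auto simp: flat_def eventually_at_filter)
  then show "(flat k \<longlongrightarrow> 0) (at_left 0)" by simp
  have "((\<lambda>x. inverse x ^ k / exp (inverse x)) \<longlongrightarrow> 0) (at_right (0::real))"
    by (rule filterlim_compose[OF tendsto_power_div_exp_0 filterlim_inverse_at_top_right])
  moreover have "(flat k \<longlongrightarrow> 0) (at_right 0) \<longleftrightarrow> ((\<lambda>x. inverse x ^ k / exp (inverse x)) \<longlongrightarrow> 0) (at_right (0::real))"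
    by (intro tendsto_cong) (auto simp: flat_def eventually_at_filter exp_minus field_simps)
  ultimately show "(flat k \<longlongrightarrow> 0) (at_right 0)" by simp
qed

lemma flat_deriv:
  "(flat k has_real_derivative - real k * flat (Suc k) x + flat (Suc (Suc k)) x) (at x)"
proof -
  consider "x > 0" | "x < 0" | "x = 0" by linarith
  then show ?thesis
  proof cases
    case 1
    have "((\<lambda>x. inverse x ^ k * exp (- inverse x)) has_real_derivative
        (- real k * flat (Suc k) x + flat (Suc (Suc k)) x)) (at x)"
    proof (cases k)
      case 0
      then show ?thesis using 1
        by (auto intro!: derivative_eq_intros simp: flat_def power2_eq_square field_simps)
    next
      case (Suc j)
      then show ?thesis using 1
        by (auto intro!: derivative_eq_intros simp: flat_def power2_eq_square algebra_simps) (cases j; simp)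
    qed
    then show ?thesis
      by (rule has_field_derivative_transform_within_open[of _ _ _ "{0<..}"]) (use 1 in \<open>auto simp: flat_def\<close>)
  next
    case 2
    have "((\<lambda>x. 0) has_real_derivative - real k * flat (Suc k) x + flat (Suc (Suc k)) x) (at x)"
      using 2 by (simp add: flat_def)
    then show ?thesis
      by (rule has_field_derivative_transform_within_open[of _ _ _ "{..<0}"]) (use 2 in \<open>auto simp: flat_def\<close>)
  next
    case 3
    have "(\<lambda>y. (flat k y - flat k 0) / (y - 0)) = flat (Suc k)"
      by (auto simp: fun_eq_iff flat_def field_simps)
    then have "((\<lambda>y. (flat k y - flat k 0) / (y - 0)) \<longlongrightarrow> 0) (at 0)" using flat_tendsto by simp
    then show ?thesis using 3 by (simp add: has_field_derivative_iff flat_def)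
  qed
qed

lemma smooth_flat: "smooth (\<lambda>x. of_real (flat k x))"
proof (rule smooth_familyI(1))
  let ?S = "\<lambda>l x. complex_of_real (\<Sum>(c,k)\<leftarrow>l. c * flat k x)"
  show "(\<lambda>x. of_real (flat k x)) \<in> range ?S"
    by (intro image_eqI[of _ _ "[(1,k)]"]) auto
  fix h assume "h \<in> range ?S"
  then obtain l where h: "h = ?S l" by blast
  let ?l' = "concat (map (\<lambda>(c,k). [(- c * real k, Suc k), (c, Suc (Suc k))]) l)"
  have "((\<lambda>x. \<Sum>(c,k)\<leftarrow>l. c * flat k x) has_real_derivative (\<Sum>(c,k)\<leftarrow>?l'. c * flat k x)) (at x)" for x
  proof (induction l)
    case (Cons p l)
    obtain c k where p: "p = (c, k)" by fastforce
    have "((\<lambda>x. c * flat k x) has_real_derivative c * (- real k * flat (Suc k) x + flat (Suc (Suc k)) x)) (at x)"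
      by (intro DERIV_cmult flat_deriv)
    from DERIV_add[OF this Cons] show ?case by (simp add: p algebra_simps)
  qed simp
  then have "(?S l has_vector_derivative ?S ?l' x) (at x)" for x
    by (intro has_vector_derivative_of_real) (simp add: has_real_derivative_iff_has_vector_derivative)
  then show "\<exists>g'\<in>range ?S. \<forall>x. (h has_vector_derivative g' x) (at x)"
    unfolding h by (intro bexI[of _ "?S ?l'"]) auto
qed

lemma smooth_antideriv:
  assumes "smooth g" "\<And>x. (f has_vector_derivative g x) (at x)"
  shows "smooth f"
proof (rule smooth_seqI(1)[of "\<lambda>n. case n of 0 \<Rightarrow> f | Suc m \<Rightarrow> nth_deriv m g"])
  fix n x
  show "((case n of 0 \<Rightarrow> f | Suc m \<Rightarrow> nth_deriv m g) has_vector_derivative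
      (case Suc n of 0 \<Rightarrow> f | Suc m \<Rightarrow> nth_deriv m g) x) (at x)"
    using assms by (cases n) (auto intro: smooth_has_vector_derivative)
qed simp

text \<open>An antiderivative of a bump on \<open>[0, 1]\<close>, normalised. It is smooth because its derivative is.\<close>

lemma smooth_step:
  obtains s :: "real \<Rightarrow> complex" where "smooth s" "\<And>x. x \<le> 0 \<Longrightarrow> s x = 0" "\<And>x. x \<ge> 1 \<Longrightarrow> s x = 1"
proof -
  define p where "p x = flat 0 x * flat 0 (1 - x)" for x
  have sp: "smooth (\<lambda>x. of_real (p x))"
    using smooth_mult[OF smooth_flat[of 0] smooth_affine(1)[OF smooth_flat[of 0], of "-1" 1]]
    by (simp add: p_def)
  have contp: "isCont p x" for x
    unfolding p_def by (intro continuous_intros isCont_o2[OF _ DERIV_isCont[OF flat_deriv]] DERIV_isCont[OF flat_deriv])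
  obtain P where P: "\<And>x. (P has_vector_derivative p x) (at x)"
    using einterval_antiderivative[of "-\<infinity>" "\<infinity>" p] contp by auto
  have P': "(P has_real_derivative p x) (at x)" for x
    using P by (simp add: has_real_derivative_iff_has_vector_derivative)
  have p0: "p x = 0" if "x \<le> 0 \<or> x \<ge> 1" for x using that by (auto simp: p_def flat_def)
  have pp: "p x > 0" if "0 < x" "x < 1" for x using that by (auto simp: p_def flat_def)
  have c: "P 0 < P 1"
    by (rule DERIV_pos_imp_increasing_open[of 0 1 P])
       (use P' pp in \<open>auto intro!: continuous_at_imp_continuous_on DERIV_isCont\<close>)
  have const: "P x = P y" if "x \<le> 0 \<and> y \<le> 0 \<or> x \<ge> 1 \<and> y \<ge> 1" for x y
  proof -
    have "\<exists>c. \<forall>x\<in>S. P x = c" if "convex S" "S \<subseteq> {x. x \<le> 0 \<or> x \<ge> 1}" for S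
    proof (rule has_field_derivative_zero_constant[OF that(1)])
      fix x assume "x \<in> S"
      then have "(P has_real_derivative 0) (at x)" using P'[of x] p0[of x] that(2) by auto
      then show "(P has_real_derivative 0) (at x within S)" by (rule has_field_derivative_at_within)
    qed
    from this[of "{..0}"] this[of "{1..}"] that show ?thesis by (auto simp: subset_iff)
  qed
  show ?thesis
  proof (rule that[of "\<lambda>x. inverse (of_real (P 1 - P 0)) * (of_real (P x) + (- of_real (P 0)))"])
    have "smooth (\<lambda>x. complex_of_real (P x))"
      by (rule smooth_antideriv[OF sp]) (intro has_vector_derivative_of_real P')
    then show "smooth (\<lambda>x. inverse (of_real (P 1 - P 0)) * (of_real (P x) + (- complex_of_real (P 0))))"
      by (intro smooth_cmult smooth_add(1) smooth_const)
    show "inverse (of_real (P 1 - P 0)) * (of_real (P x) + (- complex_of_real (P 0))) = 0" if "x \<le> 0" for x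
      using const[of x 0] that by simp
    show "inverse (of_real (P 1 - P 0)) * (of_real (P x) + (- complex_of_real (P 0))) = 1" if "x \<ge> 1" for x
    proof -
      have "complex_of_real (P 1 - P 0) \<noteq> 0" using c by (simp only: of_real_eq_0_iff)
      then show ?thesis using const[of x 1] that by (simp del: of_real_eq_0_iff)
    qed
  qed
qed

lemma bump_exists:
  obtains r where "r \<in> test_functions" "\<And>x. \<bar>x\<bar> \<le> 1 \<Longrightarrow> r x = 1" "\<And>x. 2 \<le> \<bar>x\<bar> \<Longrightarrow> r x = 0"
proof -
  obtain s :: "real \<Rightarrow> complex" where s: "smooth s" "\<And>x. x \<le> 0 \<Longrightarrow> s x = 0" "\<And>x. x \<ge> 1 \<Longrightarrow> s x = 1"
    using smooth_step by blast
  let ?r = "\<lambda>x. s (1 * x + 2) * s ((-1) * x + 2)"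
  have out: "?r x = 0" if "2 \<le> \<bar>x\<bar>" for x
    using that s(2)[of "1 * x + 2"] s(2)[of "(-1) * x + 2"] by (auto simp: abs_if split: if_splits)
  show ?thesis
  proof (rule that[of ?r])
    show "?r \<in> test_functions" unfolding test_functions_iff
      using out by (intro conjI smooth_mult smooth_affine(1) s(1) exI[of _ 2]) auto
    show "?r x = 1" if "\<bar>x\<bar> \<le> 1" for x using that by (simp add: s(3) abs_le_iff)
  qed (rule out)
qed

section \<open>Fourier transforms of test functions\<close>

definition ec :: "real \<Rightarrow> complex" where
  "ec u = cis (2 * pi * u)"

lemma ec_add: "ec (a + b) = ec a * ec b"
  by (simp add: ec_def cis_mult distrib_left)

lemma ec_0 [simp]: "ec 0 = 1"
  by (simp add: ec_def)

lemma norm_ec [simp]: "norm (ec u) = 1"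
  by (simp add: ec_def)

lemma ec_exp: "ec u = exp (of_real (2 * pi * u) * \<i>)"
  by (simp add: ec_def cis_conv_exp mult.commute)

lemma continuous_ec [continuous_intros]:
  "continuous_on A f \<Longrightarrow> continuous_on A (\<lambda>x. ec (f x))"
  unfolding ec_exp by (intro continuous_intros)

lemma measurable_ec [measurable]: "ec \<in> borel_measurable borel"
  by (intro borel_measurable_continuous_onI continuous_intros)

lemma smooth_ec: "smooth (\<lambda>x. ec (a * x))"
proof -
  have "(\<lambda>x. ec (a * x)) = (\<lambda>x. exp ((of_real (2 * pi * a) * \<i>) * of_real x))"
    by (simp add: ec_exp mult_ac)
  then show ?thesis by (simp only: smooth_exp)
qed

lemma ec_has_vector_derivative:
  "((\<lambda>x. ec (a * x)) has_vector_derivative 2 * pi * \<i> * a * ec (a * x)) (at x)"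
proof -
  have "((\<lambda>z. exp ((of_real (2 * pi * a) * \<i>) * z)) has_field_derivative
      (2 * pi * \<i> * a * ec (a * x))) (at (of_real x))"
    by (auto intro!: derivative_eq_intros simp: ec_exp mult_ac)
  from has_vector_derivative_real_field[OF this] show ?thesis
    by (simp add: ec_exp mult_ac)
qed

lemma fourier_eq:
  assumes "f \<in> borel_measurable borel"
  shows "fourier f x = (\<integral>t. ec (- (x * t)) * f t \<partial>lborel)"
proof -
  have "exp (- (2 * of_real pi * \<i> * of_real x * of_real t)) = ec (- (x * t))" for t
    by (simp add: ec_exp mult_ac)
  then have "fourier f x = (\<integral>t. ec (- (x * t)) * f t \<partial>lebesgue)" by (simp add: fourier_def)
  also have "\<dots> = (\<integral>t. ec (- (x * t)) * f t \<partial>lborel)"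
    using assms by (intro integral_completion) measurable
  finally show ?thesis .
qed

lemma test_integrable:
  assumes f: "f \<in> test_functions"
  shows "integrable lborel f"
proof -
  obtain R where R: "\<And>x. R < \<bar>x\<bar> \<Longrightarrow> f x = 0" using test_bound[OF f] by blast
  have "set_integrable lborel {-R..R} f"
    unfolding set_integrable_def by (intro borel_integrable_compact compact_Icc test_continuous[OF f])
  moreover have "indicator {-R..R} x *\<^sub>R f x = f x" for x
    using R[of x] by (auto simp: indicator_def abs_if split: if_splits)
  ultimately show ?thesis by (simp add: set_integrable_def)
qed

lemma integrable_ec_mult:
  assumes "integrable lborel f" "g \<in> borel_measurable borel"
  shows "integrable lborel (\<lambda>t. ec (g t) * f t)"
  using assms by (intro Bochner_Integration.integrable_bound[OF assms(1)]) (auto simp: norm_mult)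

lemma fourier_norm_le:
  assumes "f \<in> test_functions"
  shows "norm (fourier f x) \<le> (\<integral>t. norm (f t) \<partial>lborel)"
proof -
  have "norm (fourier f x) \<le> (\<integral>t. norm (ec (- (x * t)) * f t) \<partial>lborel)"
    unfolding fourier_eq[OF test_borel[OF assms]] by (rule integral_norm_bound)
  then show ?thesis by (simp add: norm_mult)
qed

lemma fourier_modulate:
  assumes "f \<in> borel_measurable borel"
  shows "fourier (\<lambda>s. ec (a * s) * f s) x = fourier f (x - a)"
proof -
  have "fourier (\<lambda>s. ec (a * s) * f s) x = (\<integral>t. ec (- (x * t)) * (ec (a * t) * f t) \<partial>lborel)"
    using assms by (intro fourier_eq) measurable
  also have "(\<lambda>t. ec (- (x * t)) * (ec (a * t) * f t)) = (\<lambda>t. ec (- ((x - a) * t)) * f t)"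
  proof
    fix t
    have "ec (- ((x - a) * t)) = ec (- (x * t)) * ec (a * t)"
      by (subst ec_add[symmetric]) (simp add: algebra_simps)
    then show "ec (- (x * t)) * (ec (a * t) * f t) = ec (- ((x - a) * t)) * f t" by simp
  qed
  also have "(\<integral>t. ec (- ((x - a) * t)) * f t \<partial>lborel) = fourier f (x - a)"
    using assms by (rule fourier_eq[symmetric])
  finally show ?thesis .
qed

lemma fourier_linear:
  assumes "f \<in> test_functions" "g \<in> test_functions"
  shows "fourier (\<lambda>x. f x + g x) y = fourier f y + fourier g y"
    and "fourier (\<lambda>x. c * f x) y = c * fourier f y"
proof -
  note b[measurable] = test_borel[OF assms(1)] test_borel[OF assms(2)]
  have i: "integrable lborel (\<lambda>t. ec (- (y * t)) * f t)" "integrable lborel (\<lambda>t. ec (- (y * t)) * g t)"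
    by (intro integrable_ec_mult test_integrable assms; measurable)+
  show "fourier (\<lambda>x. f x + g x) y = fourier f y + fourier g y"
    using i by (simp add: fourier_eq distrib_left)
  have "(\<lambda>t. ec (- (y * t)) * (c * f t)) = (\<lambda>t. c * (ec (- (y * t)) * f t))" by (simp add: mult_ac)
  then show "fourier (\<lambda>x. c * f x) y = c * fourier f y"
    by (simp add: fourier_eq)
qed


lemma integral_supported:
  fixes g :: "real \<Rightarrow> complex"
  assumes "continuous_on {-R..R} g" "\<And>x. R < \<bar>x\<bar> \<Longrightarrow> g x = 0"
  shows "(\<integral>t. g t \<partial>lborel) = integral {-R..R} g"
proof -
  have s: "set_integrable lborel {-R..R} g"
    unfolding set_integrable_def by (intro borel_integrable_compact compact_Icc assms)
  have "indicator {-R..R} x *\<^sub>R g x = g x" for x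
    using assms(2)[of x] by (auto simp: indicator_def abs_if split: if_splits)
  then show ?thesis using set_borel_integral_eq_integral(2)[OF s] by (simp add: set_lebesgue_integral_def)
qed

text \<open>The integral runs over a compact interval outside which \<open>f\<close> vanishes, so it may be differentiated
  under the integral sign.\<close>

lemma fourier_has_derivative:
  assumes f: "f \<in> test_functions"
  shows "(fourier f has_vector_derivative fourier (\<lambda>t. (- 2 * pi * \<i>) * (of_real t * f t)) x) (at x)"
proof -
  obtain R where R: "\<And>x. R < \<bar>x\<bar> \<Longrightarrow> f x = 0" using test_bound[OF f] by blast
  have cf: "continuous_on A f" for A by (rule test_continuous[OF f])
  have g: "(\<lambda>t. (- 2 * pi * \<i>) * (of_real t * f t)) \<in> borel_measurable borel"
    using test_borel[OF f] by measurable
  have 1: "fourier f = (\<lambda>x. integral (cbox (-R) R) (\<lambda>t. ec (- (x * t)) * f t))"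
    unfolding fourier_eq[OF test_borel[OF f]] cbox_interval
    by (rule ext, rule integral_supported) (auto intro!: continuous_intros cf simp: R)
  have 2: "fourier (\<lambda>t. (- 2 * pi * \<i>) * (of_real t * f t)) x =
      integral (cbox (-R) R) (\<lambda>t. ec (- (x * t)) * ((- 2 * pi * \<i>) * (of_real t * f t)))"
    unfolding fourier_eq[OF g] cbox_interval
    by (rule integral_supported) (auto intro!: continuous_intros cf simp: R)
  show ?thesis unfolding 1 2
  proof (rule leibniz_rule_vector_derivative[where U=UNIV])
    fix x t :: real
    have "((\<lambda>x. ec (- t * x) * f t) has_vector_derivative (2 * pi * \<i> * (- t) * ec (- t * x)) * f t) (at x)"
      using has_vector_derivative_mult_left[OF ec_has_vector_derivative[of "-t" x], of "f t"] by simp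
    then show "((\<lambda>x. ec (- (x * t)) * f t) has_vector_derivative
        ec (- (x * t)) * ((- 2 * pi * \<i>) * (of_real t * f t))) (at x within UNIV)"
      by (simp add: mult_ac)
    show "(\<lambda>t. ec (- (x * t)) * f t) integrable_on cbox (- R) R"
      by (intro integrable_continuous continuous_intros cf)
    show "continuous_on (UNIV \<times> cbox (- R) R)
       (\<lambda>(x, t). ec (- (x * t)) * ((- 2 * pi * \<i>) * (of_real t * f t)))"
      unfolding split_beta
      by (intro continuous_intros continuous_on_compose2[OF cf[of UNIV]]) auto
  qed auto
qed

text \<open>Integration by parts; the boundary terms vanish.\<close>

lemma fourier_of_deriv:
  assumes f: "f \<in> test_functions"
  shows "fourier (nth_deriv 1 f) x = 2 * pi * \<i> * x * fourier f x"
proof -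
  obtain R where R: "R > 0" "\<And>x. R < \<bar>x\<bar> \<Longrightarrow> f x = 0" using test_bound[OF f] by blast
  have f': "nth_deriv 1 f \<in> test_functions" by (rule test_deriv[OF f])
  have fl: "(\<lambda>t. f t) \<in> test_functions" using f by simp
  define h' where "h' t = ec (- (x * t)) * nth_deriv 1 f t + (2 * pi * \<i> * (- x) * ec ((- x) * t)) * f t" for t
  have d: "((\<lambda>t. ec ((- x) * t) * f t) has_vector_derivative h' t) (at t)" for t
    unfolding h'_def
    using has_vector_derivative_mult[OF ec_has_vector_derivative[of "-x" t] smooth_has_vector_derivative0[OF test_smooth[OF f], of t]]
    by (simp add: add.commute)
  obtain S where S: "S > R" "\<And>x. S < \<bar>x\<bar> \<Longrightarrow> h' x = 0"
  proof -
    obtain R' where R': "\<And>x. R' < \<bar>x\<bar> \<Longrightarrow> nth_deriv 1 f x = 0" using test_bound[OF f'] by blast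
    show ?thesis by (rule that[of "max (R+1) R'"]) (use R R' in \<open>auto simp: h'_def\<close>)
  qed
  have c: "continuous_on A h'" for A
    unfolding h'_def by (intro continuous_intros test_continuous f f')
  have "(\<integral>t. h' t \<partial>lborel) = (\<integral>t. indicator {-S..S} t *\<^sub>R h' t \<partial>lborel)"
    using S by (intro Bochner_Integration.integral_cong) (auto simp: indicator_def abs_if split: if_splits)
  also have "\<dots> = ec ((- x) * S) * f S - ec ((- x) * (- S)) * f (- S)"
    using R S c d by (intro integral_FTC_atLeastAtMost) (auto intro: has_vector_derivative_at_within)
  also have "\<dots> = 0" using R S by simp
  finally have 0: "(\<integral>t. h' t \<partial>lborel) = 0" .
  have i: "integrable lborel (\<lambda>t. ec (- (x * t)) * f t)"
    "integrable lborel (\<lambda>t. ec (- (x * t)) * nth_deriv 1 f t)"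
    by (intro integrable_ec_mult test_integrable f f'; measurable)+
  have "h' = (\<lambda>t. ec (- (x * t)) * nth_deriv 1 f t - (2 * pi * \<i> * x) * (ec (- (x * t)) * f t))"
    by (auto simp: fun_eq_iff h'_def mult_ac)
  then have "(\<integral>t. h' t \<partial>lborel) = fourier (nth_deriv 1 f) x - (2 * pi * \<i> * x) * fourier f x"
    using i test_borel[OF f] test_borel[OF f'] by (simp add: fourier_eq)
  then show ?thesis using 0 by simp
qed

text \<open>Differentiating a Fourier transform multiplies the test function by \<open>- 2 \<pi> \<i> t\<close>, and the product is
  again a test function. Bounds for all transforms are therefore bounds for all their derivatives.\<close>

lemma fourier_test_deriv_closed:
  assumes "g \<in> fourier ` test_functions"
  shows "\<exists>g'\<in>fourier ` test_functions. \<forall>x. (g has_vector_derivative g' x) (at x)"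
proof -
  obtain f where f: "f \<in> test_functions" "g = fourier f" using assms by blast
  have "(\<lambda>t. (- 2 * pi * \<i>) * (of_real t * f t)) \<in> test_functions"
    by (intro test_mult_smooth' smooth_const smooth_of_real f)
  then show ?thesis using fourier_has_derivative[OF f(1)] f(2) by blast
qed

lemma fourier_test_smooth:
  assumes "f \<in> test_functions"
  shows "smooth (fourier f)" "nth_deriv n (fourier f) \<in> fourier ` test_functions"
  by (rule smooth_familyI[of _ "fourier ` test_functions"]; use assms fourier_test_deriv_closed in blast)+

text \<open>Each power of \<open>\<bar>x\<bar>\<close> is absorbed by one derivative of \<open>f\<close>.\<close>

lemma fourier_test_rapid:
  assumes "f \<in> test_functions"
  shows "\<exists>C. \<forall>x. \<bar>x\<bar> ^ m * norm (fourier f x) \<le> C"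
  using assms
proof (induction m arbitrary: f)
  case 0
  then show ?case using fourier_norm_le[OF 0] by auto
next
  case (Suc m)
  from Suc.IH[OF test_deriv[OF Suc.prems]]
  obtain C where C: "\<And>x. \<bar>x\<bar> ^ m * norm (fourier (nth_deriv 1 f) x) \<le> C" by blast
  have "\<bar>x\<bar> ^ Suc m * norm (fourier f x) \<le> C" for x
  proof -
    have "\<bar>x\<bar> * norm (fourier f x) \<le> (2 * pi * \<bar>x\<bar>) * norm (fourier f x)"
      using pi_gt3 by (intro mult_right_mono) (auto simp: mult_le_cancel_right1)
    also have "\<dots> = norm (fourier (nth_deriv 1 f) x)"
      unfolding fourier_of_deriv[OF Suc.prems] by (simp add: norm_mult)
    finally have "\<bar>x\<bar> ^ m * (\<bar>x\<bar> * norm (fourier f x)) \<le> \<bar>x\<bar> ^ m * norm (fourier (nth_deriv 1 f) x)"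
      by (intro mult_left_mono) auto
    then show ?thesis using C[of x] by (simp add: mult_ac)
  qed
  then show ?case by blast
qed

lemma summable_inverse_square_int: "(\<lambda>k::int. C / (1 + (of_int k)\<^sup>2) :: real) summable_on UNIV"
proof -
  have s: "(\<lambda>n::nat. 1 / (1 + (real n)\<^sup>2)) summable_on UNIV"
  proof (rule summable_nonneg_imp_summable_on)
    have "summable (\<lambda>n. 1 / (1 + (real (Suc n))\<^sup>2))"
    proof (rule summable_comparison_test'[of "\<lambda>n. inverse ((real (Suc n))\<^sup>2)" 0])
      show "summable (\<lambda>n. inverse ((real (Suc n))\<^sup>2))"
        by (subst summable_Suc_iff) (rule inverse_power_summable, simp)
      fix n :: nat
      show "norm (1 / (1 + (real (Suc n))\<^sup>2)) \<le> inverse ((real (Suc n))\<^sup>2)"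
        by (simp add: inverse_eq_divide frac_le add_nonneg_nonneg)
    qed
    then show "summable (\<lambda>n. 1 / (1 + (real n)\<^sup>2))" by (subst (asm) summable_Suc_iff)
  qed (simp add: add_nonneg_nonneg)
  have i: "inj_on int UNIV" "inj_on (\<lambda>n. - int n) UNIV" by (auto simp: inj_on_def)
  have "(\<lambda>k::int. 1 / (1 + (of_int k)\<^sup>2) :: real) summable_on range int"
    using s by (subst summable_on_reindex[OF i(1)]) (simp add: o_def)
  moreover have "(\<lambda>k::int. 1 / (1 + (of_int k)\<^sup>2) :: real) summable_on range (\<lambda>n. - int n)"
    using s by (subst summable_on_reindex[OF i(2)]) (simp add: o_def)
  ultimately have "(\<lambda>k::int. 1 / (1 + (of_int k)\<^sup>2) :: real) summable_on (range int \<union> range (\<lambda>n. - int n))"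
    by (rule summable_on_union)
  also have "range int \<union> range (\<lambda>n. - int n) = UNIV"
    by (auto simp: image_iff) (metis int_cases2)
  finally have "(\<lambda>k::int. C * (1 / (1 + (of_int k)\<^sup>2)) :: real) summable_on UNIV"
    by (rule summable_on_cmult_right)
  then show ?thesis by simp
qed

text \<open>For \<open>x\<close> in the cell \<open>[k, k + 1)\<close> one has \<open>1 + k\<^sup>2 \<le> 3 (1 + x\<^sup>2)\<close>.\<close>

lemma quadratic_decay_cells:
  fixes z :: complex
  assumes "(1 + x\<^sup>2) * norm z \<le> K"
  shows "norm z \<le> 3 * K / (1 + (of_int \<lfloor>x\<rfloor>)\<^sup>2)"
proof -
  note 1 = assms
  have 2: "1 + (of_int \<lfloor>x\<rfloor>)\<^sup>2 \<le> 3 * (1 + x\<^sup>2)"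
  proof -
    have "\<bar>of_int \<lfloor>x\<rfloor>\<bar> \<le> \<bar>x\<bar> + 1" by linarith
    then have "(of_int \<lfloor>x\<rfloor>)\<^sup>2 \<le> (\<bar>x\<bar> + 1)\<^sup>2" by (metis abs_ge_zero power2_abs power_mono)
    also have "\<dots> \<le> 2 * x\<^sup>2 + 2" using zero_le_power2[of "\<bar>x\<bar> - 1"]
      by (simp add: power2_sum power2_diff)
    finally have "(of_int \<lfloor>x\<rfloor>)\<^sup>2 \<le> 2 * x\<^sup>2 + 2" .
    moreover have "3 * (1 + x\<^sup>2) = 3 + 3 * x\<^sup>2" "0 \<le> x\<^sup>2" by simp_all
    ultimately show ?thesis by linarith
  qed
  have "(1 + (of_int \<lfloor>x\<rfloor>)\<^sup>2) * norm z \<le> (3 * (1 + x\<^sup>2)) * norm z"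
    using 2 by (rule mult_right_mono) simp
  also have "\<dots> \<le> 3 * K" using 1 by (simp only: mult.assoc mult_le_cancel_left) simp
  finally have "(1 + (of_int \<lfloor>x\<rfloor>)\<^sup>2) * norm z \<le> 3 * K" .
  moreover have "1 + (of_int \<lfloor>x\<rfloor>)\<^sup>2 > (0::real)" by (simp add: add_pos_nonneg)
  ultimately show ?thesis by (simp add: pos_le_divide_eq mult.commute)
qed

lemma fourier_test_amalg:
  assumes f: "f \<in> test_functions"
  obtains B where "amalg B (fourier f)"
proof -
  obtain C0 where C0: "\<And>x. norm (fourier f x) \<le> C0" using fourier_test_rapid[OF f, of 0] by auto
  obtain C2 where C2: "\<And>x. \<bar>x\<bar> ^ 2 * norm (fourier f x) \<le> C2" using fourier_test_rapid[OF f, of 2] by auto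
  have C: "C0 \<ge> 0" "C2 \<ge> 0" using C0[of 0] C2[of 0] norm_ge_zero[of "fourier f 0"] by (linarith, simp)
  have "norm (fourier f x) \<le> 3 * (C0 + C2) / (1 + (of_int \<lfloor>x\<rfloor>)\<^sup>2)" for x
    using C0[of x] C2[of x] by (intro quadratic_decay_cells) (simp add: distrib_right)
  then have "amalg (\<lambda>k. 3 * (C0 + C2) / (1 + (of_int k)\<^sup>2)) (fourier f)"
    unfolding amalg_def using C summable_inverse_square_int by (auto simp: add_nonneg_nonneg)
  then show ?thesis by (rule that)
qed

lemma fourier_test_continuous: "f \<in> test_functions \<Longrightarrow> continuous_on A (fourier f)"
  by (intro smooth_continuous0 fourier_test_smooth)

lemma fourier_test_borel: "f \<in> test_functions \<Longrightarrow> fourier f \<in> borel_measurable borel"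
  by (intro borel_measurable_continuous_onI fourier_test_continuous)

lemma fourier_test_integrable: "f \<in> test_functions \<Longrightarrow> integrable lborel (fourier f)"
  by (meson amalg_integrable fourier_test_amalg fourier_test_borel)

lemma Fubini_kernel:
  fixes f g :: "real \<Rightarrow> complex" and k :: "real \<Rightarrow> real \<Rightarrow> complex"
  assumes f: "integrable lborel f" and g: "integrable lborel g"
    and k[measurable]: "(\<lambda>(x, y). k x y) \<in> borel_measurable (borel \<Otimes>\<^sub>M borel)" and k1: "\<And>x y. norm (k x y) \<le> 1"
  shows "(\<integral>x. f x * (\<integral>y. k x y * g y \<partial>lborel) \<partial>lborel) = (\<integral>y. g y * (\<integral>x. k x y * f x \<partial>lborel) \<partial>lborel)"
proof -
  have [measurable]: "f \<in> borel_measurable borel" "g \<in> borel_measurable borel"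
    using f g by auto
  let ?h = "\<lambda>x y. f x * (k x y * g y)"
  have bd: "norm (?h x y) \<le> norm (f x) * norm (g y)" for x y
    unfolding norm_mult using k1[of x y] by (intro mult_left_mono mult_left_le_one_le) auto
  have iy: "integrable lborel (\<lambda>y. ?h x y)" for x
    by (rule Bochner_Integration.integrable_bound[of _ "\<lambda>y. norm (f x) * norm (g y)"])
       (use g bd[of x] in \<open>auto\<close>)
  have "integrable (lborel \<Otimes>\<^sub>M lborel) (\<lambda>(x, y). ?h x y)"
  proof (rule lborel_pair.Fubini_integrable)
    show "(\<lambda>(x, y). ?h x y) \<in> borel_measurable (lborel \<Otimes>\<^sub>M lborel)" by measurable
    have m: "(\<lambda>x. \<integral>y. norm (case (x, y) of (x, y) \<Rightarrow> ?h x y) \<partial>lborel) \<in> borel_measurable lborel"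
      by measurable
    show "integrable lborel (\<lambda>x. \<integral>y. norm (case (x, y) of (x, y) \<Rightarrow> ?h x y) \<partial>lborel)"
    proof (rule Bochner_Integration.integrable_bound[of _ "\<lambda>x. norm (f x) * (\<integral>y. norm (g y) \<partial>lborel)"], goal_cases)
      case 3
      have "norm (\<integral>y. norm (?h x y) \<partial>lborel) \<le> norm (norm (f x) * (\<integral>y. norm (g y) \<partial>lborel))" for x
      proof -
        have "(\<integral>y. norm (?h x y) \<partial>lborel) \<le> (\<integral>y. norm (f x) * norm (g y) \<partial>lborel)"
          using iy g bd by (intro integral_mono) auto
        then show ?thesis by simp
      qed
      then show ?case by auto
    qed (use f m in auto)
    show "AE x in lborel. integrable lborel (\<lambda>y. case (x, y) of (x, y) \<Rightarrow> ?h x y)" using iy by auto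
  qed
  from lborel_pair.Fubini_integral[OF this]
  have "(\<integral>y. (\<integral>x. ?h x y \<partial>lborel) \<partial>lborel) = (\<integral>x. (\<integral>y. ?h x y \<partial>lborel) \<partial>lborel)" .
  moreover have "(\<integral>y. ?h x y \<partial>lborel) = f x * (\<integral>y. k x y * g y \<partial>lborel)" for x by simp
  moreover have "(\<integral>x. ?h x y \<partial>lborel) = g y * (\<integral>x. k x y * f x \<partial>lborel)" for y
  proof -
    have "(\<integral>x. ?h x y \<partial>lborel) = (\<integral>x. g y * (k x y * f x) \<partial>lborel)" by (simp add: mult_ac)
    then show ?thesis by simp
  qed
  ultimately show ?thesis by simp
qed


text \<open>The characteristic function of the standard normal distribution, rescaled.\<close>

lemma gauss_fourier:
  assumes d: "d > 0"
  shows "(\<integral>u. ec (u * y) * of_real (std_normal_density (d * u)) \<partial>lborel) =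
    of_real (sqrt (2 * pi) / d * std_normal_density (2 * pi * y / d))"
proof -
  let ?t = "2 * pi * y / d"
  have "of_real (exp (- (?t\<^sup>2) / 2)) = char std_normal_distribution ?t"
    by (simp add: char_std_normal_distribution)
  also have "\<dots> = (\<integral>x. std_normal_density x *\<^sub>R iexp (?t * x) \<partial>lborel)"
    unfolding char_def by (rule integral_density) (auto simp: normal_density_nonneg)
  also have "\<dots> = \<bar>d\<bar> *\<^sub>R (\<integral>u. std_normal_density (0 + d * u) *\<^sub>R iexp (?t * (0 + d * u)) \<partial>lborel)"
    using d by (intro lborel_integral_real_affine) auto
  also have "(\<lambda>u. std_normal_density (0 + d * u) *\<^sub>R iexp (?t * (0 + d * u))) =
      (\<lambda>u. ec (u * y) * of_real (std_normal_density (d * u)))"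
    using d by (auto simp: fun_eq_iff ec_exp scaleR_conv_of_real field_simps)
  finally have "(\<integral>u. ec (u * y) * of_real (std_normal_density (d * u)) \<partial>lborel) =
      of_real (exp (- (?t\<^sup>2) / 2) / d)"
    using d by (simp add: scaleR_conv_of_real field_simps)
  also have "exp (- (?t\<^sup>2) / 2) / d = sqrt (2 * pi) / d * std_normal_density ?t"
    by (simp add: std_normal_density_def)
  finally show ?thesis .
qed

lemma std_normal_density_le: "std_normal_density x \<le> std_normal_density 0"
  by (simp add: std_normal_density_def divide_right_mono)

text \<open>A Gaussian factor \<open>N (d u)\<close> makes the double integral absolutely convergent. Exchanging the integrals
  turns it into the mean of \<open>f\<close> with respect to a normal distribution centred at \<open>s\<close> of width
  proportional to \<open>d\<close>. As \<open>d\<close> tends to 0, one side tends to the inversion integral and the other to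
  \<open>f s\<close>.\<close>

theorem fourier_inversion:
  assumes f: "f \<in> test_functions"
  shows "(\<integral>u. fourier f u * ec (u * s) \<partial>lborel) = f s"
proof -
  define N where "N x = complex_of_real (sqrt (2 * pi) * std_normal_density x)" for x
  have N0: "N 0 = 1" by (simp add: N_def std_normal_density_def)
  have N1: "norm (N x) \<le> 1" for x
  proof -
    have "norm (N x) = sqrt (2 * pi) * std_normal_density x" by (simp add: N_def norm_mult normal_density_nonneg)
    also have "\<dots> \<le> sqrt (2 * pi) * std_normal_density 0" by (intro mult_left_mono std_normal_density_le) auto
    also have "\<dots> = 1" by (simp add: std_normal_density_def)
    finally show ?thesis .
  qed
  have Nc: "continuous_on UNIV N" unfolding N_def std_normal_density_def by (intro continuous_intros) auto
  have [measurable]: "N \<in> borel_measurable borel" by (rule borel_measurable_continuous_onI[OF Nc])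
  note [measurable] = test_borel[OF f] fourier_test_borel[OF f]
  \<comment> \<open>The factor is normalised so that \<open>N 0 = 1\<close>.\<close>
  define d where "d n = 1 / (1 + real n)" for n
  have d0: "d n > 0" for n by (simp add: d_def)
  have dl: "d \<longlonglongrightarrow> 0" unfolding d_def by (rule reciprocal_tendsto_0)
  have L1: "(\<lambda>n. \<integral>u. fourier f u * ec (u * s) * N (d n * u) \<partial>lborel) \<longlonglongrightarrow> (\<integral>u. fourier f u * ec (u * s) \<partial>lborel)"
  proof (rule integral_dominated_convergence[where w="\<lambda>u. norm (fourier f u)"])
    show "AE u in lborel. (\<lambda>n. fourier f u * ec (u * s) * N (d n * u)) \<longlonglongrightarrow> fourier f u * ec (u * s)"
    proof (intro AE_I2)
      fix u
      have "(\<lambda>n. d n * u) \<longlonglongrightarrow> 0" using tendsto_mult_right[OF dl, of u] by simp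
      then have "(\<lambda>n. N (d n * u)) \<longlonglongrightarrow> N 0" by (intro continuous_on_tendsto_compose[OF Nc]) auto
      from tendsto_mult_left[OF this, of "fourier f u * ec (u * s)"]
      show "(\<lambda>n. fourier f u * ec (u * s) * N (d n * u)) \<longlonglongrightarrow> fourier f u * ec (u * s)" by (simp add: N0)
    qed
    show "AE u in lborel. norm (fourier f u * ec (u * s) * N (d n * u)) \<le> norm (fourier f u)" for n
      using N1 by (intro AE_I2) (simp add: norm_mult mult_left_le)
  qed (use fourier_test_integrable[OF f] in auto)
  have id: "integrable lborel (\<lambda>u. ec (u * s) * N (d n * u))" for n
  proof -
    have "integrable lborel (\<lambda>u. std_normal_density (0 + d n * u))"
      using d0[of n] by (intro lborel_integrable_real_affine) auto
    then have "integrable lborel (\<lambda>u. N (d n * u))" unfolding N_def by simp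
    then show ?thesis by (rule integrable_ec_mult) measurable
  qed
  have eq: "(\<integral>u. fourier f u * ec (u * s) * N (d n * u) \<partial>lborel) =
      (\<integral>w. std_normal_density w *\<^sub>R f (s + d n / (2 * pi) * w) \<partial>lborel)" for n
  proof -
    \<comment> \<open>The width of the normal distribution.\<close>
    define c where "c = d n / (2 * pi)"
    have c: "c > 0" using d0[of n] by (simp add: c_def)
    have dc: "2 * pi / d n = 1 / c" by (simp add: c_def)
    have "(\<integral>u. fourier f u * ec (u * s) * N (d n * u) \<partial>lborel) =
        (\<integral>u. (ec (u * s) * N (d n * u)) * (\<integral>t. ec (- (u * t)) * f t \<partial>lborel) \<partial>lborel)"
      by (simp add: fourier_eq mult_ac)
    also have "\<dots> = (\<integral>t. f t * (\<integral>u. ec (- (u * t)) * (ec (u * s) * N (d n * u)) \<partial>lborel) \<partial>lborel)"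
      by (rule Fubini_kernel[OF id test_integrable[OF f]]) auto
    also have "(\<lambda>t. f t * (\<integral>u. ec (- (u * t)) * (ec (u * s) * N (d n * u)) \<partial>lborel)) =
        (\<lambda>t. (2 * pi / d n * std_normal_density (2 * pi * (s - t) / d n)) *\<^sub>R f t)"
    proof
      fix t
      have "ec (- (u * t)) * (ec (u * s) * N (d n * u)) =
          of_real (sqrt (2 * pi)) * (ec (u * (s - t)) * of_real (std_normal_density (d n * u)))" for u
      proof -
        have "ec (u * (s - t)) = ec (- (u * t)) * ec (u * s)"
          by (subst ec_add[symmetric]) (simp add: algebra_simps)
        then show ?thesis by (simp add: N_def)
      qed
      then have "(\<integral>u. ec (- (u * t)) * (ec (u * s) * N (d n * u)) \<partial>lborel) =
          of_real (sqrt (2 * pi)) * of_real (sqrt (2 * pi) / d n * std_normal_density (2 * pi * (s - t) / d n))"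
        by (simp add: gauss_fourier[OF d0])
      also have "\<dots> = of_real ((sqrt (2 * pi) * sqrt (2 * pi)) / d n * std_normal_density (2 * pi * (s - t) / d n))"
        by (simp only: of_real_mult[symmetric] times_divide_eq_right mult.assoc times_divide_eq_left)
      also have "sqrt (2 * pi) * sqrt (2 * pi) = 2 * pi" by simp
      finally show "f t * (\<integral>u. ec (- (u * t)) * (ec (u * s) * N (d n * u)) \<partial>lborel) =
          (2 * pi / d n * std_normal_density (2 * pi * (s - t) / d n)) *\<^sub>R f t"
        by (simp add: scaleR_conv_of_real mult.commute)
    qed
    also have "(\<integral>t. (2 * pi / d n * std_normal_density (2 * pi * (s - t) / d n)) *\<^sub>R f t \<partial>lborel) =
        \<bar>c\<bar> *\<^sub>R (\<integral>w. (2 * pi / d n * std_normal_density (2 * pi * (s - (s + c * w)) / d n)) *\<^sub>R f (s + c * w) \<partial>lborel)"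
      using c by (intro lborel_integral_real_affine) auto
    also have "(\<lambda>w. (2 * pi / d n * std_normal_density (2 * pi * (s - (s + c * w)) / d n)) *\<^sub>R f (s + c * w)) =
        (\<lambda>w. (1 / c) *\<^sub>R (std_normal_density w *\<^sub>R f (s + c * w)))"
    proof
      fix w
      have "2 * pi * (s - (s + c * w)) / d n = - w" using d0[of n] by (simp add: c_def field_simps)
      then show "(2 * pi / d n * std_normal_density (2 * pi * (s - (s + c * w)) / d n)) *\<^sub>R f (s + c * w) =
        (1 / c) *\<^sub>R (std_normal_density w *\<^sub>R f (s + c * w))" by (simp add: dc std_normal_density_def)
    qed
    also have "\<bar>c\<bar> *\<^sub>R (\<integral>w. (1 / c) *\<^sub>R (std_normal_density w *\<^sub>R f (s + c * w)) \<partial>lborel) =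
        (\<integral>w. std_normal_density w *\<^sub>R f (s + c * w) \<partial>lborel)"
      unfolding scaleR_conv_of_real integral_mult_right_zero using c by simp
    finally show ?thesis by (simp only: c_def)
  qed
  have L2: "(\<lambda>n. \<integral>w. std_normal_density w *\<^sub>R f (s + d n / (2 * pi) * w) \<partial>lborel) \<longlonglongrightarrow>
      (\<integral>w. std_normal_density w *\<^sub>R f s \<partial>lborel)"
  proof -
    obtain C where C: "\<And>x. norm (f x) \<le> C" using test_bounded[OF f] by blast
    show ?thesis
    proof (rule integral_dominated_convergence[where w="\<lambda>w. std_normal_density w * C"])
      show "AE w in lborel. (\<lambda>n. std_normal_density w *\<^sub>R f (s + d n / (2 * pi) * w)) \<longlonglongrightarrow> std_normal_density w *\<^sub>R f s"
      proof (intro AE_I2 tendsto_scaleR tendsto_const)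
        fix w
        have "(\<lambda>n. s + d n / (2 * pi) * w) \<longlonglongrightarrow> s + 0 / (2 * pi) * w"
          by (intro tendsto_intros dl) auto
        then show "(\<lambda>n. f (s + d n / (2 * pi) * w)) \<longlonglongrightarrow> f s"
          by (intro continuous_on_tendsto_compose[OF test_continuous[OF f, of UNIV]]) auto
      qed
      show "AE w in lborel. norm (std_normal_density w *\<^sub>R f (s + d n / (2 * pi) * w)) \<le> std_normal_density w * C" for n
        using C by (intro AE_I2) (simp add: normal_density_nonneg mult_left_mono)
    qed auto
  qed
  have "(\<integral>w. std_normal_density w *\<^sub>R f s \<partial>lborel) = f s" by simp
  with L1 L2 show ?thesis unfolding eq by (auto intro: LIMSEQ_unique)
qed

section \<open>Pairing a bounded family of point masses with test functions\<close>

definition bump :: "real \<Rightarrow> complex" where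
  "bump = (SOME r. r \<in> test_functions \<and> (\<forall>x. \<bar>x\<bar> \<le> 1 \<longrightarrow> r x = 1) \<and> (\<forall>x. 2 \<le> \<bar>x\<bar> \<longrightarrow> r x = 0))"

lemma bump: "bump \<in> test_functions" "\<bar>x\<bar> \<le> 1 \<Longrightarrow> bump x = 1" "2 \<le> \<bar>x\<bar> \<Longrightarrow> bump x = 0"
proof -
  have "\<exists>r. r \<in> test_functions \<and> (\<forall>x. \<bar>x\<bar> \<le> 1 \<longrightarrow> r x = 1) \<and> (\<forall>x. 2 \<le> \<bar>x\<bar> \<longrightarrow> r x = 0)"
    using bump_exists by metis
  from someI_ex[OF this, folded bump_def]
  show "bump \<in> test_functions" "\<bar>x\<bar> \<le> 1 \<Longrightarrow> bump x = 1" "2 \<le> \<bar>x\<bar> \<Longrightarrow> bump x = 0"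
    by blast+
qed

definition bump_at :: "real \<Rightarrow> real \<Rightarrow> real \<Rightarrow> complex" where
  "bump_at s e x = bump ((x - s) / e)"

lemma bump_at:
  assumes "e > 0"
  shows "bump_at s e \<in> test_functions" "\<bar>x - s\<bar> \<le> e \<Longrightarrow> bump_at s e x = 1"
    "2 * e \<le> \<bar>x - s\<bar> \<Longrightarrow> bump_at s e x = 0"
proof -
  have "(\<lambda>x. bump ((1 / e) * x + (- s / e))) \<in> test_functions"
    using assms by (intro test_affine bump) auto
  also have "(\<lambda>x. bump ((1 / e) * x + (- s / e))) = bump_at s e"
    by (simp add: fun_eq_iff bump_at_def diff_divide_distrib)
  finally show "bump_at s e \<in> test_functions" .
  show "\<bar>x - s\<bar> \<le> e \<Longrightarrow> bump_at s e x = 1"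
    unfolding bump_at_def by (rule bump(2)) (use assms in \<open>simp add: abs_divide\<close>)
  show "2 * e \<le> \<bar>x - s\<bar> \<Longrightarrow> bump_at s e x = 0"
    unfolding bump_at_def by (rule bump(3)) (use assms in \<open>simp add: abs_divide pos_le_divide_eq\<close>)
qed

lemma fourier_rescale:
  assumes f: "f \<in> borel_measurable borel" and e: "e > 0"
  shows "fourier (\<lambda>s. f ((s - s0) / e)) t = e *\<^sub>R (ec (- (s0 * t)) * fourier f (e * t))"
proof -
  note [measurable] = f
  have "fourier (\<lambda>s. f ((s - s0) / e)) t = (\<integral>s. ec (- (t * s)) * f ((s - s0) / e) \<partial>lborel)"
    by (intro fourier_eq) measurable
  also have "\<dots> = \<bar>e\<bar> *\<^sub>R (\<integral>u. ec (- (t * (s0 + e * u))) * f ((s0 + e * u - s0) / e) \<partial>lborel)"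
    using e by (intro lborel_integral_real_affine) auto
  also have "(\<lambda>u. ec (- (t * (s0 + e * u))) * f ((s0 + e * u - s0) / e)) =
      (\<lambda>u. ec (- (s0 * t)) * (ec (- ((e * t) * u)) * f u))"
  proof
    fix u
    have "ec (- (t * (s0 + e * u))) = ec (- (s0 * t)) * ec (- ((e * t) * u))"
      by (subst ec_add[symmetric]) (simp add: algebra_simps)
    then show "ec (- (t * (s0 + e * u))) * f ((s0 + e * u - s0) / e) =
      ec (- (s0 * t)) * (ec (- ((e * t) * u)) * f u)" using e by simp
  qed
  also have "\<bar>e\<bar> *\<^sub>R (\<integral>u. ec (- (s0 * t)) * (ec (- ((e * t) * u)) * f u) \<partial>lborel) =
      e *\<^sub>R (ec (- (s0 * t)) * fourier f (e * t))"
    using e by (simp add: fourier_eq[OF f])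
  finally show ?thesis .
qed


text \<open>The \<open>L\<^sup>1\<close> modulus of continuity of the fixed kernel \<open>fourier bump\<close>. The local estimates below depend
  on the frequency window only through a rescaling of this one function.\<close>

definition osc :: "real \<Rightarrow> real" where
  "osc h = (\<integral>t. norm (fourier bump (t + h) - fourier bump t) \<partial>lborel)"

lemma fourier_bump_borel [measurable]: "fourier bump \<in> borel_measurable borel"
  by (intro fourier_test_borel bump)

lemma integrable_shift:
  fixes f :: "real \<Rightarrow> 'a::{banach, second_countable_topology}"
  assumes "integrable lborel f"
  shows "integrable lborel (\<lambda>t. f (t + h))" "integrable lborel (\<lambda>t. f (h - t))"
  using lborel_integrable_real_affine[OF assms, of 1 h] lborel_integrable_real_affine[OF assms, of "-1" h]
  by (simp_all add: add.commute)

lemma integral_shift: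
  fixes f :: "real \<Rightarrow> 'a::{banach, second_countable_topology}"
  shows "(\<integral>t. f (t + h) \<partial>lborel) = (\<integral>t. f t \<partial>lborel)"
  using lborel_integral_real_affine[of 1 f h] by (simp add: add.commute)

lemma osc_measurable [measurable]: "osc \<in> borel_measurable borel"
  unfolding osc_def[abs_def] by measurable

lemma osc_integrable: "integrable lborel (\<lambda>t. fourier bump (t + h) - fourier bump t)"
  by (intro Bochner_Integration.integrable_diff integrable_shift fourier_test_integrable bump)

lemma osc_nonneg: "0 \<le> osc h"
  unfolding osc_def by simp

lemma osc_le: "osc h \<le> 2 * (\<integral>t. norm (fourier bump t) \<partial>lborel)"
proof -
  have i: "integrable lborel (fourier bump)" by (intro fourier_test_integrable bump)
  have "osc h \<le> (\<integral>t. norm (fourier bump (t + h)) + norm (fourier bump t) \<partial>lborel)"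
    unfolding osc_def using i osc_integrable integrable_shift(1)[OF i]
    by (intro integral_mono norm_triangle_ineq4) auto
  also have "\<dots> = (\<integral>t. norm (fourier bump (t + h)) \<partial>lborel) + (\<integral>t. norm (fourier bump t) \<partial>lborel)"
    using i integrable_shift(1)[OF i] by (intro Bochner_Integration.integral_add) auto
  also have "(\<integral>t. norm (fourier bump (t + h)) \<partial>lborel) = (\<integral>t. norm (fourier bump t) \<partial>lborel)"
    by (rule integral_shift)
  finally show ?thesis by simp
qed

text \<open>Continuity of translation in \<open>L\<^sup>1\<close>; the cell majorants make it a case of dominated convergence.\<close>

lemma osc_tendsto:
  assumes X: "X \<longlonglongrightarrow> 0"
  shows "(\<lambda>n. osc (X n)) \<longlonglongrightarrow> 0"
proof -
  obtain B where B: "amalg B (fourier bump)" using fourier_test_amalg bump(1) by blast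
  obtain N where N: "\<And>n. n \<ge> N \<Longrightarrow> norm (X n - 0) < 1" using LIMSEQ_D[OF X, of 1] by auto
  have w: "integrable lborel (\<lambda>t::real. nbr_sum B \<lfloor>t\<rfloor> + B \<lfloor>t\<rfloor>)"
  proof (rule Bochner_Integration.integrable_add)
    have "amalg (nbr_sum B) (\<lambda>t::real. nbr_sum B \<lfloor>t\<rfloor>)"
      unfolding amalg_def using nbr_sum(1,2)[OF B] by simp
    then show "integrable lborel (\<lambda>t::real. nbr_sum B \<lfloor>t\<rfloor>)" by (rule amalg_integrable) measurable
    have "amalg B (\<lambda>t::real. B \<lfloor>t\<rfloor>)"
      unfolding amalg_def using amalgD[OF B] by simp
    then show "integrable lborel (\<lambda>t::real. B \<lfloor>t\<rfloor>)" by (rule amalg_integrable) measurable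
  qed
  have "(\<lambda>n. osc (X (n + N))) \<longlonglongrightarrow> (\<integral>t. 0 \<partial>(lborel :: real measure))"
    unfolding osc_def
  proof (rule integral_dominated_convergence[OF _ _ w])
    show "AE t in lborel. (\<lambda>n. norm (fourier bump (t + X (n + N)) - fourier bump t)) \<longlonglongrightarrow> 0"
    proof (intro AE_I2 tendsto_norm_zero)
      fix t
      have "(\<lambda>n. t + X (n + N)) \<longlonglongrightarrow> t + 0"
        by (intro tendsto_intros LIMSEQ_ignore_initial_segment X)
      then have "(\<lambda>n. fourier bump (t + X (n + N))) \<longlonglongrightarrow> fourier bump (t + 0)"
        by (intro continuous_on_tendsto_compose[OF fourier_test_continuous[OF bump(1), of UNIV]]) auto
      from tendsto_diff[OF this tendsto_const[of "fourier bump t"]]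
      show "(\<lambda>n. fourier bump (t + X (n + N)) - fourier bump t) \<longlonglongrightarrow> 0" by simp
    qed
    show "AE t in lborel. norm (norm (fourier bump (t + X (n + N)) - fourier bump t)) \<le> nbr_sum B \<lfloor>t\<rfloor> + B \<lfloor>t\<rfloor>" for n
    proof (intro AE_I2)
      fix t
      have "norm (fourier bump (t + X (n + N))) \<le> nbr_sum B \<lfloor>t\<rfloor>"
        using N[of "n + N"] by (intro nbr_sum(3)[OF B]) simp
      then show "norm (norm (fourier bump (t + X (n + N)) - fourier bump t)) \<le> nbr_sum B \<lfloor>t\<rfloor> + B \<lfloor>t\<rfloor>"
        using norm_triangle_ineq4[of "fourier bump (t + X (n + N))" "fourier bump t"] amalgD(3)[OF B, of t] by simp
    qed
  qed auto
  then have "(\<lambda>n. osc (X (n + N))) \<longlonglongrightarrow> 0" by simp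
  then show ?thesis by (rule LIMSEQ_offset)
qed

text \<open>The family \<open>c\<close> on \<open>\<Gamma>\<close> stands for the measure \<open>\<Sum>g. c g \<delta>\<^sub>g\<close>. In it, \<open>wave f 0\<close> is the value at \<open>f\<close> of the
  Fourier transform of this measure, and \<open>wave f x\<close> the value at \<open>f\<close> multiplied by the character of
  frequency \<open>x\<close> (\<open>wave_modulate\<close>). Working with the bounded functions \<open>wave f\<close> instead of the distribution
  makes estimates in the supremum norm possible.\<close>

locale bounded_comb =
  fixes \<Gamma> :: "real set" and N :: int and c :: "real \<Rightarrow> complex" and M :: real
  assumes spaced: "spaced N \<Gamma>" and c_le: "\<And>g. g \<in> \<Gamma> \<Longrightarrow> norm (c g) \<le> M" and M0: "0 \<le> M"
begin

definition wave :: "(real \<Rightarrow> complex) \<Rightarrow> real \<Rightarrow> complex" where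
  "wave f x = (\<Sum>\<^sub>\<infinity>g\<in>\<Gamma>. c g * fourier f (g - x))"

lemma weighted_sums:
  fixes h :: "real \<Rightarrow> complex"
  assumes "amalg B h" "finite F" "F \<subseteq> \<Gamma>"
  shows "(\<Sum>g\<in>F. norm (c g * h (x - g))) \<le> M * (of_int N * (\<Sum>\<^sub>\<infinity>k. B k))"
    "(\<Sum>g\<in>F. norm (c g * h (g - x))) \<le> M * (of_int N * (\<Sum>\<^sub>\<infinity>k. B k))"
  using assms spaced c_le M0
  by (intro weighted_finite_sum[where A=\<Gamma>] amalg_finite_sum; simp)+

lemma weighted_summable:
  fixes h :: "real \<Rightarrow> complex"
  assumes "amalg B h"
  shows "(\<lambda>g. c g * h (x - g)) summable_on \<Gamma>" "(\<lambda>g. c g * h (g - x)) summable_on \<Gamma>"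
    "norm (\<Sum>\<^sub>\<infinity>g\<in>\<Gamma>. c g * h (x - g)) \<le> M * (of_int N * (\<Sum>\<^sub>\<infinity>k. B k))"
    "norm (\<Sum>\<^sub>\<infinity>g\<in>\<Gamma>. c g * h (g - x)) \<le> M * (of_int N * (\<Sum>\<^sub>\<infinity>k. B k))"
  using bounded_sums_imp_summable(3,4)[OF weighted_sums(1)[OF assms]]
    bounded_sums_imp_summable(3,4)[OF weighted_sums(2)[OF assms]] by auto

lemma wave_summable:
  assumes "f \<in> test_functions" shows "(\<lambda>g. c g * fourier f (g - x)) summable_on \<Gamma>"
  using fourier_test_amalg[OF assms] weighted_summable(2) by metis

lemma wave_bounded:
  assumes "f \<in> test_functions"
  obtains S where "S \<ge> 0" "\<And>x. norm (wave f x) \<le> S"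
proof -
  obtain B where B: "amalg B (fourier f)" using fourier_test_amalg[OF assms] by blast
  have le: "norm (wave f x) \<le> M * (of_int N * (\<Sum>\<^sub>\<infinity>k. B k))" for x
    unfolding wave_def by (rule weighted_summable(4)[OF B])
  show ?thesis by (rule that[OF _ le]) (use le[of 0] norm_ge_zero order_trans in blast)
qed

lemma wave_add:
  assumes "f \<in> test_functions" "g \<in> test_functions"
  shows "wave (\<lambda>s. f s + g s) x = wave f x + wave g x"
  unfolding wave_def fourier_linear[OF assms] distrib_left
  by (intro infsum_add wave_summable assms)

lemma wave_modulate:
  assumes "f \<in> test_functions"
  shows "wave (\<lambda>s. ec (a * s) * f s) x = wave f (x + a)"
  unfolding wave_def fourier_modulate[OF test_borel[OF assms]] by (simp add: algebra_simps)

text \<open>By inversion, \<open>k\<close> is a superposition of characters with density \<open>fourier k\<close>, and multiplication by a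
  character translates the transform of \<open>f\<close>.\<close>

lemma fourier_mult:
  assumes f: "f \<in> test_functions" and k: "k \<in> test_functions"
  shows "fourier (\<lambda>s. f s * k s) a = (\<integral>t. fourier k t * fourier f (a - t) \<partial>lborel)"
proof -
  note [measurable] = test_borel[OF f] test_borel[OF k]
  have "fourier (\<lambda>s. f s * k s) a = (\<integral>s. (ec (- (a * s)) * f s) * (\<integral>t. ec (t * s) * fourier k t \<partial>lborel) \<partial>lborel)"
    using fourier_inversion[OF k] by (simp add: fourier_eq mult_ac)
  also have "\<dots> = (\<integral>t. fourier k t * (\<integral>s. ec (t * s) * (ec (- (a * s)) * f s) \<partial>lborel) \<partial>lborel)"
  proof (rule Fubini_kernel)
    show "integrable lborel (\<lambda>s. ec (- (a * s)) * f s)"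
      by (intro integrable_ec_mult test_integrable f) measurable
  qed (auto intro: fourier_test_integrable k)
  also have "(\<lambda>t. fourier k t * (\<integral>s. ec (t * s) * (ec (- (a * s)) * f s) \<partial>lborel)) =
      (\<lambda>t. fourier k t * fourier f (a - t))"
  proof
    fix t
    have "ec (t * s) * (ec (- (a * s)) * f s) = ec (- ((a - t) * s)) * f s" for s
    proof -
      have "ec (- ((a - t) * s)) = ec (t * s) * ec (- (a * s))"
        by (subst ec_add[symmetric]) (simp add: algebra_simps)
      then show ?thesis by simp
    qed
    then show "fourier k t * (\<integral>s. ec (t * s) * (ec (- (a * s)) * f s) \<partial>lborel) = fourier k t * fourier f (a - t)"
      by (simp only: fourier_eq[OF test_borel[OF f]])
  qed
  finally show ?thesis .
qed

lemma countable_comb: "countable \<Gamma>"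
  by (rule spaced_countable[OF spaced])

lemma wave_convolution:
  assumes f: "f \<in> test_functions" and K: "integrable lborel K"
  shows "integrable lborel (\<lambda>t. K t * wave f (x + t))"
    and "(\<integral>t. K t * wave f (x + t) \<partial>lborel) = (\<Sum>\<^sub>\<infinity>g\<in>\<Gamma>. c g * (\<integral>t. K t * fourier f (g - x - t) \<partial>lborel))"
proof -
  note [measurable] = fourier_test_borel[OF f]
  have [measurable]: "K \<in> borel_measurable borel" using K by auto
  obtain B where B: "amalg B (fourier f)" using fourier_test_amalg[OF f] by blast
  let ?S = "M * (of_int N * (\<Sum>\<^sub>\<infinity>k. B k))"
  let ?F = "\<lambda>g t. c g * (K t * fourier f (g - x - t))"
  have dom: "(\<Sum>g\<in>F. norm (?F g t)) \<le> norm (K t) * ?S" if "finite F" "F \<subseteq> \<Gamma>" for F t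
  proof -
    have "(\<Sum>g\<in>F. norm (?F g t)) = norm (K t) * (\<Sum>g\<in>F. norm (c g * fourier f (g - (x + t))))"
      by (simp add: sum_distrib_left norm_mult mult_ac diff_diff_eq)
    also have "\<dots> \<le> norm (K t) * ?S"
      by (intro mult_left_mono weighted_sums(2)[OF B that]) auto
    finally show ?thesis .
  qed
  have eq: "(\<Sum>\<^sub>\<infinity>g\<in>\<Gamma>. ?F g t) = K t * wave f (x + t)" for t
  proof -
    have "(\<Sum>\<^sub>\<infinity>g\<in>\<Gamma>. ?F g t) = (\<Sum>\<^sub>\<infinity>g\<in>\<Gamma>. K t * (c g * fourier f (g - (x + t))))"
      by (simp add: mult_ac diff_diff_eq)
    also have "\<dots> = K t * wave f (x + t)" unfolding wave_def by (rule infsum_cmult_right')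
    finally show ?thesis .
  qed
  note swap = integral_infsum_swap[of \<Gamma> ?F lborel "\<lambda>t. norm (K t) * ?S", OF countable_comb _ _ dom, unfolded eq]
  show "integrable lborel (\<lambda>t. K t * wave f (x + t))"
    by (rule swap(2)) (use K in auto)
  have "(\<integral>t. K t * wave f (x + t) \<partial>lborel) = (\<Sum>\<^sub>\<infinity>g\<in>\<Gamma>. \<integral>t. ?F g t \<partial>lborel)"
    by (rule swap(1)) (use K in auto)
  then show "(\<integral>t. K t * wave f (x + t) \<partial>lborel) = (\<Sum>\<^sub>\<infinity>g\<in>\<Gamma>. c g * (\<integral>t. K t * fourier f (g - x - t) \<partial>lborel))"
    by simp
qed

lemma wave_mult:
  assumes f: "f \<in> test_functions" and k: "k \<in> test_functions"
  shows "wave (\<lambda>s. f s * k s) x = (\<integral>t. fourier k t * wave f (x + t) \<partial>lborel)"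
  unfolding wave_convolution(2)[OF f fourier_test_integrable[OF k]]
  unfolding wave_def fourier_mult[OF f k] ..

text \<open>Associativity of convolution: the measure, \<open>G\<close> and \<open>fourier f\<close> are convolved in two different orders.
  The second integrand contains the shift series.\<close>

lemma wave_shift_series:
  assumes f: "f \<in> test_functions" and G: "amalg B G" "continuous_on UNIV G"
  shows "integrable lborel (\<lambda>t. G t * wave f (x - t))"
    and "(\<integral>t. G t * wave f (x - t) \<partial>lborel) =
      (\<integral>y. fourier f (y - x) * (\<Sum>\<^sub>\<infinity>g\<in>\<Gamma>. c g * G (y - g)) \<partial>lborel)"
proof -
  have [measurable]: "G \<in> borel_measurable borel" by (rule borel_measurable_continuous_onI[OF G(2)])
  note [measurable] = fourier_test_borel[OF f]
  have Gi: "integrable lborel G" by (rule amalg_integrable[OF G(1)]) measurable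
  have Gi': "integrable lborel (\<lambda>t. G (- t))" using integrable_shift(2)[OF Gi, of 0] by simp
  have "integrable lborel (\<lambda>t. G (- (- t)) * wave f (x + (- t)))"
    using integrable_shift(2)[OF wave_convolution(1)[OF f Gi', of x], of 0] by simp
  then show "integrable lborel (\<lambda>t. G t * wave f (x - t))" by simp
  have "(\<integral>t. G t * wave f (x - t) \<partial>lborel) = (\<integral>t. G (- t) * wave f (x + t) \<partial>lborel)"
    using lborel_integral_real_affine[of "-1" "\<lambda>t. G t * wave f (x - t)" 0] by simp
  also have "\<dots> = (\<Sum>\<^sub>\<infinity>g\<in>\<Gamma>. c g * (\<integral>t. G (- t) * fourier f (g - x - t) \<partial>lborel))"
    by (rule wave_convolution(2)[OF f Gi'])
  also have "\<dots> = (\<Sum>\<^sub>\<infinity>g\<in>\<Gamma>. \<integral>y. fourier f (y - x) * (c g * G (y - g)) \<partial>lborel)"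
  proof (rule infsum_cong)
    fix g
    have "(\<integral>t. G (- t) * fourier f (g - x - t) \<partial>lborel) = (\<integral>y. G (y - g) * fourier f (y - x) \<partial>lborel)"
      using lborel_integral_real_affine[of "-1" "\<lambda>t. G (- t) * fourier f (g - x - t)" g] by simp
    then have "c g * (\<integral>t. G (- t) * fourier f (g - x - t) \<partial>lborel) =
        (\<integral>y. c g * (G (y - g) * fourier f (y - x)) \<partial>lborel)" by simp
    then show "c g * (\<integral>t. G (- t) * fourier f (g - x - t) \<partial>lborel) =
        (\<integral>y. fourier f (y - x) * (c g * G (y - g)) \<partial>lborel)" by (simp add: mult_ac)
  qed
  also have "\<dots> = (\<integral>y. (\<Sum>\<^sub>\<infinity>g\<in>\<Gamma>. fourier f (y - x) * (c g * G (y - g))) \<partial>lborel)"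
  proof (rule integral_infsum_swap(1)[symmetric, OF countable_comb])
    let ?S = "M * (of_int N * (\<Sum>\<^sub>\<infinity>k. B k))"
    show "(\<Sum>g\<in>F. norm (fourier f (y - x) * (c g * G (y - g)))) \<le> norm (fourier f (y - x)) * ?S"
      if "finite F" "F \<subseteq> \<Gamma>" for F y
      using mult_left_mono[OF weighted_sums(1)[OF G(1) that, of y], of "norm (fourier f (y - x))"]
      by (simp add: sum_distrib_left norm_mult)
    show "integrable lborel (\<lambda>y. norm (fourier f (y - x)) * ?S)"
      using integrable_shift(1)[OF fourier_test_integrable[OF f], of "-x"]
      by (intro integrable_mult_left integrable_norm) simp
  qed measurable
  also have "\<dots> = (\<integral>y. fourier f (y - x) * (\<Sum>\<^sub>\<infinity>g\<in>\<Gamma>. c g * G (y - g)) \<partial>lborel)"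
    by (simp add: infsum_cmult_right')
  finally show "(\<integral>t. G t * wave f (x - t) \<partial>lborel) =
      (\<integral>y. fourier f (y - x) * (\<Sum>\<^sub>\<infinity>g\<in>\<Gamma>. c g * G (y - g)) \<partial>lborel)" .
qed

text \<open>A form of Bernstein's inequality: frequencies within \<open>e\<close> of \<open>s0\<close> cannot be told apart from \<open>s0\<close> on
  distances small against \<open>1 / e\<close>. A bump equal to 1 on the support of \<open>f\<close> does not change \<open>f\<close>, so
  \<open>wave f\<close> is its own convolution with the transform of the bump. A translation of \<open>wave f\<close> can be moved
  to that kernel, whose change in \<open>L\<^sup>1\<close> is measured by \<open>osc\<close>.\<close>

lemma wave_almost_constant:
  assumes f: "f \<in> test_functions" and supp: "\<And>s. e < \<bar>s - s0\<bar> \<Longrightarrow> f s = 0" and e: "e > 0"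
    and S: "\<And>x. norm (wave f x) \<le> S"
  shows "norm (wave f (x - h) - ec (- (s0 * h)) * wave f x) \<le> S * osc (e * h)"
proof -
  let ?K = "fourier (bump_at s0 e)"
  note b = bump_at(1)[OF e, of s0]
  have Keq: "?K t = e *\<^sub>R (ec (- (s0 * t)) * fourier bump (e * t))" for t
    unfolding bump_at_def[abs_def] by (rule fourier_rescale[OF test_borel[OF bump(1)] e])
  have Ki: "integrable lborel ?K" by (rule fourier_test_integrable[OF b])
  have "(\<lambda>s. f s * bump_at s0 e s) = f"
  proof
    fix s show "f s * bump_at s0 e s = f s"
      using supp[of s] bump_at(2)[OF e, of s s0] by (cases "e < \<bar>s - s0\<bar>") auto
  qed
  then have rep: "wave f y = (\<integral>t. ?K t * wave f (y + t) \<partial>lborel)" for y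
    using wave_mult[OF f b, of y] by simp
  have "wave f (x - h) = (\<integral>t. ?K t * wave f (x - h + t) \<partial>lborel)" by (rule rep)
  also have "\<dots> = (\<integral>t. ?K (t + h) * wave f (x - h + (t + h)) \<partial>lborel)"
    by (rule integral_shift[symmetric])
  finally have 1: "wave f (x - h) = (\<integral>t. ?K (t + h) * wave f (x + t) \<partial>lborel)" by simp
  have i1: "integrable lborel (\<lambda>t. ?K (t + h) * wave f (x + t))"
    by (intro wave_convolution f integrable_shift Ki)
  have i2: "integrable lborel (\<lambda>t. ?K t * wave f (x + t))" by (intro wave_convolution f Ki)
  have eq: "wave f (x - h) - ec (- (s0 * h)) * wave f x =
      (\<integral>t. ?K (t + h) * wave f (x + t) - ec (- (s0 * h)) * (?K t * wave f (x + t)) \<partial>lborel)"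
    unfolding 1 using i1 i2 rep[of x] by simp
  have "norm (wave f (x - h) - ec (- (s0 * h)) * wave f x) \<le> (\<integral>t. norm (?K (t + h) * wave f (x + t) - ec (- (s0 * h)) * (?K t * wave f (x + t))) \<partial>lborel)"
    unfolding eq by (rule integral_norm_bound)
  also have "\<dots> \<le> (\<integral>t. S * (e * norm (fourier bump (e * t + e * h) - fourier bump (e * t))) \<partial>lborel)"
  proof (rule integral_mono)
    show "integrable lborel (\<lambda>t. norm (?K (t + h) * wave f (x + t) - ec (- (s0 * h)) * (?K t * wave f (x + t))))"
      by (intro integrable_norm Bochner_Integration.integrable_diff integrable_mult_right i1 i2)
    have "integrable lborel (\<lambda>t. fourier bump (0 + e * t + e * h) - fourier bump (0 + e * t))"
      using lborel_integrable_real_affine[OF osc_integrable[of "e * h"], of e 0] e by simp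
    then show "integrable lborel (\<lambda>t. S * (e * norm (fourier bump (e * t + e * h) - fourier bump (e * t))))"
      by (intro integrable_mult_right integrable_norm) simp
    fix t
    have "ec (- (s0 * (t + h))) = ec (- (s0 * h)) * ec (- (s0 * t))"
      by (subst ec_add[symmetric]) (simp add: algebra_simps)
    then have "?K (t + h) * wave f (x + t) - ec (- (s0 * h)) * (?K t * wave f (x + t)) =
        e *\<^sub>R (ec (- (s0 * h)) * ec (- (s0 * t)) * (fourier bump (e * t + e * h) - fourier bump (e * t)) * wave f (x + t))"
      unfolding Keq by (simp add: scaleR_conv_of_real algebra_simps)
    then have "norm (?K (t + h) * wave f (x + t) - ec (- (s0 * h)) * (?K t * wave f (x + t))) =
        e * norm (fourier bump (e * t + e * h) - fourier bump (e * t)) * norm (wave f (x + t))"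
      using e by (simp add: norm_mult)
    also have "\<dots> \<le> e * norm (fourier bump (e * t + e * h) - fourier bump (e * t)) * S"
      using e S by (intro mult_left_mono) auto
    finally show "norm (?K (t + h) * wave f (x + t) - ec (- (s0 * h)) * (?K t * wave f (x + t))) \<le>
        S * (e * norm (fourier bump (e * t + e * h) - fourier bump (e * t)))" by (simp add: mult_ac)
  qed
  also have "\<dots> = S * osc (e * h)"
  proof -
    have "osc (e * h) = \<bar>e\<bar> *\<^sub>R (\<integral>t. norm (fourier bump (0 + e * t + e * h) - fourier bump (0 + e * t)) \<partial>lborel)"
      unfolding osc_def using e by (intro lborel_integral_real_affine) auto
    then show ?thesis using e by simp
  qed
  finally show ?thesis .
qed

end

section \<open>A vanishing shift series has a discrete spectrum\<close>

text \<open>A partition of unity as an induction principle. The bump at the centre of a ball of a finite cover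
  splits \<open>f\<close> into a local part and a part that vanishes near that centre, hence needs one ball less.\<close>

lemma test_partition_induct:
  assumes C: "compact C" and e: "\<And>s. s \<in> C \<Longrightarrow> e s > 0"
    and loc: "\<And>s f. s \<in> C \<Longrightarrow> f \<in> test_functions \<Longrightarrow> (\<And>t. e s < \<bar>t - s\<bar> \<Longrightarrow> f t = 0) \<Longrightarrow> P f"
    and zero: "P (\<lambda>x. 0)"
    and add: "\<And>f g. f \<in> test_functions \<Longrightarrow> g \<in> test_functions \<Longrightarrow> P f \<Longrightarrow> P g \<Longrightarrow> P (\<lambda>x. f x + g x)"
    and f: "f \<in> test_functions" "\<And>t. t \<notin> C \<Longrightarrow> f t = 0"
  shows "P f"
proof -
  obtain I where I: "finite I" "I \<subseteq> C" "C \<subseteq> (\<Union>s\<in>I. ball s (e s / 2))"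
  proof (rule compactE_image[OF C, of C "\<lambda>s. ball s (e s / 2)"])
    show "C \<subseteq> (\<Union>s\<in>C. ball s (e s / 2))"
    proof
      fix s assume "s \<in> C"
      then show "s \<in> (\<Union>s\<in>C. ball s (e s / 2))" using e[of s] by (intro UN_I[of s]) auto
    qed
  qed auto
  have "P f" if "f \<in> test_functions" "\<And>t. f t \<noteq> 0 \<Longrightarrow> t \<in> (\<Union>s\<in>I. ball s (e s / 2))" for f
    using I(1,2) that
  proof (induction I arbitrary: f rule: finite_induct)
    case empty
    then have "f = (\<lambda>x. 0)" by auto
    then show ?case using zero by simp
  next
    case (insert s I)
    have es: "e s / 2 > 0" and sC: "s \<in> C" using insert.prems(1) e by auto
    let ?r = "bump_at s (e s / 2)"
    note r = bump_at[OF es, where s=s]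
    let ?g = "\<lambda>x. f x * ?r x" and ?h = "\<lambda>x. f x * (1 + (-1) * ?r x)"
    have g: "?g \<in> test_functions" by (intro test_mult_smooth insert.prems test_smooth r)
    have h: "?h \<in> test_functions"
      by (intro test_mult_smooth insert.prems smooth_add(1) smooth_cmult smooth_const test_smooth r)
    have "P ?g" by (rule loc[OF sC g]) (use r(3) in simp)
    moreover have "P ?h"
    proof (rule insert.IH[OF _ h])
      fix t assume "?h t \<noteq> 0"
      then have "f t \<noteq> 0" "?r t \<noteq> 1" by auto
      then have "t \<notin> ball s (e s / 2)" using r(2)[of t] by (auto simp: dist_real_def abs_minus_commute)
      then show "t \<in> (\<Union>s\<in>I. ball s (e s / 2))" using insert.prems(3)[OF \<open>f t \<noteq> 0\<close>] by auto
    qed (use insert.prems in auto)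
    ultimately have "P (\<lambda>x. ?g x + ?h x)" by (rule add[OF g h])
    then show ?case by (simp add: algebra_simps)
  qed
  from this[OF f(1)] show ?thesis using f(2) I(3) by blast
qed

context bounded_comb
begin

lemma wave_zero [simp]: "wave (\<lambda>x. 0) x = 0"
  by (simp add: wave_def fourier_def)

context
  fixes B :: "int \<Rightarrow> real" and G :: "real \<Rightarrow> complex"
  assumes G: "amalg B G" "continuous_on UNIV G"
    and null: "\<And>y. (\<Sum>\<^sub>\<infinity>g\<in>\<Gamma>. c g * G (y - g)) = 0"
begin

lemma G_borel [measurable]: "G \<in> borel_measurable borel"
  by (rule borel_measurable_continuous_onI[OF G(2)])

lemma G_integrable: "integrable lborel G"
  by (rule amalg_integrable[OF G(1)]) measurable

text \<open>Write \<open>v = wave f\<close>. Since the convolution of \<open>G\<close> with \<open>v\<close> vanishes, \<open>fourier G s0 * v x\<close> is the integral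
  of \<open>G t * (ec (- (s0 * t)) * v x - v (x - t))\<close> over \<open>t\<close>. By \<open>wave_almost_constant\<close> it is at most
  \<open>S * (\<integral>t. norm (G t) * osc (e * t))\<close>, where \<open>S\<close> is the supremum of \<open>norm (v x)\<close>. For small \<open>e\<close> that
  integral is less than \<open>norm (fourier G s0)\<close>, which leaves only \<open>S = 0\<close>.\<close>

lemma wave_local_vanish:
  assumes s0: "fourier G s0 \<noteq> 0"
  obtains e where "e > 0"
    "\<And>f x. f \<in> test_functions \<Longrightarrow> (\<And>s. e < \<bar>s - s0\<bar> \<Longrightarrow> f s = 0) \<Longrightarrow> wave f x = 0"
proof -
  let ?b = "2 * (\<integral>t. norm (fourier bump t) \<partial>lborel)"
  define e where "e n = 1 / (1 + real n)" for n
  have e0: "e n > 0" for n by (simp add: e_def)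
  have el: "e \<longlonglongrightarrow> 0" unfolding e_def by (rule reciprocal_tendsto_0)
  have wi: "integrable lborel (\<lambda>t. norm (G t) * ?b)" using G_integrable by auto
  have bd: "norm (norm (G t) * osc (e n * t)) \<le> norm (G t) * ?b" for t n
    using osc_le[of "e n * t"] osc_nonneg[of "e n * t"] by (simp add: abs_mult mult_left_mono)
  have "(\<lambda>n. \<integral>t. norm (G t) * osc (e n * t) \<partial>lborel) \<longlonglongrightarrow> (\<integral>t. 0 \<partial>(lborel :: real measure))"
  proof (rule integral_dominated_convergence[OF _ _ wi])
    show "AE t in lborel. (\<lambda>n. norm (G t) * osc (e n * t)) \<longlonglongrightarrow> 0"
    proof (intro AE_I2 tendsto_mult_right_zero osc_tendsto)
      fix t show "(\<lambda>n. e n * t) \<longlonglongrightarrow> 0" using tendsto_mult_right[OF el, of t] by simp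
    qed
  qed (use bd in auto)
  then have lim: "(\<lambda>n. \<integral>t. norm (G t) * osc (e n * t) \<partial>lborel) \<longlonglongrightarrow> 0" by simp
  have "norm (fourier G s0) > 0" using s0 by simp
  from order_tendstoD(2)[OF lim this]
  obtain n where n: "(\<integral>t. norm (G t) * osc (e n * t) \<partial>lborel) < norm (fourier G s0)"
    unfolding eventually_sequentially by auto
  let ?I = "\<integral>t. norm (G t) * osc (e n * t) \<partial>lborel"
  show ?thesis
  proof (rule that[of "e n", OF e0])
    fix f x assume f: "f \<in> test_functions" and supp: "\<And>s. e n < \<bar>s - s0\<bar> \<Longrightarrow> f s = 0"
    define S where "S = (SUP x. norm (wave f x))"
    have bdd: "bdd_above (range (\<lambda>x. norm (wave f x)))"
      using wave_bounded[OF f] by (metis bdd_aboveI2)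
    have S: "norm (wave f x) \<le> S" for x unfolding S_def by (intro cSUP_upper bdd) auto
    have S0: "0 \<le> S" using S[of 0] norm_ge_zero order_trans by blast
    have key: "norm (fourier G s0) * norm (wave f x) \<le> S * ?I" for x
    proof -
      have i1: "integrable lborel (\<lambda>t. ec (- (s0 * t)) * G t)"
        by (intro integrable_ec_mult G_integrable) measurable
      have i2: "integrable lborel (\<lambda>t. G t * wave f (x - t))" by (rule wave_shift_series(1)[OF f G])
      have "(\<integral>t. G t * wave f (x - t) \<partial>lborel) = 0" unfolding wave_shift_series(2)[OF f G] null by simp
      then have eq: "fourier G s0 * wave f x = (\<integral>t. (ec (- (s0 * t)) * G t) * wave f x - G t * wave f (x - t) \<partial>lborel)"
        using i1 i2 by (simp add: fourier_eq)
      have "norm (fourier G s0 * wave f x) \<le> (\<integral>t. norm ((ec (- (s0 * t)) * G t) * wave f x - G t * wave f (x - t)) \<partial>lborel)"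
        unfolding eq by (rule integral_norm_bound)
      also have "\<dots> \<le> (\<integral>t. S * (norm (G t) * osc (e n * t)) \<partial>lborel)"
      proof (rule integral_mono)
        show "integrable lborel (\<lambda>t. norm ((ec (- (s0 * t)) * G t) * wave f x - G t * wave f (x - t)))"
          by (intro integrable_norm Bochner_Integration.integrable_diff integrable_mult_left i1 i2)
        have "integrable lborel (\<lambda>t. norm (G t) * osc (e n * t))"
          by (rule Bochner_Integration.integrable_bound[OF wi]) (use bd in \<open>auto intro: order_trans[OF _ abs_ge_self]\<close>)
        then show "integrable lborel (\<lambda>t. S * (norm (G t) * osc (e n * t)))" by (rule integrable_mult_right)
        fix t
        have "(ec (- (s0 * t)) * G t) * wave f x - G t * wave f (x - t) =
            - (G t * (wave f (x - t) - ec (- (s0 * t)) * wave f x))" by (simp add: algebra_simps)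
        then have "norm ((ec (- (s0 * t)) * G t) * wave f x - G t * wave f (x - t)) =
            norm (G t) * norm (wave f (x - t) - ec (- (s0 * t)) * wave f x)" by (simp only: norm_minus_cancel norm_mult)
        also have "\<dots> \<le> norm (G t) * (S * osc (e n * t))"
          by (intro mult_left_mono wave_almost_constant[OF f supp e0 S]) auto
        finally show "norm ((ec (- (s0 * t)) * G t) * wave f x - G t * wave f (x - t)) \<le> S * (norm (G t) * osc (e n * t))"
          by (simp add: mult_ac)
      qed
      finally show ?thesis by (simp add: norm_mult)
    qed
    have "S = 0"
    proof (rule ccontr)
      assume "S \<noteq> 0"
      then have "S > 0" using S0 by simp
      have "norm (wave f x) \<le> S * ?I / norm (fourier G s0)" for x
        using key[of x] s0 by (simp add: pos_le_divide_eq mult.commute)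
      then have "(SUP x. norm (wave f x)) \<le> S * ?I / norm (fourier G s0)"
        by (intro cSUP_least) auto
      then have "norm (fourier G s0) * S \<le> ?I * S"
        using s0 by (simp only: S_def[symmetric]) (simp add: pos_le_divide_eq mult.commute)
      then show False using n \<open>S > 0\<close> by simp
    qed
    then show "wave f x = 0" using S[of x] by simp
  qed
qed

lemma wave_vanish:
  assumes C: "compact C" "\<And>s. s \<in> C \<Longrightarrow> fourier G s \<noteq> 0"
    and f: "f \<in> test_functions" "\<And>t. t \<notin> C \<Longrightarrow> f t = 0"
  shows "wave f x = 0"
proof -
  have "\<exists>e. s \<in> C \<longrightarrow> e > 0 \<and> (\<forall>f x. f \<in> test_functions \<longrightarrow> (\<forall>t. e < \<bar>t - s\<bar> \<longrightarrow> f t = 0) \<longrightarrow> wave f x = 0)" for s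
    using wave_local_vanish[OF C(2)] by metis
  then obtain e where e: "\<And>s. s \<in> C \<Longrightarrow> e s > 0"
    "\<And>s f x. s \<in> C \<Longrightarrow> f \<in> test_functions \<Longrightarrow> (\<And>t. e s < \<bar>t - s\<bar> \<Longrightarrow> f t = 0) \<Longrightarrow> wave f x = 0"
    by metis
  have "\<forall>x. wave f x = 0"
  proof (rule test_partition_induct[where P="\<lambda>f. \<forall>x. wave f x = 0", OF C(1) e(1) _ _ _ f])
    show "\<And>s f. s \<in> C \<Longrightarrow> f \<in> test_functions \<Longrightarrow> (\<And>t. e s < \<bar>t - s\<bar> \<Longrightarrow> f t = 0) \<Longrightarrow> \<forall>x. wave f x = 0"
      using e(2) by blast
  qed (auto simp: wave_add)
  then show ?thesis by blast
qed

text \<open>Away from \<open>s0\<close> nothing contributes, by \<open>wave_vanish\<close>, so \<open>f\<close> may be cut down to an arbitrarily short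
  interval around \<open>s0\<close> without changing its wave. In the limit \<open>wave_almost_constant\<close> becomes an
  equality.\<close>

lemma wave_isolated:
  assumes eta: "eta > 0" and iso: "\<And>s. s \<noteq> s0 \<Longrightarrow> \<bar>s - s0\<bar> \<le> eta \<Longrightarrow> fourier G s \<noteq> 0"
    and f: "f \<in> test_functions" "\<And>s. eta < \<bar>s - s0\<bar> \<Longrightarrow> f s = 0"
  shows "wave f (x - h) = ec (- (s0 * h)) * wave f x"
proof -
  obtain S where S: "S \<ge> 0" "\<And>x. norm (wave f x) \<le> S" using wave_bounded[OF f(1)] by blast
  have le: "norm (wave f (x - h) - ec (- (s0 * h)) * wave f x) \<le> S * osc (2 * e * h)" if e: "e > 0" for e
  proof -
    let ?r = "bump_at s0 e"
    note r = bump_at[OF e, where s=s0]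
    let ?g = "\<lambda>x. f x * ?r x" and ?h = "\<lambda>x. f x * (1 + (-1) * ?r x)"
    have g: "?g \<in> test_functions" by (intro test_mult_smooth f test_smooth r)
    have h: "?h \<in> test_functions"
      by (intro test_mult_smooth f smooth_add(1) smooth_cmult smooth_const test_smooth r)
    have hv: "wave ?h y = 0" for y
    proof (rule wave_vanish[OF _ _ h])
      show "compact (cball s0 eta - ball s0 e)" by (intro compact_diff compact_cball open_ball)
      show "fourier G s \<noteq> 0" if "s \<in> cball s0 eta - ball s0 e" for s
        using that e by (intro iso) (auto simp: dist_real_def abs_minus_commute)
      show "?h t = 0" if "t \<notin> cball s0 eta - ball s0 e" for t
        using that f(2)[of t] r(2)[of t] by (auto simp: dist_real_def abs_minus_commute not_le)
    qed
    have "(\<lambda>x. ?g x + ?h x) = f" by (simp add: fun_eq_iff algebra_simps)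
    then have fg: "wave f y = wave ?g y" for y using wave_add[OF g h, of y] hv by simp
    show ?thesis unfolding fg
      by (rule wave_almost_constant[OF g]) (use e S(2) r(3) in \<open>auto simp: fg[symmetric]\<close>)
  qed
  define e where "e n = 1 / (1 + real n)" for n
  have e0: "e n > 0" for n by (simp add: e_def)
  have el: "e \<longlonglongrightarrow> 0" unfolding e_def by (rule reciprocal_tendsto_0)
  have "(\<lambda>n. 2 * e n * h) \<longlonglongrightarrow> 2 * 0 * h" by (intro tendsto_intros el)
  then have "(\<lambda>n. osc (2 * e n * h)) \<longlonglongrightarrow> 0" by (intro osc_tendsto) simp
  from tendsto_mult_left[OF this, of S]
  have "norm (wave f (x - h) - ec (- (s0 * h)) * wave f x) \<le> S * 0"
    by (rule LIMSEQ_le_const) (use le[OF e0] in auto)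
  then show ?thesis by simp
qed

text \<open>The mass is the value at a bump around \<open>s0\<close>. The wave of the bump is an exponential of frequency
  \<open>s0\<close>; multiplying the bump by \<open>f\<close> averages this exponential against \<open>fourier f\<close>, which by inversion is
  evaluation of \<open>f\<close> at \<open>s0\<close>.\<close>

lemma wave_isolated_mass:
  assumes eta: "eta > 0" and iso: "\<And>s. s \<noteq> s0 \<Longrightarrow> \<bar>s - s0\<bar> \<le> eta \<Longrightarrow> fourier G s \<noteq> 0"
  obtains a where
    "\<And>f. f \<in> test_functions \<Longrightarrow> (\<And>s. eta / 2 < \<bar>s - s0\<bar> \<Longrightarrow> f s = 0) \<Longrightarrow> wave f 0 = a * f s0"
proof -
  have e2: "eta / 2 > 0" using eta by simp
  let ?r = "bump_at s0 (eta / 2)"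
  note r = bump_at[OF e2, where s=s0]
  have w: "wave ?r t = ec (s0 * t) * wave ?r 0" for t
  proof -
    have "wave ?r (0 - (- t)) = ec (- (s0 * (- t))) * wave ?r 0"
    proof (rule wave_isolated[OF eta _ r(1)])
      show "fourier G s \<noteq> 0" if "s \<noteq> s0" "\<bar>s - s0\<bar> \<le> eta" for s using that by (rule iso)
      show "?r s = 0" if "eta < \<bar>s - s0\<bar>" for s using that by (intro r(3)) simp
    qed
    then show ?thesis by simp
  qed
  show ?thesis
  proof (rule that[of "wave ?r 0"])
    fix f assume f: "f \<in> test_functions" and supp: "\<And>s. eta / 2 < \<bar>s - s0\<bar> \<Longrightarrow> f s = 0"
    have "(\<lambda>s. ?r s * f s) = f"
    proof
      fix s show "?r s * f s = f s"
        using supp[of s] r(2)[of s] by (cases "eta / 2 < \<bar>s - s0\<bar>") auto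
    qed
    then have "wave f 0 = (\<integral>t. fourier f t * wave ?r (0 + t) \<partial>lborel)"
      using wave_mult[OF r(1) f, of 0] by simp
    also have "(\<lambda>t. fourier f t * wave ?r (0 + t)) = (\<lambda>t. wave ?r 0 * (fourier f t * ec (t * s0)))"
    proof
      fix t show "fourier f t * wave ?r (0 + t) = wave ?r 0 * (fourier f t * ec (t * s0))"
        using w[of t] by (simp add: mult_ac)
    qed
    finally show "wave f 0 = wave ?r 0 * f s0" by (simp add: fourier_inversion[OF f])
  qed
qed

text \<open>Every frequency \<open>s\<close> has a window in which the functional \<open>wave f 0\<close> is \<open>v s * f s\<close> and in which no other
  zero of \<open>fourier G\<close> lies; the windows are glued by \<open>test_partition_induct\<close>.\<close>

theorem wave_atomic:
  assumes fin: "\<And>a b. finite (Zer (fourier G) \<inter> {a..b})"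
  obtains v where "atoms v \<subseteq> Zer (fourier G)"
    "\<And>f. f \<in> test_functions \<Longrightarrow> wave f 0 = (\<Sum>\<^sub>\<infinity>s\<in>atoms v. v s * f s)"
proof -
  have "\<exists>e a. e > 0 \<and> (fourier G s \<noteq> 0 \<longrightarrow> a = 0) \<and>
     (\<forall>t. t \<noteq> s \<longrightarrow> \<bar>t - s\<bar> \<le> e \<longrightarrow> fourier G t \<noteq> 0) \<and>
     (\<forall>f. f \<in> test_functions \<longrightarrow> (\<forall>t. e < \<bar>t - s\<bar> \<longrightarrow> f t = 0) \<longrightarrow> wave f 0 = a * f s)" for s
  proof -
    have "finite (Zer (fourier G) \<inter> {s - 1..s + 1} - {s})" using fin by auto
    from finite_set_avoid[OF this, of s]
    obtain d where d: "d > 0" "\<And>t. t \<in> Zer (fourier G) \<inter> {s - 1..s + 1} - {s} \<Longrightarrow> t \<noteq> s \<Longrightarrow> d \<le> dist s t"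
      by blast
    define eta where "eta = min 1 (d / 2)"
    have eta: "eta > 0" using d by (simp add: eta_def)
    have iso: "fourier G t \<noteq> 0" if "t \<noteq> s" "\<bar>t - s\<bar> \<le> eta" for t
    proof
      assume "fourier G t = 0"
      then have "t \<in> Zer (fourier G) \<inter> {s - 1..s + 1} - {s}" using that by (auto simp: Zer_def eta_def)
      then have "d \<le> \<bar>t - s\<bar>" using d(2)[of t] that by (simp add: dist_real_def abs_minus_commute)
      then show False using that(2) d(1) by (simp add: eta_def)
    qed
    obtain a where a: "\<And>f. f \<in> test_functions \<Longrightarrow> (\<And>t. eta / 2 < \<bar>t - s\<bar> \<Longrightarrow> f t = 0) \<Longrightarrow> wave f 0 = a * f s"
      using wave_isolated_mass[OF eta iso] by blast
    have "wave f 0 = 0" if nz: "fourier G s \<noteq> 0" and f: "f \<in> test_functions"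
      and supp: "\<And>t. eta / 2 < \<bar>t - s\<bar> \<Longrightarrow> f t = 0" for f
    proof (rule wave_vanish[OF _ _ f])
      show "compact (cball s eta)" by simp
      show "fourier G t \<noteq> 0" if "t \<in> cball s eta" for t
        using that iso[of t] nz by (cases "t = s") (auto simp: dist_real_def abs_minus_commute)
      show "f t = 0" if "t \<notin> cball s eta" for t
        by (rule supp) (use that eta in \<open>auto simp: dist_real_def abs_minus_commute\<close>)
    qed
    then show ?thesis
      using a eta iso
      by (intro exI[of _ "eta / 2"] exI[of _ "if fourier G s = 0 then a else 0"]) auto
  qed
  then obtain e v where e: "\<And>s. e s > 0" and v0: "\<And>s. fourier G s \<noteq> 0 \<Longrightarrow> v s = 0"
    and iso: "\<And>s t. t \<noteq> s \<Longrightarrow> \<bar>t - s\<bar> \<le> e s \<Longrightarrow> fourier G t \<noteq> 0"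
    and loc: "\<And>s f. f \<in> test_functions \<Longrightarrow> (\<And>t. e s < \<bar>t - s\<bar> \<Longrightarrow> f t = 0) \<Longrightarrow> wave f 0 = v s * f s"
    by metis
  have sub: "atoms v \<subseteq> Zer (fourier G)" using v0 by (auto simp: atoms_def Zer_def)
  have sm: "(\<lambda>s. v s * f s) summable_on atoms v" if f: "f \<in> test_functions" for f
  proof (rule finite_nonzero_values_imp_summable_on)
    obtain R where R: "\<And>x. R < \<bar>x\<bar> \<Longrightarrow> f x = 0" using test_bound[OF f] by blast
    have "{s \<in> atoms v. v s * f s \<noteq> 0} \<subseteq> Zer (fourier G) \<inter> {-R..R}"
      using sub R by (force simp: not_less abs_le_iff)
    then show "finite {s \<in> atoms v. v s * f s \<noteq> 0}" using fin finite_subset by blast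
  qed
  show ?thesis
  proof (rule that[OF sub])
    fix f assume f: "f \<in> test_functions"
    obtain R where R: "\<And>x. R < \<bar>x\<bar> \<Longrightarrow> f x = 0" using test_bound[OF f] by blast
    show "wave f 0 = (\<Sum>\<^sub>\<infinity>s\<in>atoms v. v s * f s)"
    proof (rule test_partition_induct[where P="\<lambda>f. wave f 0 = (\<Sum>\<^sub>\<infinity>s\<in>atoms v. v s * f s)" and C="{-R..R}" and e=e, OF _ e _ _ _ f])
      fix s f assume f: "f \<in> test_functions" "\<And>t. e s < \<bar>t - s\<bar> \<Longrightarrow> f t = 0"
      have "(\<Sum>\<^sub>\<infinity>t\<in>atoms v. v t * f t) = (\<Sum>\<^sub>\<infinity>t\<in>{s}. v t * f t)"
      proof (rule infsum_cong_neutral)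
        fix t assume "t \<in> atoms v - {s}"
        then have "fourier G t = 0" "t \<noteq> s" using sub by (auto simp: Zer_def)
        then have "e s < \<bar>t - s\<bar>" using iso[of t s] by (meson not_less)
        then show "v t * f t = 0" using f(2) by simp
      qed (auto simp: atoms_def)
      then show "wave f 0 = (\<Sum>\<^sub>\<infinity>t\<in>atoms v. v t * f t)" using loc[OF f] by simp
    next
      fix f g assume fg: "f \<in> test_functions" "g \<in> test_functions"
        "wave f 0 = (\<Sum>\<^sub>\<infinity>s\<in>atoms v. v s * f s)" "wave g 0 = (\<Sum>\<^sub>\<infinity>s\<in>atoms v. v s * g s)"
      show "wave (\<lambda>x. f x + g x) 0 = (\<Sum>\<^sub>\<infinity>s\<in>atoms v. v s * (f s + g s))"
        unfolding wave_add[OF fg(1,2)] fg(3,4) distrib_left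
        by (intro infsum_add[symmetric] sm fg)
    qed (use R in auto)
  qed
qed

text \<open>The functional \<open>\<Sum>g. c g * f g\<close> converges absolutely for every Schwartz function. Its continuity follows
  from quadratic decay alone, so only seminorms without derivatives enter.\<close>

theorem crystalline_of_null:
  assumes fin: "\<And>a b. finite (Zer (fourier G) \<inter> {a..b})"
    and c0: "\<And>g. g \<notin> \<Gamma> \<Longrightarrow> c g = 0"
  obtains v where "crystalline_measure c v" "atoms v \<subseteq> Zer (fourier G)"
proof -
  obtain v where v: "atoms v \<subseteq> Zer (fourier G)"
    "\<And>f. f \<in> test_functions \<Longrightarrow> wave f 0 = (\<Sum>\<^sub>\<infinity>s\<in>atoms v. v s * f s)"
    using wave_atomic[OF fin] by blast
  define T where "T f = (\<Sum>\<^sub>\<infinity>g\<in>\<Gamma>. c g * f g)" for f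
  have am: "amalg (\<lambda>k. 3 * (schwartz_seminorm 0 0 f + schwartz_seminorm 2 0 f) / (1 + (of_int k)\<^sup>2)) f"
    if f: "f \<in> schwartz_space" for f
  proof -
    have bdd: "bdd_above (range (\<lambda>x. \<bar>x\<bar> ^ m * norm (nth_deriv n f x)))" for m n
      using f by (simp add: schwartz_space_def)
    have le: "\<bar>x\<bar> ^ m * norm (f x) \<le> schwartz_seminorm m 0 f" for m x
      unfolding schwartz_seminorm_def using cSUP_upper[OF UNIV_I bdd[of m 0], of x] by simp
    have nn: "0 \<le> schwartz_seminorm m 0 f" for m
      using le[of 0 m] by (smt (verit) mult_nonneg_nonneg norm_ge_zero zero_le_power abs_ge_zero)
    have "norm (f x) \<le> 3 * (schwartz_seminorm 0 0 f + schwartz_seminorm 2 0 f) / (1 + (of_int \<lfloor>x\<rfloor>)\<^sup>2)" for x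
      using le[of x 0] le[of x 2] by (intro quadratic_decay_cells) (simp_all add: distrib_right)
    then show ?thesis unfolding amalg_def using nn summable_inverse_square_int by (auto simp: add_nonneg_nonneg)
  qed
  note smT = weighted_summable(2)[OF am, of _ 0, simplified]
  show ?thesis
  proof (rule that[OF _ v(1)])
    show "crystalline_measure c v" unfolding crystalline_measure_def
    proof (intro conjI exI[of _ T])
      have at: "atoms c \<subseteq> \<Gamma>" using c0 by (auto simp: atoms_def)
      show "locally_finite_set (atoms c)" unfolding locally_finite_set_def
        using spaced_finite_Icc[OF spaced] at by (meson Int_mono finite_subset order_refl)
      show "locally_finite_set (atoms v)" unfolding locally_finite_set_def
        using fin v(1) by (meson Int_mono finite_subset order_refl)
      show "is_atomic_measure T c" unfolding is_atomic_measure_def T_def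
        using at by (intro ballI infsum_cong_neutral) (auto simp: atoms_def)
      show "is_atomic_measure (fourier_distr T) v" unfolding is_atomic_measure_def fourier_distr_def
        using v(2) by (simp add: T_def wave_def)
      show "tempered_distribution T" unfolding tempered_distribution_def
      proof (intro conjI ballI allI)
        fix f g assume "f \<in> schwartz_space" "g \<in> schwartz_space"
        then show "T (\<lambda>x. f x + g x) = T f + T g" unfolding T_def distrib_left
          by (intro infsum_add smT)
      next
        fix a f
        have "T (\<lambda>x. a * f x) = (\<Sum>\<^sub>\<infinity>g\<in>\<Gamma>. a * (c g * f g))" by (simp add: T_def mult_ac)
        then show "T (\<lambda>x. a * f x) = a * T f" by (simp add: T_def infsum_cmult_right')
      next
        let ?s = "\<Sum>\<^sub>\<infinity>k::int. 1 / (1 + (of_int k)\<^sup>2) :: real"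
        have "norm (T f) \<le> (M * (of_int N * (3 * ?s))) * (\<Sum>m\<le>2. \<Sum>n\<le>2. schwartz_seminorm m n f)"
          if f: "f \<in> schwartz_space" for f
        proof -
          have bdd: "bdd_above (range (\<lambda>x. \<bar>x\<bar> ^ m * norm (nth_deriv n f x)))" for m n
            using f by (simp add: schwartz_space_def)
          have nn: "0 \<le> schwartz_seminorm m n f" for m n
            unfolding schwartz_seminorm_def by (rule cSUP_upper2[OF bdd, of 0]) auto
          let ?q = "schwartz_seminorm 0 0 f + schwartz_seminorm 2 0 f"
          have "norm (T f) \<le> M * (of_int N * (\<Sum>\<^sub>\<infinity>k::int. 3 * ?q / (1 + (of_int k)\<^sup>2)))"
            using weighted_summable(4)[OF am[OF f], of 0] by (simp add: T_def)
          also have "(\<Sum>\<^sub>\<infinity>k::int. 3 * ?q / (1 + (of_int k)\<^sup>2)) = (3 * ?q) * ?s"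
            using infsum_cmult_right'[of "3 * ?q" "\<lambda>k::int. 1 / (1 + (of_int k)\<^sup>2)" UNIV] by simp
          also have "M * (of_int N * ((3 * ?q) * ?s)) = (M * (of_int N * (3 * ?s))) * ?q" by simp
          also have "\<dots> \<le> (M * (of_int N * (3 * ?s))) * (\<Sum>m\<le>2. \<Sum>n\<le>2. schwartz_seminorm m n f)"
          proof (rule mult_left_mono)
            have "?q \<le> (\<Sum>m\<le>2. schwartz_seminorm m 0 f)" using nn by (simp add: eval_nat_numeral)
            also have "\<dots> \<le> (\<Sum>m\<le>2. \<Sum>n\<le>2. schwartz_seminorm m n f)"
              by (intro sum_mono member_le_sum) (use nn in auto)
            finally show "?q \<le> (\<Sum>m\<le>2. \<Sum>n\<le>2. schwartz_seminorm m n f)" .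
            show "0 \<le> M * (of_int N * (3 * ?s))"
              using spaced M0 by (auto simp: spaced_def intro!: mult_nonneg_nonneg infsum_nonneg add_nonneg_nonneg)
          qed
          finally show ?thesis .
        qed
        then show "\<exists>C N. \<forall>f\<in>schwartz_space. norm (T f) \<le> C * (\<Sum>m\<le>N. \<Sum>n\<le>N. schwartz_seminorm m n f)"
          by blast
      qed
    qed
  qed
qed

end

end

section \<open>Compactness of weighted spaced sets\<close>

text \<open>Tychonoff's theorem together with the metrizability of countable products replaces a diagonal argument.\<close>

lemma compact_componentwise_subsequence:
  fixes f :: "nat \<Rightarrow> 'i::countable \<Rightarrow> 'a::metric_space"
  assumes K: "compact K" and f: "\<And>k j. f k j \<in> K"
  obtains r l where "strict_mono r" "\<And>j. l j \<in> K" "\<And>j. (\<lambda>k. f (r k) j) \<longlonglongrightarrow> l j"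
proof -
  have "compactin (product_topology (\<lambda>_. euclidean) UNIV) (PiE UNIV (\<lambda>_::'i. K))"
    using K by (simp add: compactin_PiE)
  then have "compact (PiE UNIV (\<lambda>_::'i. K))"
    by (simp add: euclidean_product_topology)
  then have "seq_compact (PiE UNIV (\<lambda>_::'i. K))" by (rule compact_imp_seq_compact)
  then obtain l r where l: "l \<in> PiE UNIV (\<lambda>_::'i. K)" "strict_mono r" "(f \<circ> r) \<longlonglongrightarrow> l"
    using f by (elim seq_compactE[of _ f]) auto
  have "(\<lambda>k. f (r k) j) \<longlonglongrightarrow> l j" for j
    using continuous_on_tendsto_compose[OF continuous_on_product_coordinates l(3)] by simp
  then show ?thesis using l by (intro that[of r l]) (auto simp: PiE_def Pi_def)
qed

text \<open>For an empty cell the value is its left end, so that in every case the point lies in the closed cell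
  \<open>[j / N, (j + 1) / N]\<close> and the coordinates of all cells range in one compact set.\<close>

definition cell_point :: "int \<Rightarrow> real set \<Rightarrow> int \<Rightarrow> real" where
  "cell_point N S j = (if \<exists>p\<in>S. \<lfloor>of_int N * p\<rfloor> = j then SOME p. p \<in> S \<and> \<lfloor>of_int N * p\<rfloor> = j else of_int j / of_int N)"

lemma cell_point_mem:
  assumes "\<exists>p\<in>S. \<lfloor>of_int N * p\<rfloor> = j"
  shows "cell_point N S j \<in> S" "\<lfloor>of_int N * cell_point N S j\<rfloor> = j"
proof -
  have "\<exists>p. p \<in> S \<and> \<lfloor>of_int N * p\<rfloor> = j" using assms by blast
  from someI_ex[OF this] show "cell_point N S j \<in> S" "\<lfloor>of_int N * cell_point N S j\<rfloor> = j"
    using assms by (simp_all add: cell_point_def)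
qed

lemma cell_point_eq:
  assumes "spaced N S" "p \<in> S"
  shows "cell_point N S \<lfloor>of_int N * p\<rfloor> = p"
  using cell_point_mem[of S N "\<lfloor>of_int N * p\<rfloor>"] assms spaced_floor_inj by blast

lemma cell_point_bounds:
  assumes "N > 0"
  shows "0 \<le> of_int N * cell_point N S j - of_int j" "of_int N * cell_point N S j - of_int j \<le> 1"
proof -
  have "0 \<le> of_int N * cell_point N S j - of_int j \<and> of_int N * cell_point N S j - of_int j \<le> 1"
  proof (cases "\<exists>p\<in>S. \<lfloor>of_int N * p\<rfloor> = j")
    case True
    from cell_point_mem(2)[OF this] show ?thesis by linarith
  next
    case False
    then have "cell_point N S j = of_int j / of_int N" unfolding cell_point_def by (rule if_not_P)
    then show ?thesis using assms by simp
  qed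
  then show "0 \<le> of_int N * cell_point N S j - of_int j" "of_int N * cell_point N S j - of_int j \<le> 1" by auto
qed

text \<open>Each set is recorded cell by cell, with cells of length \<open>1 / N\<close>: whether the cell is occupied, where the
  point sits in it, and which weight it carries. These data range in a compact set, so a subsequence
  converges in every cell. Being occupied is a value 0 or 1, hence eventually constant, and two limit
  points from different cells inherit the gap of the points that approximate them.\<close>

theorem spaced_sets_compactness:
  fixes S :: "nat \<Rightarrow> real set" and d :: "nat \<Rightarrow> real \<Rightarrow> complex"
  assumes S: "\<And>k. spaced N (S k)" and d: "\<And>k p. p \<in> S k \<Longrightarrow> norm (d k p) \<le> 1"
  obtains r S' a where "strict_mono r" "spaced N S'" "converges_weakly (\<lambda>k. S (r k)) S'"
    "\<And>p. norm (a p) \<le> 1" "\<And>p. p \<notin> S' \<Longrightarrow> a p = 0"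
    "\<And>p. (\<forall>k. p \<in> S k) \<Longrightarrow> (\<lambda>k. d (r k) p) \<longlonglongrightarrow> a p"
    "\<And>B G y. amalg B G \<Longrightarrow> continuous_on UNIV G \<Longrightarrow>
       (\<lambda>k. \<Sum>\<^sub>\<infinity>p\<in>S (r k). d (r k) p * G (y - p)) \<longlonglongrightarrow> (\<Sum>\<^sub>\<infinity>p\<in>S'. a p * G (y - p))"
proof -
  have N: "N > 0" using S[of 0] by (simp add: spaced_def)
  define pres where "pres k j \<longleftrightarrow> (\<exists>p\<in>S k. \<lfloor>of_int N * p\<rfloor> = j)" for k j
  define P where "P k j = cell_point N (S k) j" for k j
  define w where "w k j = (if pres k j then d k (P k j) else 0)" for k j
  define q where "q k j = (if pres k j then 1 else 0 :: real, of_int N * P k j - of_int j,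
      w k j)" for k j
  have Pm: "P k j \<in> S k" "\<lfloor>of_int N * P k j\<rfloor> = j" if "pres k j" for k j
    using cell_point_mem[of "S k" N j] that unfolding pres_def P_def by auto
  have Peq: "P k \<lfloor>of_int N * p\<rfloor> = p" "pres k \<lfloor>of_int N * p\<rfloor>" if "p \<in> S k" for k p
    using cell_point_eq[OF S that] that by (auto simp: P_def pres_def)
  let ?K = "{0, 1::real} \<times> {0..1::real} \<times> cball (0::complex) 1"
  have "compact ?K" by (intro compact_Times compact_cball compact_Icc) (simp add: finite_imp_compact)
  moreover have "q k j \<in> ?K" for k j
    using cell_point_bounds[OF N, of "S k" j] d[OF Pm(1)] by (auto simp: q_def w_def P_def[symmetric])
  ultimately obtain r l where r: "strict_mono r" and l: "\<And>j. l j \<in> ?K" "\<And>j. (\<lambda>k. q (r k) j) \<longlonglongrightarrow> l j"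
    using compact_componentwise_subsequence by blast
  define \<beta> where "\<beta> j = fst (l j)" for j
  define \<pi> where "\<pi> j = (fst (snd (l j)) + of_int j) / of_int N" for j
  define \<alpha> where "\<alpha> j = snd (snd (l j))" for j
  have b: "(\<lambda>k. if pres (r k) j then 1 else 0) \<longlonglongrightarrow> \<beta> j" for j
    using tendsto_fst[OF l(2)[of j]] by (simp add: q_def \<beta>_def)
  have \<pi>: "(\<lambda>k. P (r k) j) \<longlonglongrightarrow> \<pi> j" for j
  proof -
    have "(\<lambda>k. (fst (snd (q (r k) j)) + of_int j) / of_int N) \<longlonglongrightarrow> \<pi> j"
      unfolding \<pi>_def using N by (intro tendsto_intros l) auto
    then show ?thesis using N by (simp add: q_def)
  qed
  have \<alpha>: "(\<lambda>k. w (r k) j) \<longlonglongrightarrow> \<alpha> j" for j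
    using tendsto_snd[OF tendsto_snd[OF l(2)[of j]]] by (simp add: q_def \<alpha>_def)
  have \<beta>01: "\<beta> j = 0 \<or> \<beta> j = 1" for j using l(1)[of j] by (auto simp: \<beta>_def)
  have \<alpha>1: "norm (\<alpha> j) \<le> 1" for j using l(1)[of j] by (auto simp: \<alpha>_def)
  have ev: "\<forall>\<^sub>F k in sequentially. pres (r k) j \<longleftrightarrow> \<beta> j = 1" for j
  proof -
    have "\<forall>\<^sub>F k in sequentially. dist (if pres (r k) j then 1 else 0) (\<beta> j) < 1/2"
      using b[of j] by (rule tendstoD) simp
    then show ?thesis
      by (rule eventually_mono) (use \<beta>01[of j] in \<open>auto simp: dist_real_def split: if_splits\<close>)
  qed
  have \<alpha>0: "\<alpha> j = 0" if "\<beta> j \<noteq> 1" for j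
  proof -
    have "\<forall>\<^sub>F k in sequentially. w (r k) j = 0"
      using ev[of j] by (rule eventually_mono) (use that in \<open>auto simp: w_def\<close>)
    then have "(\<lambda>k. w (r k) j) \<longlonglongrightarrow> 0"
      by (rule tendsto_eventually)
    then show ?thesis using \<alpha>[of j] LIMSEQ_unique by blast
  qed
  define S' where "S' = \<pi> ` {j. \<beta> j = 1}"
  have sep: "1 \<le> of_int N * \<bar>\<pi> i - \<pi> j\<bar>" if "i \<noteq> j" "\<beta> i = 1" "\<beta> j = 1" for i j
  proof (rule tendsto_lowerbound)
    show "(\<lambda>k. of_int N * \<bar>P (r k) i - P (r k) j\<bar>) \<longlonglongrightarrow> of_int N * \<bar>\<pi> i - \<pi> j\<bar>"
      by (intro tendsto_intros \<pi>)
    show "\<forall>\<^sub>F k in sequentially. 1 \<le> real_of_int N * \<bar>P (r k) i - P (r k) j\<bar>"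
      using ev[of i] ev[of j]
    proof eventually_elim
      case (elim k)
      then have p: "pres (r k) i" "pres (r k) j" using that by auto
      then have "P (r k) i \<noteq> P (r k) j" using Pm(2) that(1) by metis
      then show ?case using S[of "r k"] Pm(1)[OF p(1)] Pm(1)[OF p(2)] unfolding spaced_def by blast
    qed
  qed simp
  have inj: "inj_on \<pi> {j. \<beta> j = 1}"
  proof (rule inj_onI, rule ccontr)
    fix i j assume "i \<in> {j. \<beta> j = 1}" "j \<in> {j. \<beta> j = 1}" "\<pi> i = \<pi> j" "i \<noteq> j"
    then show False using sep[of i j] by simp
  qed
  have S': "spaced N S'" unfolding spaced_def S'_def
    using N sep by (auto simp: image_iff) metis
  define a where "a p = (if p \<in> S' then \<alpha> (the_inv_into {j. \<beta> j = 1} \<pi> p) else 0)" for p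
  have a\<pi>: "a (\<pi> j) = \<alpha> j" if "\<beta> j = 1" for j
    using that the_inv_into_f_f[OF inj, of j] by (auto simp: a_def S'_def)
  have bnd: "0 \<le> of_int N * \<pi> j - of_int j" "of_int N * \<pi> j - of_int j \<le> 1" for j
    using l(1)[of j] N by (auto simp: \<pi>_def mem_Times_iff)
  show ?thesis
  proof (rule that[of r S' a])
    show "converges_weakly (\<lambda>k. S (r k)) S'" unfolding converges_weakly_def
    proof (intro conjI allI impI)
      show "separated_set (S (r k))" for k by (rule spaced_imp_separated_set(1)[OF S])
      show "separated_set S'" by (rule spaced_imp_separated_set(1)[OF S'])
      have "ereal (1 / of_int N) \<le> (INF k. separation (S (r k)))"
        by (intro INF_greatest spaced_imp_separated_set(2)[OF S])
      moreover have "0 < ereal (1 / of_int N)" using N by simp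
      ultimately show "0 < (INF k. separation (S (r k)))" by (rule less_le_trans[rotated])
      fix \<epsilon> R :: real assume \<epsilon>: "0 < \<epsilon>" and R: "0 < R"
      define J where "J = {- \<lceil>of_int N * R + 1\<rceil> .. \<lceil>of_int N * R + 1\<rceil>}"
      have NR: "\<bar>of_int N * p\<bar> < of_int N * R" if "- R < p" "p < R" for p
        using that N by (simp add: abs_mult abs_less_iff)
      have "\<forall>\<^sub>F k in sequentially. \<forall>j\<in>J. (pres (r k) j \<longleftrightarrow> \<beta> j = 1) \<and> dist (P (r k) j) (\<pi> j) < \<epsilon>"
        by (intro eventually_ball_finite ballI eventually_conj ev tendstoD[OF \<pi> \<epsilon>]) (simp add: J_def)
      then obtain k0 where k0: "\<And>k j. k \<ge> k0 \<Longrightarrow> j \<in> J \<Longrightarrow> (pres (r k) j \<longleftrightarrow> \<beta> j = 1) \<and> dist (P (r k) j) (\<pi> j) < \<epsilon>"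
        unfolding eventually_sequentially by blast
      show "\<exists>k0. \<forall>k\<ge>k0. S (r k) \<inter> {- R<..<R} \<subseteq> fatten \<epsilon> S' \<and> S' \<inter> {- R<..<R} \<subseteq> fatten \<epsilon> (S (r k))"
      proof (intro exI[of _ k0] allI impI conjI subsetI)
        fix k p assume k: "k0 \<le> k" and p: "p \<in> S (r k) \<inter> {- R<..<R}"
        let ?j = "\<lfloor>of_int N * p\<rfloor>"
        have "?j \<in> J" using NR[of p] p unfolding J_def atLeastAtMost_iff by (auto; linarith)
        from k0[OF k this] Peq[of p "r k"] p have "\<pi> ?j \<in> S'" "dist p (\<pi> ?j) < \<epsilon>" by (auto simp: S'_def)
        then show "p \<in> fatten \<epsilon> S'" unfolding fatten_def
          by (intro CollectI exI[of _ "\<pi> ?j"] exI[of _ "p - \<pi> ?j"]) (auto simp: dist_real_def abs_less_iff)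
      next
        fix k p assume k: "k0 \<le> k" and p: "p \<in> S' \<inter> {- R<..<R}"
        then obtain j where j: "\<beta> j = 1" "p = \<pi> j" by (auto simp: S'_def)
        have "j \<in> J" using NR[of p] p bnd[of j] unfolding J_def atLeastAtMost_iff j(2) by (auto; linarith)
        from k0[OF k this] j Pm(1)[of "r k" j] have "P (r k) j \<in> S (r k)" "dist (P (r k) j) p < \<epsilon>" by auto
        then show "p \<in> fatten \<epsilon> (S (r k))" unfolding fatten_def
          by (intro CollectI exI[of _ "P (r k) j"] exI[of _ "p - P (r k) j"]) (auto simp: dist_real_def abs_less_iff)
      qed
    qed
    show "norm (a p) \<le> 1" for p using \<alpha>1 by (simp add: a_def)
    show "a p = 0" if "p \<notin> S'" for p using that by (simp add: a_def)
    show "(\<lambda>k. d (r k) p) \<longlonglongrightarrow> a p" if p: "\<forall>k. p \<in> S k" for p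
    proof -
      let ?j = "\<lfloor>of_int N * p\<rfloor>"
      have pr: "pres k ?j" "P k ?j = p" for k using Peq p by auto
      have "\<beta> ?j = 1" using ev[of ?j] pr(1) by simp
      moreover have "\<pi> ?j = p" using \<pi>[of ?j] pr(2) LIMSEQ_unique[of "\<lambda>k. p"] by simp
      ultimately show ?thesis using \<alpha>[of ?j] a\<pi>[of ?j] pr by (simp add: w_def)
    qed
    fix B G y assume G: "amalg B (G :: real \<Rightarrow> complex)" "continuous_on UNIV G"
    have "(\<lambda>k. \<Sum>\<^sub>\<infinity>j\<in>UNIV. w (r k) j * G (y - P (r k) j)) \<longlonglongrightarrow>
        (\<Sum>\<^sub>\<infinity>j\<in>UNIV. \<alpha> j * G (y - \<pi> j))"
    proof (rule infsum_dominated_convergence)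
      let ?h = "\<lambda>j::int. nbr_sum B \<lfloor>y - of_int j / of_int N\<rfloor>"
      show "?h summable_on UNIV"
      proof (rule bounded_sums_imp_summable(3))
        fix F :: "int set" assume F: "finite F"
        have i: "inj_on (\<lambda>j. y - of_int j / of_int N) F" using N by (auto simp: inj_on_def)
        have sp: "spaced N ((\<lambda>j. y - of_int j / of_int N) ` F)"
          unfolding spaced_def
        proof (intro conjI N ballI impI)
          fix u v assume "u \<in> (\<lambda>j. y - of_int j / of_int N) ` F" "v \<in> (\<lambda>j. y - of_int j / of_int N) ` F" "u \<noteq> v"
          then obtain i j where ij: "u = y - of_int i / of_int N" "v = y - of_int j / of_int N" "i \<noteq> j" by auto
          have "real_of_int N * \<bar>u - v\<bar> = \<bar>real_of_int N * (u - v)\<bar>" using N by (simp add: abs_mult)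
          also have "real_of_int N * (u - v) = of_int (j - i)" using N by (simp add: ij field_simps)
          also have "\<bar>real_of_int (j - i)\<bar> \<ge> 1" using ij(3) by linarith
          finally show "1 \<le> real_of_int N * \<bar>u - v\<bar>" .
        qed
        have "(\<Sum>j\<in>F. norm (?h j)) = (\<Sum>u\<in>(\<lambda>j. y - of_int j / of_int N) ` F. nbr_sum B \<lfloor>u\<rfloor>)"
          using nbr_sum(1)[OF G(1)] by (simp add: sum.reindex[OF i])
        also have "\<dots> \<le> of_int N * (\<Sum>\<^sub>\<infinity>k. nbr_sum B k)"
          by (intro spaced_sum_cells sp nbr_sum[OF G(1)]) (use F in auto)
        finally show "(\<Sum>j\<in>F. norm (?h j)) \<le> of_int N * (\<Sum>\<^sub>\<infinity>k. nbr_sum B k)" .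
      qed
      fix j :: int
      show "norm (w (r k) j * G (y - P (r k) j)) \<le> ?h j" for k
      proof -
        have "\<bar>P (r k) j - of_int j / of_int N\<bar> = \<bar>of_int N * P (r k) j - of_int j\<bar> / of_int N"
        proof -
          have "P (r k) j - of_int j / of_int N = (of_int N * P (r k) j - of_int j) / of_int N"
            using N by (simp add: field_simps)
          then show ?thesis using N by (simp add: abs_divide)
        qed
        also have "\<dots> \<le> 1 / of_int N"
          using cell_point_bounds[OF N, of "S (r k)" j] N by (intro divide_right_mono) (auto simp: P_def)
        also have "\<dots> \<le> 1" using N by simp
        finally have "norm (G (y - P (r k) j)) \<le> ?h j" by (intro nbr_sum(3)[OF G(1)]) auto
        moreover have "norm (w (r k) j) \<le> 1" using d Pm(1) by (auto simp: w_def)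
        ultimately show ?thesis unfolding norm_mult
          by (metis mult_mono mult_1 norm_ge_zero zero_le_one)
      qed
      have "(\<lambda>k. G (y - P (r k) j)) \<longlonglongrightarrow> G (y - \<pi> j)"
        by (intro continuous_on_tendsto_compose[OF G(2)] tendsto_intros \<pi>) auto
      with \<alpha> show "(\<lambda>k. w (r k) j * G (y - P (r k) j)) \<longlonglongrightarrow> \<alpha> j * G (y - \<pi> j)"
        by (rule tendsto_mult)
    qed
    moreover have "(\<Sum>\<^sub>\<infinity>j\<in>UNIV. w k j * G (y - P k j)) = (\<Sum>\<^sub>\<infinity>p\<in>S k. d k p * G (y - p))" for k
    proof -
      have bij: "bij_betw (P k) {j. pres k j} (S k)"
        by (rule bij_betw_byWitness[of _ "\<lambda>p. \<lfloor>of_int N * p\<rfloor>"]) (use Pm Peq in auto)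
      have "(\<Sum>\<^sub>\<infinity>j\<in>UNIV. w k j * G (y - P k j)) =
          (\<Sum>\<^sub>\<infinity>j\<in>{j. pres k j}. d k (P k j) * G (y - P k j))"
        by (rule infsum_cong_neutral) (auto simp: w_def)
      also have "\<dots> = (\<Sum>\<^sub>\<infinity>p\<in>S k. d k p * G (y - p))"
        by (rule infsum_reindex_bij_betw[OF bij])
      finally show ?thesis .
    qed
    moreover have "(\<Sum>\<^sub>\<infinity>j\<in>UNIV. \<alpha> j * G (y - \<pi> j)) = (\<Sum>\<^sub>\<infinity>p\<in>S'. a p * G (y - p))"
    proof -
      have "(\<Sum>\<^sub>\<infinity>j\<in>UNIV. \<alpha> j * G (y - \<pi> j)) = (\<Sum>\<^sub>\<infinity>j\<in>{j. \<beta> j = 1}. a (\<pi> j) * G (y - \<pi> j))"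
        by (rule infsum_cong_neutral) (auto simp: \<alpha>0 a\<pi>)
      also have "\<dots> = (\<Sum>\<^sub>\<infinity>p\<in>S'. a p * G (y - p))"
        unfolding S'_def by (subst infsum_reindex[OF inj]) (simp add: o_def)
      finally show ?thesis .
    qed
    ultimately show "(\<lambda>k. \<Sum>\<^sub>\<infinity>p\<in>S (r k). d (r k) p * G (y - p)) \<longlonglongrightarrow> (\<Sum>\<^sub>\<infinity>p\<in>S'. a p * G (y - p))" by simp
  qed (use r S' in auto)
qed

section \<open>Crystalline measures give vanishing shift series\<close>

text \<open>The family \<open>\<eta> R\<close>, for \<open>R \<ge> 1\<close>, cuts off a neighbourhood of the origin of size \<open>R\<close> with derivatives
  bounded independently of \<open>R\<close>. The notion is invariant under differentiation, which makes the induction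
  in \<open>tail_decay\<close> work.\<close>

definition tail_family :: "(real \<Rightarrow> real \<Rightarrow> complex) \<Rightarrow> bool" where
  "tail_family \<eta> \<longleftrightarrow> (\<forall>R\<ge>1. smooth (\<eta> R)) \<and>
     (\<forall>n. \<exists>C. \<forall>R\<ge>1. \<forall>x. norm (nth_deriv n (\<eta> R) x) \<le> C) \<and>
     (\<forall>R\<ge>1. \<forall>x. \<bar>x\<bar> < R \<longrightarrow> \<eta> R x = 0)"

lemma tail_family_deriv:
  assumes "tail_family \<eta>"
  shows "tail_family (\<lambda>R. nth_deriv 1 (\<eta> R))"
  unfolding tail_family_def
proof (intro conjI allI impI)
  fix R :: real assume R: "1 \<le> R"
  have s: "smooth (\<eta> R)" using assms R unfolding tail_family_def by blast
  then show "smooth (nth_deriv 1 (\<eta> R))" by (rule smooth_deriv)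
  fix x :: real assume x: "\<bar>x\<bar> < R"
  have "nth_deriv 1 (\<eta> R) x = nth_deriv 1 (\<lambda>_. 0) x"
  proof (rule nth_deriv_cong_open)
    show "open {- R<..<R}" by simp
    show "x \<in> {- R<..<R}" using x by auto
    show "\<eta> R y = 0" if "y \<in> {- R<..<R}" for y
      using assms R that unfolding tail_family_def by (auto simp: abs_less_iff)
  qed
  then show "nth_deriv 1 (\<eta> R) x = 0" by simp
next
  fix n
  obtain C where "\<And>R x. R \<ge> 1 \<Longrightarrow> norm (nth_deriv (Suc n) (\<eta> R) x) \<le> C"
    using assms unfolding tail_family_def by metis
  then show "\<exists>C. \<forall>R\<ge>1. \<forall>x. norm (nth_deriv n (nth_deriv 1 (\<eta> R)) x) \<le> C"
    unfolding nth_deriv_Suc' by blast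
qed

lemma tail_family_bump: "tail_family (\<lambda>R x. 1 + (-1) * bump_at 0 R x)"
proof -
  define h where "h x = 1 + (-1) * bump x" for x
  have hs: "smooth h" unfolding h_def
    by (intro smooth_add(1) smooth_const smooth_cmult test_smooth bump)
  have h': "nth_deriv 1 h \<in> test_functions"
  proof -
    have "nth_deriv 1 h x = 0" if x: "2 < \<bar>x\<bar>" for x
    proof -
      have "open {x::real. 2 < \<bar>x\<bar>}" by (intro open_Collect_less continuous_intros)
      then have "nth_deriv 1 h x = nth_deriv 1 (\<lambda>_. 1) x"
        by (rule nth_deriv_cong_open) (use x in \<open>auto simp: h_def bump(3)\<close>)
      also have "nth_deriv 1 (\<lambda>_::real. 1::complex) = (\<lambda>x. (if (1::nat) = 0 then 1 else 0))"
        by (rule smooth_seqI(2)[of "\<lambda>n x. if n = 0 then 1 else 0"]) auto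
      finally show ?thesis by simp
    qed
    then show ?thesis unfolding test_functions_iff using smooth_deriv[OF hs] by blast
  qed
  have hb: "\<exists>C. \<forall>x. norm (nth_deriv n h x) \<le> C" for n
  proof (cases n)
    case 0
    obtain C where C: "\<And>x. norm (bump x) \<le> C" using test_bounded[OF bump(1)] by blast
    have "norm (h x) \<le> 1 + C" for x
      using norm_triangle_ineq[of 1 "(-1) * bump x"] C[of x] by (simp add: h_def)
    then show ?thesis using 0 by auto
  next
    case (Suc m)
    then show ?thesis using test_bounded[OF test_nth_deriv[OF h', of m]] by (metis nth_deriv_Suc')
  qed
  have eq: "(\<lambda>x. 1 + (-1) * bump_at 0 R x) = (\<lambda>x. h ((1 / R) * x + 0))" for R
    by (simp add: h_def bump_at_def)
  show ?thesis unfolding eq tail_family_def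
  proof (intro conjI allI impI)
    fix R :: real
    show "smooth (\<lambda>x. h ((1 / R) * x + 0))" by (rule smooth_affine(1)[OF hs])
    assume R: "1 \<le> R"
    fix x :: real assume "\<bar>x\<bar> < R"
    then have "bump (x / R) = 1" using R by (intro bump(2)) (simp add: abs_divide)
    then show "h ((1 / R) * x + 0) = 0" by (simp add: h_def)
  next
    fix n
    obtain C where C: "\<And>x. norm (nth_deriv n h x) \<le> C" using hb by blast
    have "norm (nth_deriv n (\<lambda>x. h ((1 / R) * x + 0)) x) \<le> C" if R: "1 \<le> R" for R x
    proof -
      have "norm (nth_deriv n (\<lambda>x. h ((1 / R) * x + 0)) x) = (1 / R) ^ n * norm (nth_deriv n h ((1 / R) * x + 0))"
        unfolding smooth_affine(2)[OF hs] using R by (simp add: norm_mult norm_power norm_divide)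
      also have "\<dots> \<le> 1 * C" using R C by (intro mult_mono power_le_one) auto
      finally show ?thesis by simp
    qed
    then show "\<exists>C. \<forall>R\<ge>1. \<forall>x. norm (nth_deriv n (\<lambda>x. h ((1 / R) * x + 0)) x) \<le> C" by blast
  qed
qed

text \<open>Only points with \<open>\<bar>x\<bar> \<ge> R\<close> matter, and there one power of \<open>\<bar>x\<bar>\<close> can be traded for a factor \<open>1 / R\<close>. The
  product rule reduces higher derivatives to this case.\<close>

lemma tail_decay:
  assumes "f \<in> test_functions" "tail_family \<eta>"
  shows "\<exists>C. \<forall>R\<ge>1. \<forall>x. \<bar>x\<bar> ^ m * norm (nth_deriv n (\<lambda>x. fourier f x * \<eta> R x) x) \<le> C / R"
  using assms
proof (induction n arbitrary: f \<eta>)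
  case 0
  obtain C1 where C1: "\<And>x. \<bar>x\<bar> ^ Suc m * norm (fourier f x) \<le> C1" using fourier_test_rapid[OF 0(1)] by blast
  have "\<exists>C. \<forall>R\<ge>1. \<forall>x. norm (nth_deriv 0 (\<eta> R) x) \<le> C" using 0(2) unfolding tail_family_def by blast
  then obtain C2 where C2: "\<And>R x. R \<ge> 1 \<Longrightarrow> norm (\<eta> R x) \<le> C2" by auto
  have "0 \<le> C2" using C2[of 1 0] norm_ge_zero order_trans by blast
  have "0 \<le> C1" using C1[of 0] by simp
  have "\<bar>x\<bar> ^ m * norm (fourier f x * \<eta> R x) \<le> (C1 * C2) / R" if R: "R \<ge> 1" for R x
  proof (cases "\<bar>x\<bar> < R")
    case True
    then have "\<eta> R x = 0" using 0(2) R unfolding tail_family_def by blast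
    then show ?thesis using \<open>0 \<le> C1\<close> \<open>0 \<le> C2\<close> R by simp
  next
    case False
    have "R * (\<bar>x\<bar> ^ m * norm (fourier f x)) \<le> \<bar>x\<bar> * (\<bar>x\<bar> ^ m * norm (fourier f x))"
      using False by (intro mult_right_mono) auto
    also have "\<dots> \<le> C1" using C1[of x] by (simp add: mult.assoc)
    finally have "(R * (\<bar>x\<bar> ^ m * norm (fourier f x))) * norm (\<eta> R x) \<le> C1 * C2"
      using C2[OF R, of x] \<open>0 \<le> C1\<close> by (intro mult_mono) auto
    then show ?thesis using R by (simp add: pos_le_divide_eq norm_mult mult_ac)
  qed
  then show ?case by auto
next
  case (Suc n)
  obtain f' where f': "f' \<in> test_functions" "nth_deriv 1 (fourier f) = fourier f'"
    using fourier_test_smooth(2)[OF Suc.prems(1), of 1] by blast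
  obtain C1 where C1: "\<And>R x. R \<ge> 1 \<Longrightarrow> \<bar>x\<bar> ^ m * norm (nth_deriv n (\<lambda>x. fourier f' x * \<eta> R x) x) \<le> C1 / R"
    using Suc.IH[OF f'(1) Suc.prems(2)] by blast
  obtain C2 where C2: "\<And>R x. R \<ge> 1 \<Longrightarrow> \<bar>x\<bar> ^ m * norm (nth_deriv n (\<lambda>x. fourier f x * nth_deriv 1 (\<eta> R) x) x) \<le> C2 / R"
    using Suc.IH[OF Suc.prems(1) tail_family_deriv[OF Suc.prems(2)]] by blast
  have "\<bar>x\<bar> ^ m * norm (nth_deriv (Suc n) (\<lambda>x. fourier f x * \<eta> R x) x) \<le> (C1 + C2) / R" if R: "R \<ge> 1" for R x
  proof -
    have e: "smooth (\<eta> R)" using Suc.prems(2) R unfolding tail_family_def by blast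
    have s: "smooth (\<lambda>x. fourier f' x * \<eta> R x)" "smooth (\<lambda>x. fourier f x * nth_deriv 1 (\<eta> R) x)"
      by (intro smooth_mult fourier_test_smooth smooth_deriv e f' Suc.prems)+
    have "nth_deriv (Suc n) (\<lambda>x. fourier f x * \<eta> R x) x =
        nth_deriv n (\<lambda>x. fourier f' x * \<eta> R x) x + nth_deriv n (\<lambda>x. fourier f x * nth_deriv 1 (\<eta> R) x) x"
      unfolding nth_deriv_Suc' nth_deriv_mult[OF fourier_test_smooth(1)[OF Suc.prems(1)] e] f'(2)
        smooth_add(2)[OF s] ..
    then have "\<bar>x\<bar> ^ m * norm (nth_deriv (Suc n) (\<lambda>x. fourier f x * \<eta> R x) x) \<le>
        \<bar>x\<bar> ^ m * (norm (nth_deriv n (\<lambda>x. fourier f' x * \<eta> R x) x) + norm (nth_deriv n (\<lambda>x. fourier f x * nth_deriv 1 (\<eta> R) x) x))"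
      by (intro mult_left_mono) (auto intro: norm_triangle_ineq)
    then show ?thesis using C1[OF R, of x] C2[OF R, of x] by (simp add: distrib_left add_divide_distrib)
  qed
  then show ?case by blast
qed

text \<open>A tempered distribution that is an atomic measure is known only on test functions, whereas the
  definition of its Fourier transform evaluates it at \<open>fourier f\<close>. Truncations of \<open>fourier f\<close> bridge this
  gap, because they converge to it in every Schwartz seminorm.\<close>

lemma tempered_fourier_limit:
  assumes T: "tempered_distribution T" and f: "f \<in> test_functions"
  shows "(\<lambda>n. T (\<lambda>x. fourier f x * bump_at 0 (1 + real n) x)) \<longlonglongrightarrow> T (fourier f)"
proof -
  define R where "R n = 1 + real n" for n
  have R: "R n \<ge> 1" "R n > 0" for n by (auto simp: R_def)
  let ?b = "\<lambda>n x. fourier f x * bump_at 0 (R n) x"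
  let ?t = "\<lambda>n x. fourier f x * (1 + (-1) * bump_at 0 (R n) x)"
  obtain C N where C: "\<And>g. g \<in> schwartz_space \<Longrightarrow> norm (T g) \<le> C * (\<Sum>m\<le>N. \<Sum>n\<le>N. schwartz_seminorm m n g)"
    using T unfolding tempered_distribution_def by blast
  have "\<exists>D. \<forall>R\<ge>1. \<forall>x. \<bar>x\<bar> ^ m * norm (nth_deriv k (\<lambda>x. fourier f x * (1 + (-1) * bump_at 0 R x)) x) \<le> D / R" for m k
    by (rule tail_decay[OF f tail_family_bump])
  then obtain D where D: "\<And>m k R x. R \<ge> 1 \<Longrightarrow>
      \<bar>x\<bar> ^ m * norm (nth_deriv k (\<lambda>x. fourier f x * (1 + (-1) * bump_at 0 R x)) x) \<le> D m k / R"
    by metis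
  have tS: "?t n \<in> schwartz_space" for n
  proof -
    have "smooth (?t n)"
      by (intro smooth_mult fourier_test_smooth f smooth_add(1) smooth_cmult smooth_const test_smooth bump_at R)
    moreover have "bdd_above (range (\<lambda>x. \<bar>x\<bar> ^ m * norm (nth_deriv k (?t n) x)))" for m k
      using D[OF R(1)] by (intro bdd_aboveI2)
    ultimately show ?thesis by (simp add: schwartz_space_def)
  qed
  have bS: "?b n \<in> schwartz_space" for n
    by (intro test_schwartz test_mult_smooth' fourier_test_smooth f bump_at R)
  have add: "T (\<lambda>x. g x + h x) = T g + T h" if "g \<in> schwartz_space" "h \<in> schwartz_space" for g h
    using T that unfolding tempered_distribution_def by blast
  have eq: "(\<lambda>x. ?b n x + ?t n x) = fourier f" for n by (simp add: fun_eq_iff algebra_simps)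
  have split: "T (fourier f) = T (?b n) + T (?t n)" for n
    using add[OF bS[of n] tS[of n]] unfolding eq .
  have sem: "0 \<le> schwartz_seminorm m k (?t n) \<and> schwartz_seminorm m k (?t n) \<le> D m k / R n" for m k n
  proof
    show "schwartz_seminorm m k (?t n) \<le> D m k / R n" unfolding schwartz_seminorm_def
      using D[OF R(1)] by (intro cSUP_least) auto
    show "0 \<le> schwartz_seminorm m k (?t n)" unfolding schwartz_seminorm_def
      by (rule cSUP_upper2[of _ _ 0]) (use D[OF R(1)] in \<open>auto intro!: bdd_aboveI2\<close>)
  qed
  have Rl: "(\<lambda>n. D m k / R n) \<longlonglongrightarrow> 0" for m k
  proof -
    have "(\<lambda>n. D m k * inverse (real (Suc n))) \<longlonglongrightarrow> D m k * 0" by (intro tendsto_intros LIMSEQ_inverse_real_of_nat)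
    then show ?thesis by (simp add: R_def divide_inverse)
  qed
  have "(\<lambda>n. schwartz_seminorm m k (?t n)) \<longlonglongrightarrow> 0" for m k
    by (rule tendsto_sandwich[OF _ _ tendsto_const Rl[of m k]]) (use sem in auto)
  then have "(\<lambda>n. C * (\<Sum>m\<le>N. \<Sum>k\<le>N. schwartz_seminorm m k (?t n))) \<longlonglongrightarrow> C * (\<Sum>m\<le>N. \<Sum>k\<le>N. 0)"
    by (intro tendsto_intros)
  then have "(\<lambda>n. T (?t n)) \<longlonglongrightarrow> 0"
    by (intro Lim_null_comparison[of "\<lambda>n. T (?t n)"]) (use C[OF tS] in auto)
  from tendsto_diff[OF tendsto_const[of "T (fourier f)"] this]
  have "(\<lambda>n. T (fourier f) - T (?t n)) \<longlonglongrightarrow> T (fourier f)" by simp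
  moreover have "T (fourier f) - T (?t n) = T (?b n)" for n using split[of n] by simp
  ultimately show ?thesis by (simp add: R_def)
qed

context bounded_comb
begin

lemma shift_sum_tendsto:
  assumes G: "amalg B G" "continuous_on UNIV (G :: real \<Rightarrow> complex)" and X: "X \<longlonglongrightarrow> y"
  shows "(\<lambda>n. \<Sum>\<^sub>\<infinity>g\<in>\<Gamma>. c g * G (X n - g)) \<longlonglongrightarrow> (\<Sum>\<^sub>\<infinity>g\<in>\<Gamma>. c g * G (y - g))"
proof -
  obtain n0 where n0: "\<And>n. n \<ge> n0 \<Longrightarrow> norm (X n - y) < 1" using LIMSEQ_D[OF X, of 1] by auto
  have am: "amalg (nbr_sum B) (\<lambda>t::real. nbr_sum B \<lfloor>t\<rfloor>)"
    unfolding amalg_def using nbr_sum(1,2)[OF G(1)] by simp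
  have "(\<lambda>n. \<Sum>\<^sub>\<infinity>g\<in>\<Gamma>. c g * G (X (n + n0) - g)) \<longlonglongrightarrow> (\<Sum>\<^sub>\<infinity>g\<in>\<Gamma>. c g * G (y - g))"
  proof (rule infsum_dominated_convergence)
    show "(\<lambda>g. M * nbr_sum B \<lfloor>y - g\<rfloor>) summable_on \<Gamma>"
      by (intro summable_on_cmult_right bounded_sums_imp_summable(3)[OF amalg_finite_sum(1)[OF am spaced]])
    fix g n assume g: "g \<in> \<Gamma>"
    have "norm (G (X (n + n0) - g)) \<le> nbr_sum B \<lfloor>y - g\<rfloor>"
      using n0[of "n + n0"] by (intro nbr_sum(3)[OF G(1)]) simp
    then show "norm (c g * G (X (n + n0) - g)) \<le> M * nbr_sum B \<lfloor>y - g\<rfloor>"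
      unfolding norm_mult using c_le[OF g] M0 by (intro mult_mono) auto
  next
    fix g
    show "(\<lambda>n. c g * G (X (n + n0) - g)) \<longlonglongrightarrow> c g * G (y - g)"
      by (intro tendsto_intros continuous_on_tendsto_compose[OF G(2)] LIMSEQ_ignore_initial_segment X) auto
  qed
  then show ?thesis by (rule LIMSEQ_offset)
qed

lemma shift_sum_continuous:
  assumes "amalg B G" "continuous_on UNIV (G :: real \<Rightarrow> complex)"
  shows "continuous_on UNIV (\<lambda>y. \<Sum>\<^sub>\<infinity>g\<in>\<Gamma>. c g * G (y - g))"
  unfolding continuous_on_sequentially
  using shift_sum_tendsto[OF assms] by (auto simp: o_def)

lemma wave_eq_spectral_sum:
  assumes cr: "crystalline_measure c v" and c0: "\<And>g. g \<notin> \<Gamma> \<Longrightarrow> c g = 0" and f: "f \<in> test_functions"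
  shows "wave f 0 = (\<Sum>\<^sub>\<infinity>s\<in>atoms v. v s * f s)"
proof -
  obtain T where T: "tempered_distribution T" "is_atomic_measure T c" "is_atomic_measure (fourier_distr T) v"
    using cr unfolding crystalline_measure_def by blast
  have at: "atoms c \<subseteq> \<Gamma>" using c0 by (auto simp: atoms_def)
  let ?b = "\<lambda>n x. fourier f x * bump_at 0 (1 + real n) x"
  have bt: "?b n \<in> test_functions" for n
    by (intro test_mult_smooth' fourier_test_smooth f bump_at) auto
  have "T (?b n) = (\<Sum>\<^sub>\<infinity>g\<in>\<Gamma>. c g * ?b n g)" for n
  proof -
    have "T (?b n) = (\<Sum>\<^sub>\<infinity>g\<in>atoms c. c g * ?b n g)"
      using T(2) bt unfolding is_atomic_measure_def by blast
    also have "\<dots> = (\<Sum>\<^sub>\<infinity>g\<in>\<Gamma>. c g * ?b n g)"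
      by (rule infsum_cong_neutral) (use at in \<open>auto simp: atoms_def\<close>)
    finally show ?thesis .
  qed
  moreover have "(\<lambda>n. \<Sum>\<^sub>\<infinity>g\<in>\<Gamma>. c g * ?b n g) \<longlonglongrightarrow> (\<Sum>\<^sub>\<infinity>g\<in>\<Gamma>. c g * fourier f g)"
  proof -
    obtain C where C: "C \<ge> 0" "\<And>x. norm (bump x) \<le> C" using test_bounded[OF bump(1)] by blast
    obtain B where B: "amalg B (fourier f)" using fourier_test_amalg[OF f] by blast
    show ?thesis
    proof (rule infsum_dominated_convergence)
      show "(\<lambda>g. norm (c g * fourier f (g - 0)) * C) summable_on \<Gamma>"
        by (intro summable_on_cmult_left bounded_sums_imp_summable(1)[OF weighted_sums(2)[OF B]])
      show "norm (c g * ?b n g) \<le> norm (c g * fourier f (g - 0)) * C" for n g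
        using C(2)[of "(g - 0) / (1 + real n)"] by (simp add: norm_mult bump_at_def mult_left_mono flip: mult.assoc)
      show "(\<lambda>n. c g * ?b n g) \<longlonglongrightarrow> c g * fourier f g" for g
      proof (rule tendsto_eventually)
        obtain n0 :: nat where n0: "\<bar>g\<bar> \<le> real n0" using real_arch_simple by blast
        have "bump_at 0 (1 + real n) g = 1" if "n \<ge> n0" for n
          by (rule bump_at(2)) (use n0 that in auto)
        then show "\<forall>\<^sub>F n in sequentially. c g * ?b n g = c g * fourier f g"
          unfolding eventually_sequentially by (intro exI[of _ n0]) simp
      qed
    qed
  qed
  ultimately have "(\<lambda>n. T (?b n)) \<longlonglongrightarrow> wave f 0" by (simp add: wave_def)
  then have "T (fourier f) = wave f 0"
    using tempered_fourier_limit[OF T(1) f] LIMSEQ_unique by blast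
  then show ?thesis using T(3) f unfolding is_atomic_measure_def fourier_distr_def by metis
qed

text \<open>By \<open>wave_eq_spectral_sum\<close>, \<open>wave f\<close> is a finite sum of exponentials whose frequencies are zeros of
  \<open>fourier G\<close>, so its convolution with \<open>G\<close> vanishes. Through \<open>wave_shift_series\<close> the shift series is
  orthogonal to all \<open>fourier f (y - x)\<close>. The transforms of ever wider bumps form an approximate identity,
  with total integral \<open>bump 0 = 1\<close> by inversion.\<close>

theorem null_of_crystalline:
  assumes cr: "crystalline_measure c v" and c0: "\<And>g. g \<notin> \<Gamma> \<Longrightarrow> c g = 0"
    and G: "amalg B G" "continuous_on UNIV G" and v: "atoms v \<subseteq> Zer (fourier G)"
  shows "(\<Sum>\<^sub>\<infinity>g\<in>\<Gamma>. c g * G (y - g)) = 0"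
proof -
  have [measurable]: "G \<in> borel_measurable borel" by (rule borel_measurable_continuous_onI[OF G(2)])
  have Gi: "integrable lborel G" by (rule amalg_integrable[OF G(1)]) measurable
  define F where "F y = (\<Sum>\<^sub>\<infinity>g\<in>\<Gamma>. c g * G (y - g))" for y
  have Fc: "continuous_on UNIV F" unfolding F_def by (rule shift_sum_continuous[OF G])
  have [measurable]: "F \<in> borel_measurable borel" by (rule borel_measurable_continuous_onI[OF Fc])
  define S where "S = M * (of_int N * (\<Sum>\<^sub>\<infinity>k. B k))"
  have Fb: "norm (F y) \<le> S" for y unfolding F_def S_def by (rule weighted_summable(3)[OF G(1)])
  have zero: "(\<integral>y. fourier f (y - x) * F y \<partial>lborel) = 0" if f: "f \<in> test_functions" for f x
  proof -
    obtain R where R: "\<And>x. R < \<bar>x\<bar> \<Longrightarrow> f x = 0" using test_bound[OF f] by blast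
    define A where "A = atoms v \<inter> {-R..R}"
    have A: "finite A" using cr unfolding A_def crystalline_measure_def locally_finite_set_def by blast
    have w: "wave f t = (\<Sum>s\<in>A. v s * (ec (t * s) * f s))" for t
    proof -
      have "wave f t = wave (\<lambda>s. ec (t * s) * f s) 0" using wave_modulate[OF f, of t 0] by simp
      also have "\<dots> = (\<Sum>\<^sub>\<infinity>s\<in>atoms v. v s * (ec (t * s) * f s))"
        by (rule wave_eq_spectral_sum[OF cr c0 test_mult_smooth'[OF f smooth_ec]])
      also have "\<dots> = (\<Sum>\<^sub>\<infinity>s\<in>A. v s * (ec (t * s) * f s))"
        by (rule infsum_cong_neutral) (use R in \<open>auto simp: A_def not_le abs_if\<close>)
      finally show ?thesis using A by simp
    qed
    have i: "integrable lborel (\<lambda>t. ec (- (s * t)) * G t)" for s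
      by (intro integrable_ec_mult Gi) measurable
    have "G t * wave f (x - t) = (\<Sum>s\<in>A. (v s * f s * ec (x * s)) * (ec (- (s * t)) * G t))" for t
    proof -
      have "ec ((x - t) * s) = ec (x * s) * ec (- (s * t))" for s
        by (subst ec_add[symmetric]) (simp add: algebra_simps)
      then show ?thesis unfolding w by (simp add: sum_distrib_left mult_ac)
    qed
    then have "(\<integral>t. G t * wave f (x - t) \<partial>lborel) = (\<Sum>s\<in>A. (v s * f s * ec (x * s)) * fourier G s)"
      using i by (simp add: fourier_eq Bochner_Integration.integral_sum)
    also have "\<dots> = 0" using v by (intro sum.neutral) (auto simp: A_def Zer_def)
    finally show ?thesis using wave_shift_series(2)[OF f G, of x] by (simp add: F_def)
  qed
  have scaled: "(\<integral>u. fourier bump u * F (y + u / (1 + real n)) \<partial>lborel) = 0" for n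
  proof -
    let ?R = "1 + real n"
    have R: "?R > 0" by simp
    have "0 = (\<integral>z. fourier (bump_at 0 ?R) (z - y) * F z \<partial>lborel)"
      using zero[OF bump_at(1)[OF R], of 0 y] by simp
    also have "\<dots> = \<bar>1 / ?R\<bar> *\<^sub>R (\<integral>u. fourier (bump_at 0 ?R) (y + (1 / ?R) * u - y) * F (y + (1 / ?R) * u) \<partial>lborel)"
      by (intro lborel_integral_real_affine) auto
    also have "(\<lambda>u. fourier (bump_at 0 ?R) (y + (1 / ?R) * u - y) * F (y + (1 / ?R) * u)) =
        (\<lambda>u. of_real ?R * (fourier bump u * F (y + u / ?R)))"
    proof
      fix u
      have "fourier (bump_at 0 ?R) (u / ?R) = ?R *\<^sub>R fourier bump u"
        unfolding bump_at_def[abs_def] using fourier_rescale[OF test_borel[OF bump(1)] R, of 0 "u / ?R"] R by simp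
      then show "fourier (bump_at 0 ?R) (y + (1 / ?R) * u - y) * F (y + (1 / ?R) * u) =
          of_real ?R * (fourier bump u * F (y + u / ?R))" by (simp add: scaleR_conv_of_real)
    qed
    finally show ?thesis using R by (simp del: of_real_add)
  qed
  have "(\<lambda>n. \<integral>u. fourier bump u * F (y + u / (1 + real n)) \<partial>lborel) \<longlonglongrightarrow> (\<integral>u. fourier bump u * F y \<partial>lborel)"
  proof (rule integral_dominated_convergence[where w="\<lambda>u. norm (fourier bump u) * S"])
    show "integrable lborel (\<lambda>u. norm (fourier bump u) * S)"
      by (intro integrable_mult_left integrable_norm fourier_test_integrable bump)
    show "AE u in lborel. norm (fourier bump u * F (y + u / (1 + real n))) \<le> norm (fourier bump u) * S" for n
      using Fb by (intro AE_I2) (simp add: norm_mult mult_left_mono)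
    show "AE u in lborel. (\<lambda>n. fourier bump u * F (y + u / (1 + real n))) \<longlonglongrightarrow> fourier bump u * F y"
    proof (intro AE_I2 tendsto_mult_left)
      fix u
      have "(\<lambda>n. y + u * inverse (real (Suc n))) \<longlonglongrightarrow> y + u * 0"
        by (intro tendsto_intros LIMSEQ_inverse_real_of_nat)
      then have "(\<lambda>n. y + u / (1 + real n)) \<longlonglongrightarrow> y" by (simp add: divide_inverse)
      then show "(\<lambda>n. F (y + u / (1 + real n))) \<longlonglongrightarrow> F y"
        by (intro continuous_on_tendsto_compose[OF Fc]) auto
    qed
  qed measurable
  then have "(\<integral>u. fourier bump u * F y \<partial>lborel) = 0"
    unfolding scaled using LIMSEQ_unique[OF tendsto_const] by metis
  moreover have "(\<integral>u. fourier bump u * F y \<partial>lborel) = F y"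
    using fourier_inversion[OF bump(1), of 0] by (simp add: bump(2))
  ultimately have "F y = 0" by (metis)
  then show ?thesis by (simp add: F_def)
qed

end

section \<open>Stability and vanishing shift series\<close>

text \<open>A continuous function that exceeds \<open>C\<close> at a point of the closure exceeds it on a nonempty open subset
  of \<open>A\<close>, which is not negligible.\<close>

lemma AE_le_imp_le_closure:
  fixes f :: "real \<Rightarrow> complex"
  assumes A: "open A" and f: "continuous_on UNIV f"
    and ae: "AE x in lebesgue_on A. ennreal (norm (f x)) \<le> ennreal C" and C: "0 \<le> C"
    and x: "x \<in> closure A"
  shows "norm (f x) \<le> C"
proof (rule ccontr)
  assume "\<not> norm (f x) \<le> C"
  define U where "U = {y. C < norm (f y)}"
  have U: "open U" unfolding U_def by (intro open_Collect_less continuous_intros f)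
  have "U \<inter> A \<noteq> {}"
  proof -
    have "x \<in> U" using \<open>\<not> norm (f x) \<le> C\<close> by (simp add: U_def)
    then show ?thesis using x U open_Int_closure_eq_empty[of U A] by blast
  qed
  then have "\<not> negligible (U \<inter> A)" using U A by (intro open_not_negligible open_Int)
  moreover have "negligible (U \<inter> A)"
  proof -
    have "A \<in> sets lebesgue" using A by simp
    then have "AE x in lebesgue. x \<in> A \<longrightarrow> ennreal (norm (f x)) \<le> ennreal C"
      using ae by (subst (asm) AE_restrict_space_iff) auto
    then obtain Z where Z: "Z \<in> null_sets lebesgue"
      "{x \<in> space lebesgue. \<not> (x \<in> A \<longrightarrow> ennreal (norm (f x)) \<le> ennreal C)} \<subseteq> Z"
      unfolding eventually_ae_filter by blast
    have "U \<inter> A \<subseteq> Z"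
    proof
      fix y assume y: "y \<in> U \<inter> A"
      then have "\<not> ennreal (norm (f y)) \<le> ennreal C" using ennreal_le_iff[OF C] by (simp add: U_def)
      then show "y \<in> Z" using y Z(2) by (simp add: subset_iff)
    qed
    moreover have "negligible Z" using Z(1) by (simp only: negligible_iff_null_sets)
    ultimately show ?thesis by (rule negligible_subset[rotated])
  qed
  ultimately show False by blast
qed

lemma Linf_norm_le_iff:
  assumes f: "continuous_on UNIV f" and C: "0 \<le> C"
  shows "Linf_norm UNIV f \<le> ennreal C \<longleftrightarrow> (\<forall>x. norm (f x) \<le> C)"
proof
  assume le: "Linf_norm UNIV f \<le> ennreal C"
  have "AE x in lebesgue_on UNIV. ennreal (norm (f x)) \<le> ennreal C"
    using esssup_AE[of "\<lambda>x. ennreal (norm (f x))" "lebesgue_on UNIV"] le unfolding Linf_norm_def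
    by (auto elim: eventually_mono)
  then show "\<forall>x. norm (f x) \<le> C" using AE_le_imp_le_closure[OF open_UNIV f _ C] by auto
next
  assume "\<forall>x. norm (f x) \<le> C"
  moreover have "f \<in> borel_measurable (lebesgue_on UNIV)"
    by (rule continuous_imp_measurable_on_sets_lebesgue[OF f]) simp
  ultimately show "Linf_norm UNIV f \<le> ennreal C"
    unfolding Linf_norm_def by (intro esssup_I AE_I2) (auto simp: ennreal_leI)
qed

lemma wiener_amalgam_imp_amalg:
  assumes G: "G \<in> wiener_amalgam" "continuous_on UNIV G"
  obtains B where "amalg B G"
proof -
  define L where "L k = Linf_norm {real_of_int k<..<real_of_int k + 1} G" for k
  have tot: "(\<Sum>\<^sub>\<infinity>k\<in>UNIV. L k) < \<infinity>" using G by (simp add: wiener_amalgam_def wiener_norm_def L_def)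
  have fin: "(\<Sum>k\<in>F. L k) \<le> (\<Sum>\<^sub>\<infinity>k\<in>UNIV. L k)" if "finite F" for F
  proof -
    have "(\<Sum>\<^sub>\<infinity>k\<in>UNIV. L k) = (SUP F\<in>{F. finite F \<and> F \<subseteq> UNIV}. sum L F)"
      by (rule nonneg_infsum_complete) simp
    then show ?thesis using that by (simp add: SUP_upper)
  qed
  have Lk: "L k < top" for k using fin[of "{k}"] tot by (auto intro: le_less_trans)
  show ?thesis
  proof (rule that[of "\<lambda>k. enn2real (L k)"], unfold amalg_def, intro conjI allI)
    show "(\<lambda>k. enn2real (L k)) summable_on UNIV"
    proof (rule bounded_sums_imp_summable(3))
      fix F :: "int set" assume F: "finite F"
      have "(\<Sum>k\<in>F. norm (enn2real (L k))) = enn2real (\<Sum>k\<in>F. L k)"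
        using Lk by (simp add: enn2real_sum)
      also have "\<dots> \<le> enn2real (\<Sum>\<^sub>\<infinity>k\<in>UNIV. L k)" using fin[OF F] tot by (intro enn2real_mono) auto
      finally show "(\<Sum>k\<in>F. norm (enn2real (L k))) \<le> enn2real (\<Sum>\<^sub>\<infinity>k\<in>UNIV. L k)" .
    qed
    fix x :: real
    let ?k = "\<lfloor>x\<rfloor>"
    show "norm (G x) \<le> enn2real (L ?k)"
    proof (rule AE_le_imp_le_closure[OF _ G(2)])
      show "AE x in lebesgue_on {real_of_int ?k<..<real_of_int ?k + 1}. ennreal (norm (G x)) \<le> ennreal (enn2real (L ?k))"
        using esssup_AE[of "\<lambda>x. ennreal (norm (G x))" "lebesgue_on {real_of_int ?k<..<real_of_int ?k + 1}"] Lk[of ?k]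
        by (simp add: L_def Linf_norm_def)
      show "x \<in> closure {real_of_int ?k<..<real_of_int ?k + 1}" by (simp add: closure_greaterThanLessThan)
    qed auto
  qed auto
qed

lemma linf_norm_bounded:
  assumes "bounded (c ` \<Gamma>)"
  obtains m where "m \<ge> 0" "linf_norm \<Gamma> c = ennreal m" "\<And>g. g \<in> \<Gamma> \<Longrightarrow> norm (c g) \<le> m"
proof -
  obtain C where C: "\<And>g. g \<in> \<Gamma> \<Longrightarrow> norm (c g) \<le> C" using assms unfolding bounded_iff by blast
  have "linf_norm \<Gamma> c \<le> ennreal C" unfolding linf_norm_def
    by (intro SUP_least ennreal_leI C)
  then have fin: "linf_norm \<Gamma> c < top" by (auto intro: le_less_trans)
  then have eq: "linf_norm \<Gamma> c = ennreal (enn2real (linf_norm \<Gamma> c))" by simp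
  show ?thesis
  proof (rule that[OF _ eq])
    fix g assume "g \<in> \<Gamma>"
    then have "ennreal (norm (c g)) \<le> linf_norm \<Gamma> c" unfolding linf_norm_def by (intro SUP_upper)
    then have "ennreal (norm (c g)) \<le> ennreal (enn2real (linf_norm \<Gamma> c))" using eq by simp
    then show "norm (c g) \<le> enn2real (linf_norm \<Gamma> c)" by (simp add: ennreal_le_iff)
  qed simp
qed

lemma amalg_uniformly_continuous:
  fixes G :: "real \<Rightarrow> complex"
  assumes G: "amalg B G" "continuous_on UNIV G" and e: "e > 0"
  obtains d where "d > 0" "\<And>x y. \<bar>x - y\<bar> < d \<Longrightarrow> norm (G x - G y) < e"
proof -
  have "e / 2 > 0" using e by simp
  from amalg_tendsto_0[OF G(1) this]
  obtain R where R: "R > 0" "\<And>x. \<bar>x\<bar> \<ge> R \<Longrightarrow> norm (G x) < e / 2" by blast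
  have "uniformly_continuous_on {-(R+1)..R+1} G"
    by (intro compact_uniformly_continuous continuous_on_subset[OF G(2)]) auto
  then obtain d where d: "d > 0" "\<And>x y. x \<in> {-(R+1)..R+1} \<Longrightarrow> y \<in> {-(R+1)..R+1} \<Longrightarrow> dist x y < d \<Longrightarrow> dist (G x) (G y) < e"
    unfolding uniformly_continuous_on_def using e by (metis dist_commute)
  show ?thesis
  proof (rule that[of "min d 1"])
    fix x y assume xy: "\<bar>x - y\<bar> < min d 1"
    show "norm (G x - G y) < e"
    proof (cases "\<bar>x\<bar> < R \<or> \<bar>y\<bar> < R")
      case True
      then have "x \<in> {-(R+1)..R+1}" "y \<in> {-(R+1)..R+1}" using xy by auto
      then show ?thesis using d(2)[of x y] xy by (simp add: dist_norm)
    next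
      case False
      then show ?thesis using R(2)[of x] R(2)[of y] norm_triangle_ineq4[of "G x" "G y"] by simp
    qed
  qed (use d in auto)
qed

text \<open>On the cell \<open>k\<close> the factor bounds the change over a distance of at most \<open>\<bar>k\<bar> + 1\<close> of a function with
  values in \<open>[0, 1]\<close> and slope at most \<open>1 / (1 + n)\<close>. It is at most 1 and tends to 0 for each \<open>k\<close>.\<close>

lemma amalg_slow_cutoff:
  assumes G: "amalg B G" and e: "e > 0"
  obtains n :: nat where "(\<Sum>\<^sub>\<infinity>k. min 1 ((\<bar>of_int k\<bar> + 1) / (1 + real n)) * B k) < e"
proof -
  note B = amalgD[OF G]
  have "(\<lambda>n. \<Sum>\<^sub>\<infinity>k\<in>UNIV. min 1 ((\<bar>real_of_int k\<bar> + 1) / (1 + real n)) * B k) \<longlonglongrightarrow> (\<Sum>\<^sub>\<infinity>k::int. 0)"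
  proof (rule infsum_dominated_convergence)
    show "B summable_on UNIV" by (rule B(2))
    fix n k
    show "norm (min 1 ((\<bar>real_of_int k\<bar> + 1) / (1 + real n)) * B k) \<le> B k"
      using B(1)[of k] by (simp add: abs_mult mult_left_le_one_le)
  next
    fix k
    have "(\<lambda>n. (\<bar>real_of_int k\<bar> + 1) * inverse (real (Suc n))) \<longlonglongrightarrow> (\<bar>real_of_int k\<bar> + 1) * 0"
      by (intro tendsto_intros LIMSEQ_inverse_real_of_nat)
    then have "(\<lambda>n. min 1 ((\<bar>real_of_int k\<bar> + 1) / (1 + real n))) \<longlonglongrightarrow> min 1 0"
      by (intro tendsto_intros) (simp add: divide_inverse)
    from tendsto_mult_right[OF this, of "B k"]
    show "(\<lambda>n. min 1 ((\<bar>real_of_int k\<bar> + 1) / (1 + real n)) * B k) \<longlonglongrightarrow> 0" by simp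
  qed
  then have "(\<lambda>n. \<Sum>\<^sub>\<infinity>k\<in>UNIV. min 1 ((\<bar>real_of_int k\<bar> + 1) / (1 + real n)) * B k) \<longlonglongrightarrow> 0" by simp
  from order_tendstoD(2)[OF this e] obtain n where
    "(\<Sum>\<^sub>\<infinity>k\<in>UNIV. min 1 ((\<bar>real_of_int k\<bar> + 1) / (1 + real n)) * B k) < e"
    unfolding eventually_sequentially by auto
  then show ?thesis by (rule that)
qed

context bounded_comb
begin

lemma shift_series_bound:
  assumes "amalg B G"
  shows "norm (shift_series \<Gamma> G c x) \<le> M * (of_int N * (\<Sum>\<^sub>\<infinity>k. B k))"
  unfolding shift_series_def by (rule weighted_summable(3)[OF assms])

lemma shift_series_continuous:
  assumes "amalg B G" "continuous_on UNIV G"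
  shows "continuous_on UNIV (shift_series \<Gamma> G c)"
  unfolding shift_series_def[abs_def] by (rule shift_sum_continuous[OF assms])

text \<open>The weights are multiplied by a tent \<open>t\<close> of slope \<open>1 / (1 + n)\<close> around \<open>g0\<close>. Because the original series
  vanishes at \<open>y\<close>, the constant \<open>t (y - g0)\<close> may be subtracted from the factors \<open>t (g - g0)\<close>. The
  difference is small when \<open>g\<close> is near \<open>y\<close>, and \<open>G (y - g)\<close> is small when it is not.\<close>

lemma truncated_null_series_small:
  assumes G: "amalg B G" "continuous_on UNIV G"
    and null: "\<And>y. (\<Sum>\<^sub>\<infinity>g\<in>\<Gamma>. c g * G (y - g)) = 0" and e: "e > 0"
  obtains F w where "finite F" "F \<subseteq> \<Gamma>" "\<And>g. g \<in> \<Gamma> \<Longrightarrow> norm (w g) \<le> M"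
    "g0 \<in> \<Gamma> \<Longrightarrow> g0 \<in> F" "w g0 = c g0" "\<And>y. norm (\<Sum>g\<in>F. w g * G (y - g)) \<le> e"
proof -
  have N: "N > 0" using spaced by (simp add: spaced_def)
  have "e / (M * of_int N + 1) > 0" using e N M0 by (intro divide_pos_pos) (auto simp: add_nonneg_pos)
  from amalg_slow_cutoff[OF G(1) this] obtain n :: nat
    where n: "(\<Sum>\<^sub>\<infinity>k. min 1 ((\<bar>of_int k\<bar> + 1) / (1 + real n)) * B k) < e / (M * of_int N + 1)" by blast
  define E where "E k = min 1 ((\<bar>of_int k\<bar> + 1) / (1 + real n)) * B k" for k
  have E0: "0 \<le> E k" for k using amalgD(1)[OF G(1), of k] by (simp add: E_def)
  have Es: "E summable_on UNIV"
    by (rule Infinite_Sum.abs_summable_on_comparison_test'[OF amalgD(2)[OF G(1)], of UNIV E, THEN abs_summable_summable])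
       (use amalgD(1)[OF G(1)] E0 in \<open>auto simp: E_def mult_left_le_one_le\<close>)
  define t where "t u = max 0 (1 - \<bar>u\<bar> / (1 + real n))" for u
  have t01: "0 \<le> t u" "t u \<le> 1" for u by (auto simp: t_def)
  have tl: "\<bar>t u - t v\<bar> \<le> \<bar>u - v\<bar> / (1 + real n)" for u v
  proof -
    have "\<bar>max 0 (1 - p) - max 0 (1 - q)\<bar> \<le> \<bar>p - q\<bar>" for p q :: real by (auto simp: max_def)
    then have "\<bar>t u - t v\<bar> \<le> \<bar>\<bar>u\<bar> / (1 + real n) - \<bar>v\<bar> / (1 + real n)\<bar>" unfolding t_def .
    also have "\<dots> = \<bar>\<bar>u\<bar> - \<bar>v\<bar>\<bar> / (1 + real n)" by (simp add: diff_divide_distrib[symmetric] abs_divide)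
    also have "\<dots> \<le> \<bar>u - v\<bar> / (1 + real n)" by (intro divide_right_mono) auto
    finally show ?thesis .
  qed
  define F where "F = \<Gamma> \<inter> {g0 - (1 + real n)..g0 + (1 + real n)}"
  define w where "w g = c g * of_real (t (g - g0))" for g
  have wM: "norm (w g) \<le> M" if "g \<in> \<Gamma>" for g
    using c_le[OF that] t01[of "g - g0"] by (simp add: w_def norm_mult) (metis mult_left_le norm_ge_zero order_trans)
  have w0: "w g = 0" if "g \<in> \<Gamma> - F" for g
  proof -
    have "\<bar>g - g0\<bar> \<ge> 1 + real n" using that by (auto simp: F_def abs_if)
    then have "t (g - g0) = 0" by (simp add: t_def max_def divide_simps)
    then show ?thesis by (simp add: w_def)
  qed
  have F: "finite F" unfolding F_def by (rule spaced_finite_Icc[OF spaced])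
  show ?thesis
  proof (rule that[OF F _ wM])
    show "F \<subseteq> \<Gamma>" by (simp add: F_def)
    show "g0 \<in> F" if "g0 \<in> \<Gamma>" using that by (simp add: F_def)
    show "w g0 = c g0" by (simp add: w_def t_def)
    fix y
    let ?D = "\<lambda>u::real. of_real (t (y - u - g0) - t (y - g0)) * G u"
    have "(\<Sum>g\<in>F. w g * G (y - g)) = (\<Sum>\<^sub>\<infinity>g\<in>\<Gamma>. w g * G (y - g))"
    proof -
      have "(\<Sum>\<^sub>\<infinity>g\<in>\<Gamma>. w g * G (y - g)) = (\<Sum>\<^sub>\<infinity>g\<in>F. w g * G (y - g))"
        by (rule infsum_cong_neutral) (use w0 in \<open>auto simp: F_def\<close>)
      then show ?thesis using F by simp
    qed
    also have "\<dots> = (\<Sum>\<^sub>\<infinity>g\<in>\<Gamma>. w g * G (y - g)) + - of_real (t (y - g0)) * (\<Sum>\<^sub>\<infinity>g\<in>\<Gamma>. c g * G (y - g))"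
      by (simp add: null)
    also have "\<dots> = (\<Sum>\<^sub>\<infinity>g\<in>\<Gamma>. w g * G (y - g) + - of_real (t (y - g0)) * (c g * G (y - g)))"
    proof (subst infsum_cmult_right'[symmetric], rule infsum_add[symmetric])
      show "(\<lambda>g. w g * G (y - g)) summable_on \<Gamma>"
        by (rule finite_nonzero_values_imp_summable_on, rule finite_subset[OF _ F]) (use w0 in auto)
      show "(\<lambda>g. - of_real (t (y - g0)) * (c g * G (y - g))) summable_on \<Gamma>"
        by (intro summable_on_cmult_right weighted_summable(1)[OF G(1)])
    qed
    also have "\<dots> = (\<Sum>\<^sub>\<infinity>g\<in>\<Gamma>. c g * ?D (y - g))"
      by (rule infsum_cong) (simp add: w_def algebra_simps)
    also have "norm \<dots> \<le> M * (of_int N * (\<Sum>\<^sub>\<infinity>k. E k))"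
    proof (rule weighted_summable(3))
      show "amalg E ?D" unfolding amalg_def
      proof (intro conjI allI E0 Es)
        fix u :: real
        have "\<bar>u\<bar> \<le> \<bar>of_int \<lfloor>u\<rfloor>\<bar> + 1" by linarith
        then have "\<bar>t (y - u - g0) - t (y - g0)\<bar> \<le> (\<bar>of_int \<lfloor>u\<rfloor>\<bar> + 1) / (1 + real n)"
          by (intro order_trans[OF tl] divide_right_mono) auto
        moreover have "\<bar>t (y - u - g0) - t (y - g0)\<bar> \<le> 1"
          using t01[of "y - u - g0"] t01[of "y - g0"] by linarith
        ultimately have "\<bar>t (y - u - g0) - t (y - g0)\<bar> * norm (G u) \<le> E \<lfloor>u\<rfloor>"
          unfolding E_def using amalgD(3)[OF G(1), of u] by (intro mult_mono) auto
        then show "norm (?D u) \<le> E \<lfloor>u\<rfloor>" by (simp only: norm_mult norm_of_real)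
      qed
    qed
    also have "\<dots> \<le> e"
    proof -
      have "(M * of_int N) * (\<Sum>\<^sub>\<infinity>k. E k) \<le> (M * of_int N + 1) * (\<Sum>\<^sub>\<infinity>k. E k)"
        using E0 by (intro mult_right_mono infsum_nonneg) auto
      also have "\<dots> \<le> (M * of_int N + 1) * (e / (M * of_int N + 1))"
        using n N M0 unfolding E_def by (intro mult_left_mono) auto
      also have "\<dots> = e"
      proof -
        have "M * of_int N + 1 > 0" using N M0 by (simp add: add_nonneg_pos)
        then show ?thesis by simp
      qed
      finally show ?thesis by (simp add: mult.assoc)
    qed
    finally show "norm (\<Sum>g\<in>F. w g * G (y - g)) \<le> e" .
  qed
qed

end

text \<open>If \<open>c g0 \<noteq> 0\<close>, the truncated null series has finitely many nodes, the weight \<open>c g0\<close> at one of them, and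
  is small everywhere. The nodes are close to nodes of a translate of \<open>\<Gamma>\<close>, and by uniform continuity of
  \<open>G\<close> moving them there changes little. The lower stability bound does not allow the resulting series to
  be this small.\<close>

theorem stable_imp_no_null_series:
  assumes \<Gamma>: "spaced N \<Gamma>" and G: "amalg B G" "continuous_on UNIV G"
    and stable: "linf_stable_shifts \<Gamma> G"
    and lim: "\<Gamma>' \<in> weak_limits \<Gamma>" and comb: "bounded_comb \<Gamma>' N' c M"
    and null: "\<And>y. (\<Sum>\<^sub>\<infinity>g\<in>\<Gamma>'. c g * G (y - g)) = 0"
    and g0: "g0 \<in> \<Gamma>'"
  shows "c g0 = 0"
proof (rule ccontr)
  assume "c g0 \<noteq> 0"
  interpret L: bounded_comb \<Gamma>' N' c M by (rule comb)
  obtain C1 where C1: "C1 > 0" "\<And>c. bounded (c ` \<Gamma>) \<Longrightarrow> ennreal C1 * linf_norm \<Gamma> c \<le> Linf_norm UNIV (shift_series \<Gamma> G c)"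
    using stable unfolding linf_stable_shifts_def by blast
  define q where "q = C1 * norm (c g0)"
  have q: "q > 0" using C1 \<open>c g0 \<noteq> 0\<close> by (simp add: q_def)
  then have "q / 4 > 0" by simp
  from L.truncated_null_series_small[OF G null this, of g0] obtain F w where
    F: "finite F" "F \<subseteq> \<Gamma>'" and w: "\<And>g. g \<in> \<Gamma>' \<Longrightarrow> norm (w g) \<le> M" "w g0 = c g0"
    and g0F: "g0 \<in> F" and small: "\<And>y. norm (\<Sum>g\<in>F. w g * G (y - g)) \<le> q / 4" using g0 by metis
  have N': "N' > 0" using L.spaced by (simp add: spaced_def)
  \<comment> \<open>The summand 1 keeps the denominator positive when \<open>M = 0\<close>.\<close>
  define \<eta> where "\<eta> = q / 4 / (real (card F) * M + 1)"
  have den: "real (card F) * M + 1 > 0" using L.M0 by (simp add: add_nonneg_pos)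
  have \<eta>: "\<eta> > 0" unfolding \<eta>_def using q den by simp
  obtain d where d: "d > 0" "\<And>x y. \<bar>x - y\<bar> < d \<Longrightarrow> norm (G x - G y) < \<eta>"
    using amalg_uniformly_continuous[OF G \<eta>] by blast
  \<comment> \<open>Half the gap of \<open>\<Gamma>'\<close>, so that distinct nodes are moved to distinct nodes.\<close>
  define \<epsilon> where "\<epsilon> = min d (1 / (2 * of_int N'))"
  have \<epsilon>: "\<epsilon> > 0" using d N' by (simp add: \<epsilon>_def)
  obtain R where R: "R > 0" "\<And>g. g \<in> F \<Longrightarrow> \<bar>g\<bar> < R"
  proof -
    have "bounded F" using F by (simp add: finite_imp_bounded)
    then obtain b where "b > 0" "\<forall>g\<in>F. norm g \<le> b" using bounded_pos by blast
    then show ?thesis by (intro that[of "b + 1"]) auto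
  qed
  obtain x where x: "converges_weakly (\<lambda>k. (\<lambda>\<gamma>. \<gamma> - x k) ` \<Gamma>) \<Gamma>'" using lim unfolding weak_limits_def by blast
  then have "\<forall>\<epsilon>>0. \<forall>R>0. \<exists>l. \<forall>k\<ge>l. (\<lambda>\<gamma>. \<gamma> - x k) ` \<Gamma> \<inter> {-R<..<R} \<subseteq> fatten \<epsilon> \<Gamma>' \<and>
      \<Gamma>' \<inter> {-R<..<R} \<subseteq> fatten \<epsilon> ((\<lambda>\<gamma>. \<gamma> - x k) ` \<Gamma>)"
    unfolding converges_weakly_def by (elim conjE)
  from this[rule_format, OF \<epsilon> R(1)] obtain k where k: "\<Gamma>' \<inter> {-R<..<R} \<subseteq> fatten \<epsilon> ((\<lambda>\<gamma>. \<gamma> - x k) ` \<Gamma>)"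
    by auto
  have "\<exists>p. g \<in> F \<longrightarrow> p \<in> \<Gamma> \<and> \<bar>(p - x k) - g\<bar> < \<epsilon>" for g
  proof (cases "g \<in> F")
    case True
    then have "g \<in> \<Gamma>' \<inter> {-R<..<R}" using F R(2)[of g] by (auto simp: abs_less_iff)
    then have "g \<in> fatten \<epsilon> ((\<lambda>\<gamma>. \<gamma> - x k) ` \<Gamma>)" using k by blast
    then obtain p s where "p \<in> \<Gamma>" "g = (p - x k) + s" "s \<in> {-\<epsilon><..<\<epsilon>}" unfolding fatten_def by auto
    then show ?thesis by (intro exI[of _ p]) auto
  qed auto
  then obtain p where p: "\<And>g. g \<in> F \<Longrightarrow> p g \<in> \<Gamma>" "\<And>g. g \<in> F \<Longrightarrow> \<bar>(p g - x k) - g\<bar> < \<epsilon>" by metis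
  have inj: "inj_on p F"
  proof (rule inj_onI, rule ccontr)
    fix g h assume gh: "g \<in> F" "h \<in> F" "p g = p h" "g \<noteq> h"
    have "\<bar>g - h\<bar> < 2 * \<epsilon>" using p(2)[OF gh(1)] p(2)[OF gh(2)] gh(3) by linarith
    also have "\<dots> \<le> 1 / of_int N'" unfolding \<epsilon>_def by (simp add: min_def field_simps)
    finally have "of_int N' * \<bar>g - h\<bar> < 1" using N' by (simp add: pos_less_divide_eq mult.commute)
    moreover have "1 \<le> of_int N' * \<bar>g - h\<bar>" using L.spaced gh F unfolding spaced_def by blast
    ultimately show False by simp
  qed
  define c' where "c' y = (if y \<in> p ` F then w (the_inv_into F p y) else 0)" for y
  have c'p: "c' (p g) = w g" if "g \<in> F" for g using that the_inv_into_f_f[OF inj that] by (simp add: c'_def)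
  have c'M: "norm (c' y) \<le> M" for y
    using L.M0 F w(1) the_inv_into_into[OF inj, of y F] by (auto simp: c'_def)
  interpret P: bounded_comb \<Gamma> N c' M
    by unfold_locales (use \<Gamma> c'M L.M0 in auto)
  have ser: "shift_series \<Gamma> G c' y = (\<Sum>g\<in>F. w g * G (y - p g))" for y
  proof -
    have "shift_series \<Gamma> G c' y = (\<Sum>\<^sub>\<infinity>\<gamma>\<in>p ` F. c' \<gamma> * G (y - \<gamma>))"
      unfolding shift_series_def by (rule infsum_cong_neutral) (use p(1) in \<open>auto simp: c'_def\<close>)
    also have "\<dots> = (\<Sum>\<gamma>\<in>p ` F. c' \<gamma> * G (y - \<gamma>))" using F by simp
    also have "\<dots> = (\<Sum>g\<in>F. w g * G (y - p g))" by (simp add: sum.reindex[OF inj] c'p)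
    finally show ?thesis .
  qed
  have "norm (shift_series \<Gamma> G c' y) \<le> q / 2" for y
  proof -
    have split: "shift_series \<Gamma> G c' y = (\<Sum>g\<in>F. w g * G (y - x k - g)) + (\<Sum>g\<in>F. w g * (G (y - p g) - G (y - x k - g)))"
      unfolding ser by (simp add: sum.distrib[symmetric] algebra_simps)
    have "norm (\<Sum>g\<in>F. w g * (G (y - p g) - G (y - x k - g))) \<le> real (card F) * (M * \<eta>)"
    proof (rule sum_norm_bound)
      fix g assume g: "g \<in> F"
      have "\<bar>(p g - x k) - g\<bar> < d" using p(2)[OF g] by (simp add: \<epsilon>_def)
      then have "\<bar>(y - p g) - (y - x k - g)\<bar> < d" by linarith
      then show "norm (w g * (G (y - p g) - G (y - x k - g))) \<le> M * \<eta>"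
        unfolding norm_mult using w(1)[of g] g F d(2)[of "y - p g" "y - x k - g"] L.M0 by (intro mult_mono) auto
    qed
    moreover have "real (card F) * (M * \<eta>) \<le> q / 4"
    proof -
      have "real (card F) * (M * \<eta>) \<le> (real (card F) * M + 1) * \<eta>" using \<eta> by (simp add: distrib_right)
      also have "\<dots> = q / 4"
      proof -
        have "D * (z / D) = z" if "D > 0" for D z :: real using that by simp
        then show ?thesis unfolding \<eta>_def using den .
      qed
      finally show ?thesis .
    qed
    ultimately show ?thesis
      unfolding split using small[of "y - x k"] norm_triangle_ineq[of "\<Sum>g\<in>F. w g * G (y - x k - g)" "\<Sum>g\<in>F. w g * (G (y - p g) - G (y - x k - g))"]
      by linarith
  qed
  then have up: "Linf_norm UNIV (shift_series \<Gamma> G c') \<le> ennreal (q / 2)"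
    using q by (subst Linf_norm_le_iff[OF P.shift_series_continuous[OF G]]) auto
  have "bounded (c' ` \<Gamma>)" using c'M by (auto simp: bounded_iff)
  then have "ennreal C1 * linf_norm \<Gamma> c' \<le> Linf_norm UNIV (shift_series \<Gamma> G c')" by (rule C1(2))
  moreover have "ennreal q \<le> ennreal C1 * linf_norm \<Gamma> c'"
  proof -
    have "ennreal (norm (c g0)) \<le> linf_norm \<Gamma> c'" unfolding linf_norm_def
      using c'p[OF g0F] w(2) p(1)[OF g0F] by (metis SUP_upper)
    then show ?thesis unfolding q_def using C1 by (simp add: ennreal_mult mult_left_mono)
  qed
  ultimately have "ennreal q \<le> ennreal (q / 2)" using up by (meson order_trans)
  then show False using q by (simp add: ennreal_le_iff)
qed

text \<open>The upper bound always holds, so it is the lower bound that fails, for every constant. This gives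
  weights of norm at most 1 with arbitrarily small series and with a node of weight at least \<open>1 / 2\<close>, which
  is translated to the origin. In the limit the weight there survives while the series becomes 0.\<close>

theorem unstable_imp_null_series:
  assumes \<Gamma>: "spaced N \<Gamma>" and G: "amalg B G" "continuous_on UNIV G"
    and unstable: "\<not> linf_stable_shifts \<Gamma> G"
  obtains \<Gamma>' c where "\<Gamma>' \<in> weak_limits \<Gamma>" "bounded_comb \<Gamma>' N c 1" "\<And>g. g \<notin> \<Gamma>' \<Longrightarrow> c g = 0"
    "c 0 \<noteq> 0" "\<And>y. (\<Sum>\<^sub>\<infinity>g\<in>\<Gamma>'. c g * G (y - g)) = 0"
proof -
  have N: "N > 0" using \<Gamma> by (simp add: spaced_def)
  have comb: "bounded_comb \<Gamma> N c m" if "\<And>g. g \<in> \<Gamma> \<Longrightarrow> norm (c g) \<le> m" "0 \<le> m" for c m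
    by unfold_locales (use \<Gamma> that in auto)
  define K where "K = of_int N * (\<Sum>\<^sub>\<infinity>k. B k) + 1"
  have K: "K > 0" unfolding K_def using N amalg_nonneg[OF G(1)] by (simp add: add_nonneg_pos)
  have upper: "Linf_norm UNIV (shift_series \<Gamma> G c) \<le> ennreal K * linf_norm \<Gamma> c" if c: "bounded (c ` \<Gamma>)" for c
  proof -
    obtain m where m: "m \<ge> 0" "linf_norm \<Gamma> c = ennreal m" "\<And>g. g \<in> \<Gamma> \<Longrightarrow> norm (c g) \<le> m"
      using linf_norm_bounded[OF c] by blast
    interpret P: bounded_comb \<Gamma> N c m by (rule comb[OF m(3,1)])
    have "norm (shift_series \<Gamma> G c x) \<le> K * m" for x
      using P.shift_series_bound[OF G(1), of x] m(1) by (simp add: K_def algebra_simps)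
    then have "Linf_norm UNIV (shift_series \<Gamma> G c) \<le> ennreal (K * m)"
      using K m by (subst Linf_norm_le_iff[OF P.shift_series_continuous[OF G]]) auto
    then show ?thesis using K m by (simp add: ennreal_mult)
  qed
  have "\<exists>c x. (\<forall>g\<in>\<Gamma>. norm (c g) \<le> 1) \<and> x \<in> \<Gamma> \<and> 1 / 2 \<le> norm (c x) \<and> (\<forall>y. norm (shift_series \<Gamma> G c y) \<le> 1 / (1 + real n))" for n
  proof -
    let ?e = "1 / (1 + real n)"
    have e: "?e > 0" by simp
    obtain c where c: "bounded (c ` \<Gamma>)" "\<not> ennreal ?e * linf_norm \<Gamma> c \<le> Linf_norm UNIV (shift_series \<Gamma> G c)"
      using unstable upper K e unfolding linf_stable_shifts_def by blast
    obtain m where m: "m \<ge> 0" "linf_norm \<Gamma> c = ennreal m" "\<And>g. g \<in> \<Gamma> \<Longrightarrow> norm (c g) \<le> m"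
      using linf_norm_bounded[OF c(1)] by blast
    interpret P: bounded_comb \<Gamma> N c m by (rule comb[OF m(3,1)])
    have lt: "Linf_norm UNIV (shift_series \<Gamma> G c) < ennreal (?e * m)"
    proof -
      have "ennreal (?e * m) = ennreal ?e * ennreal m" by (rule ennreal_mult) (use m e in auto)
      then show ?thesis using c(2) unfolding m(2) not_le by simp
    qed
    have "m \<noteq> 0" using lt by (intro notI) simp
    then have m0: "m > 0" using m by simp
    have bd: "norm (shift_series \<Gamma> G c y) \<le> ?e * m" for y
    proof -
      have "0 \<le> ?e * m" using e m(1) by (intro mult_nonneg_nonneg) auto
      then show ?thesis using Linf_norm_le_iff[OF P.shift_series_continuous[OF G], of "?e * m"] lt by auto
    qed
    have "ennreal (m / 2) < linf_norm \<Gamma> c" unfolding m(2) using m0 by (intro ennreal_lessI) auto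
    then obtain x where x: "x \<in> \<Gamma>" "ennreal (m / 2) < ennreal (norm (c x))"
      unfolding linf_norm_def less_SUP_iff by blast
    then have x2: "m / 2 < norm (c x)" using m0 by (simp add: ennreal_less_iff)
    let ?c = "\<lambda>g. of_real (1 / m) * c g"
    have ser: "shift_series \<Gamma> G ?c y = of_real (1 / m) * shift_series \<Gamma> G c y" for y
      unfolding shift_series_def mult.assoc by (rule infsum_cmult_right')
    have "norm (?c g) \<le> 1" if "g \<in> \<Gamma>" for g
      using m(3)[OF that] m0 by (simp add: norm_mult norm_divide)
    moreover have "1 / 2 \<le> norm (?c x)" using x2 m0 by (simp add: norm_mult norm_divide field_simps)
    moreover have "norm (shift_series \<Gamma> G ?c y) \<le> ?e" for y
    proof -
      have "norm (shift_series \<Gamma> G ?c y) = (1 / m) * norm (shift_series \<Gamma> G c y)"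
        unfolding ser norm_mult using m0 by (simp add: norm_divide)
      also have "\<dots> \<le> (1 / m) * (?e * m)" using bd[of y] m0 by (intro mult_left_mono) auto
      finally show ?thesis using m0 by simp
    qed
    ultimately show ?thesis using x(1) by (intro exI[of _ ?c] exI[of _ x] conjI ballI allI)
  qed
  then obtain c x where cx: "\<And>n g. g \<in> \<Gamma> \<Longrightarrow> norm (c n g) \<le> 1" "\<And>n. x n \<in> \<Gamma>" "\<And>n. 1 / 2 \<le> norm (c n (x n))"
    "\<And>n y. norm (shift_series \<Gamma> G (c n) y) \<le> 1 / (1 + real n)"
    by metis
  define S where "S n = (\<lambda>\<gamma>. \<gamma> - x n) ` \<Gamma>" for n
  define d where "d n p = c n (p + x n)" for n p
  have Ss: "spaced N (S n)" for n unfolding S_def spaced_image_diff' by (rule \<Gamma>)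
  have d1: "norm (d n p) \<le> 1" if "p \<in> S n" for n p using that cx(1) by (auto simp: S_def d_def)
  have S0: "0 \<in> S n" for n using cx(2) by (auto simp: S_def image_iff)
  obtain r S' a where r: "strict_mono r" and S': "spaced N S'" "converges_weakly (\<lambda>k. S (r k)) S'"
    and a: "\<And>p. norm (a p) \<le> 1" "\<And>p. p \<notin> S' \<Longrightarrow> a p = 0"
      "\<And>p. (\<forall>k. p \<in> S k) \<Longrightarrow> (\<lambda>k. d (r k) p) \<longlonglongrightarrow> a p"
    and lim: "\<And>B G y. amalg B G \<Longrightarrow> continuous_on UNIV G \<Longrightarrow>
       (\<lambda>k. \<Sum>\<^sub>\<infinity>p\<in>S (r k). d (r k) p * G (y - p)) \<longlonglongrightarrow> (\<Sum>\<^sub>\<infinity>p\<in>S'. a p * G (y - p))"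
    by (rule spaced_sets_compactness[of N S d, OF Ss d1], assumption, rule that)
  show ?thesis
  proof (rule that[of S' a])
    show "S' \<in> weak_limits \<Gamma>" unfolding weak_limits_def
      using S'(2) unfolding S_def by (intro CollectI exI[of _ "\<lambda>k. x (r k)"])
    show "bounded_comb S' N a 1" by unfold_locales (use S' a in auto)
    show "a g = 0" if "g \<notin> S'" for g using that by (rule a(2))
    show "a 0 \<noteq> 0"
    proof -
      have "(\<lambda>k. norm (d (r k) 0)) \<longlonglongrightarrow> norm (a 0)" by (intro tendsto_norm a(3) allI S0)
      then have "1 / 2 \<le> norm (a 0)"
        by (rule LIMSEQ_le_const) (use cx(3) in \<open>auto simp: d_def\<close>)
      then show ?thesis by auto
    qed
    fix y
    have eq: "(\<Sum>\<^sub>\<infinity>p\<in>S n. d n p * G (y - p)) = shift_series \<Gamma> G (c n) (y + x n)" for n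
    proof -
      have "(\<Sum>\<^sub>\<infinity>p\<in>S n. d n p * G (y - p)) = (\<Sum>\<^sub>\<infinity>\<gamma>\<in>\<Gamma>. d n (\<gamma> - x n) * G (y - (\<gamma> - x n)))"
        unfolding S_def by (subst infsum_reindex) (auto simp: inj_on_def o_def)
      then show ?thesis by (simp add: shift_series_def d_def algebra_simps)
    qed
    have "(\<lambda>k. \<Sum>\<^sub>\<infinity>p\<in>S (r k). d (r k) p * G (y - p)) \<longlonglongrightarrow> 0"
    proof (rule Lim_null_comparison)
      show "\<forall>\<^sub>F k in sequentially. norm (\<Sum>\<^sub>\<infinity>p\<in>S (r k). d (r k) p * G (y - p)) \<le> 1 / (1 + real (r k))"
        unfolding eq using cx(4) by auto
      from LIMSEQ_subseq_LIMSEQ[OF reciprocal_tendsto_0 r] show "(\<lambda>k. 1 / (1 + real (r k))) \<longlonglongrightarrow> 0" by (simp add: o_def)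
    qed
    then show "(\<Sum>\<^sub>\<infinity>g\<in>S'. a g * G (y - g)) = 0" using lim[OF G, of y] LIMSEQ_unique by blast
  qed
qed

lemma finite_zeros_Icc:
  assumes "\<And>x :: real. finite (Z \<inter> {x<..<x + 1})"
  shows "finite (Z \<inter> {a..b})"
proof -
  have fb: "finite (Z \<inter> ball x (1 / 2))" for x :: real
  proof -
    have "ball x (1 / 2) = {x - 1 / 2<..<(x - 1 / 2) + 1}"
      by (rule set_eqI, unfold mem_ball dist_real_def greaterThanLessThan_iff) linarith
    then show ?thesis using assms by metis
  qed
  obtain I where I: "finite I" "{a..b} \<subseteq> (\<Union>x\<in>I. ball x (1 / 2))"
    by (rule compactE_image[of "{a..b}" "{a..b}" "\<lambda>x. ball x (1 / 2)"]) auto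
  have "finite (\<Union>x\<in>I. Z \<inter> ball x (1 / 2))" using I(1) fb by (rule finite_UN_I)
  then show ?thesis by (rule rev_finite_subset) (use I in auto)
qed

theorem theorem3p3:
  fixes \<Gamma> :: "real set" and G :: "real \<Rightarrow> complex"
  assumes "separated_set \<Gamma>"
    and "G \<in> wiener_amalgam"
    and "continuous_on UNIV G"
    and "\<And>x :: real. finite (Zer (fourier G) \<inter> {x<..<x + 1})"
  shows "linf_stable_shifts \<Gamma> G \<longleftrightarrow>
    \<not> (\<exists>\<Gamma>'\<in>weak_limits \<Gamma>. \<exists>\<mu> \<nu>. crystalline_measure \<mu> \<nu> \<and> atoms \<mu> \<noteq> {} \<and>
         sparse_measure \<mu> \<and> bounded_coefficients \<mu> \<and> supports_measure \<Gamma>' \<mu> \<and>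
         atoms \<nu> \<subseteq> Zer (fourier G))"
proof -
  obtain N where N: "spaced N \<Gamma>" using separated_set_imp_spaced[OF assms(1)] .
  obtain B where G: "amalg B G" using wiener_amalgam_imp_amalg[OF assms(2,3)] .
  have fin: "finite (Zer (fourier G) \<inter> {a..b})" for a b by (rule finite_zeros_Icc[OF assms(4)])
  show ?thesis
  proof
    assume stable: "linf_stable_shifts \<Gamma> G"
    show "\<not> (\<exists>\<Gamma>'\<in>weak_limits \<Gamma>. \<exists>\<mu> \<nu>. crystalline_measure \<mu> \<nu> \<and> atoms \<mu> \<noteq> {} \<and>
         sparse_measure \<mu> \<and> bounded_coefficients \<mu> \<and> supports_measure \<Gamma>' \<mu> \<and>
         atoms \<nu> \<subseteq> Zer (fourier G))"
    proof clarify
      fix \<Gamma>' \<mu> \<nu>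
      assume lim: "\<Gamma>' \<in> weak_limits \<Gamma>" and cr: "crystalline_measure \<mu> \<nu>" and ne: "atoms \<mu> \<noteq> {}"
        and bc: "bounded_coefficients \<mu>" and sup: "supports_measure \<Gamma>' \<mu>" and v: "atoms \<nu> \<subseteq> Zer (fourier G)"
      have "separated_set \<Gamma>'" using lim unfolding weak_limits_def converges_weakly_def by blast
      then obtain N' where N': "spaced N' \<Gamma>'" using separated_set_imp_spaced by blast
      obtain M where M: "M > 0" "\<And>g. g \<in> atoms \<mu> \<Longrightarrow> norm (\<mu> g) \<le> M"
        using bc unfolding bounded_coefficients_def bounded_pos by auto
      have "norm (\<mu> g) \<le> M" for g using M by (cases "g \<in> atoms \<mu>") (auto simp: atoms_def)
      then interpret bounded_comb \<Gamma>' N' \<mu> M using N' M by unfold_locales auto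
      have off: "\<mu> g = 0" if "g \<notin> \<Gamma>'" for g using that sup by (auto simp: supports_measure_def atoms_def)
      have null: "(\<Sum>\<^sub>\<infinity>g\<in>\<Gamma>'. \<mu> g * G (y - g)) = 0" for y
        by (rule null_of_crystalline[OF cr off G assms(3) v])
      have "\<mu> g = 0" for g
        using stable_imp_no_null_series[OF N G assms(3) stable lim bounded_comb_axioms null, of g] off by blast
      then show False using ne by (simp add: atoms_def)
    qed
  next
    assume no: "\<not> (\<exists>\<Gamma>'\<in>weak_limits \<Gamma>. \<exists>\<mu> \<nu>. crystalline_measure \<mu> \<nu> \<and> atoms \<mu> \<noteq> {} \<and>
         sparse_measure \<mu> \<and> bounded_coefficients \<mu> \<and> supports_measure \<Gamma>' \<mu> \<and>
         atoms \<nu> \<subseteq> Zer (fourier G))"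
    show "linf_stable_shifts \<Gamma> G"
    proof (rule ccontr)
      assume "\<not> linf_stable_shifts \<Gamma> G"
      from unstable_imp_null_series[OF N G assms(3) this]
      obtain \<Gamma>' c where lim: "\<Gamma>' \<in> weak_limits \<Gamma>" and comb: "bounded_comb \<Gamma>' N c 1"
        and off: "\<And>g. g \<notin> \<Gamma>' \<Longrightarrow> c g = 0" and c0: "c 0 \<noteq> 0"
        and null: "\<And>y. (\<Sum>\<^sub>\<infinity>g\<in>\<Gamma>'. c g * G (y - g)) = 0" by blast
      interpret bounded_comb \<Gamma>' N c 1 by (rule comb)
      have at: "atoms c \<subseteq> \<Gamma>'" using off by (auto simp: atoms_def)
      obtain v where v: "crystalline_measure c v" "atoms v \<subseteq> Zer (fourier G)"
        using crystalline_of_null[OF G assms(3) null fin off] by blast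
      have "atoms c \<noteq> {}" using c0 by (auto simp: atoms_def)
      moreover have "sparse_measure c" unfolding sparse_measure_def
        by (rule spaced_imp_separated_set(1)[OF spaced_subset[OF spaced at]])
      moreover have "bounded_coefficients c" unfolding bounded_coefficients_def bounded_iff
        using c_le at by (intro exI[of _ 1]) auto
      moreover have "supports_measure \<Gamma>' c" using at by (simp add: supports_measure_def)
      ultimately show False using no lim v by blast
    qed
  qed
qed

end
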